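(* The task ListMinSep can be solved with polynomial delay $O(n^3)$: there is an algorithm that, given an ancestral graph $G=(V,E)$ with $n$ nodes, pairwise disjoint sets $X,Y,R\subseteq V$ with $X,Y$ non-empty, and a set $I\subseteq R$, enumerates all $I$-minimal $m$-separators $Z$ relative to $(X,Y)$ with $I\subseteq Z\subseteq R$, with delay $O(n^3)$.
   Context: A mixed graph has directed ($A\to B$), undirected ($A-B$) and bidirected ($A\leftrightarrow B$) edges. A path is a sequence of distinct nodes with consecutive nodes adjacent. $U$ is an ancestor of $W$ if there is a directed path $U\to\cdots\to W$; $U$ is an anterior of $W$ if there is a path from $U$ to $W$ that becomes directed after replacing each undirected edge $S-T$ on it (traversed from $S$ to $T$) by $S\to T$. Every node is its own ancestor and anterior. A mixed graph is an ancestral graph if (1) for each edge $A\gets B$ or $A\leftrightarrow B$, $A$ is not an anterior of $B$, and (2) for each edge $A-B$ there are no edges $A\gets C$, $A\leftrightarrow C$, $B\gets C$ or $B\leftrightarrow C$. A node on a path is a collider if two arrowheads of the path meet at it. Nodes $U,W$ are $m$-connected by $Z$ if there is a path between them on which every collider is in $An(Z)$ (the set of ancestors of $Z$) and every non-collider is not in $Z$; otherwise $Z$ $m$-separates them. $Z$ is an $m$-separator relative to $(X,Y)$ if it $m$-separates every $U\in X$ from every $W\in Y$. An $m$-separator $Z$ relative to $(X,Y)$ is $I$-minimal if $I\subseteq Z$ and no $Z'\subsetneq Z$ with $I\subseteq Z'$ is an $m$-separator relative to $(X,Y)$. Delay $O(f)$ means that at most $O(f)$ time passes between the start of the algorithm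 or the output of a solution and the output of the next solution or the end of the algorithm (standard RAM model). *)

theory Defs
  imports Main
begin

record 'v mixed_graph =
  nodes :: "'v set"
  dir :: "('v \<times> 'v) set"
  und :: "('v \<times> 'v) set"
  bid :: "('v \<times> 'v) set"

text \<open>A pair (A, B) in \<^term>\<open>dir\<close> is the edge from A to B. Undirected and bidirected edges
  are represented by both of their orientations.\<close>

definition mixed_graph :: "'v mixed_graph \<Rightarrow> bool" where
  "mixed_graph G \<longleftrightarrow>
     finite (nodes G) \<and>
     dir G \<subseteq> nodes G \<times> nodes G \<and> und G \<subseteq> nodes G \<times> nodes G \<and> bid G \<subseteq> nodes G \<times> nodes G \<and>
     irrefl (dir G) \<and> irrefl (und G) \<and> irrefl (bid G) \<and>
     sym (und G) \<and> sym (bid G)"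

definition adjacent :: "'v mixed_graph \<Rightarrow> 'v \<Rightarrow> 'v \<Rightarrow> bool" where
  "adjacent G A B \<longleftrightarrow> (A, B) \<in> dir G \<or> (B, A) \<in> dir G \<or> (A, B) \<in> und G \<or> (A, B) \<in> bid G"

definition path_between :: "'v mixed_graph \<Rightarrow> 'v \<Rightarrow> 'v list \<Rightarrow> 'v \<Rightarrow> bool" where
  "path_between G U p W \<longleftrightarrow>
     p \<noteq> [] \<and> hd p = U \<and> last p = W \<and> distinct p \<and> set p \<subseteq> nodes G \<and>
     successively (adjacent G) p"

definition ancestor :: "'v mixed_graph \<Rightarrow> 'v \<Rightarrow> 'v \<Rightarrow> bool" where
  "ancestor G U W \<longleftrightarrow>
     (\<exists>p. path_between G U p W \<and> successively (\<lambda>S T. (S, T) \<in> dir G) p)"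

definition anterior :: "'v mixed_graph \<Rightarrow> 'v \<Rightarrow> 'v \<Rightarrow> bool" where
  "anterior G U W \<longleftrightarrow>
     (\<exists>p. path_between G U p W \<and> successively (\<lambda>S T. (S, T) \<in> dir G \<or> (S, T) \<in> und G) p)"

definition An :: "'v mixed_graph \<Rightarrow> 'v set \<Rightarrow> 'v set" where
  "An G Z = {U. \<exists>W\<in>Z. ancestor G U W}"

definition ancestral_graph :: "'v mixed_graph \<Rightarrow> bool" where
  "ancestral_graph G \<longleftrightarrow>
     mixed_graph G \<and>
     (\<forall>A B. (B, A) \<in> dir G \<or> (A, B) \<in> bid G \<longrightarrow> \<not> anterior G A B) \<and>
     (\<forall>A B. (A, B) \<in> und G \<longrightarrow>
        (\<forall>C. (C, A) \<notin> dir G \<and> (A, C) \<notin> bid G \<and> (C, B) \<notin> dir G \<and> (B, C) \<notin> bid G))"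

definition arrowhead_at :: "'v mixed_graph \<Rightarrow> 'v \<Rightarrow> 'v \<Rightarrow> bool" where
  "arrowhead_at G A B \<longleftrightarrow> (A, B) \<in> dir G \<or> (A, B) \<in> bid G"

text \<open>An ancestral graph has at most one edge between any two nodes, so the node sequence of
  a path determines its edges. The endpoints of a path are non-colliders.\<close>

definition collider :: "'v mixed_graph \<Rightarrow> 'v list \<Rightarrow> nat \<Rightarrow> bool" where
  "collider G p i \<longleftrightarrow>
     0 < i \<and> Suc i < length p \<and>
     arrowhead_at G (p ! (i - 1)) (p ! i) \<and> arrowhead_at G (p ! Suc i) (p ! i)"

definition m_connected :: "'v mixed_graph \<Rightarrow> 'v set \<Rightarrow> 'v \<Rightarrow> 'v \<Rightarrow> bool" where
  "m_connected G Z U W \<longleftrightarrow>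
     (\<exists>p. path_between G U p W \<and>
        (\<forall>i<length p. if collider G p i then p ! i \<in> An G Z else p ! i \<notin> Z))"

definition m_separator :: "'v mixed_graph \<Rightarrow> 'v set \<Rightarrow> 'v set \<Rightarrow> 'v set \<Rightarrow> bool" where
  "m_separator G X Y Z \<longleftrightarrow> (\<forall>U\<in>X. \<forall>W\<in>Y. \<not> m_connected G Z U W)"

definition minimal_m_separator ::
    "'v mixed_graph \<Rightarrow> 'v set \<Rightarrow> 'v set \<Rightarrow> 'v set \<Rightarrow> 'v set \<Rightarrow> bool" where
  "minimal_m_separator G X Y I Z \<longleftrightarrow>
     m_separator G X Y Z \<and> I \<subseteq> Z \<and> (\<nexists>Z'. Z' \<subset> Z \<and> I \<subseteq> Z' \<and> m_separator G X Y Z')"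

text \<open>A random access machine with unit cost for every instruction and indirect addressing by
  \<open>Load\<close> and \<open>Store\<close>. The input is a separate read-only array accessed by \<open>Read\<close>. A solution is
  printed number by number with \<open>Emit\<close> and is completed by \<open>EndSol\<close>.\<close>

datatype instr =
    Const nat nat
  | Add nat nat nat
  | Sub nat nat nat
  | Load nat nat
  | Store nat nat
  | Read nat nat
  | Jump nat
  | JumpZero nat nat
  | Emit nat
  | EndSol

text \<open>The field \<open>printed\<close> holds the completed solutions, each with the time of its completion;
  \<open>partial\<close> holds what has been printed of the next one.\<close>

record ram_state =
  pc :: nat
  mem :: "nat \<Rightarrow> nat"
  clock :: nat
  partial :: "nat list"
  printed :: "(nat \<times> nat list) list"

definition ram_init :: ram_state where
  "ram_init = \<lparr>pc = 0, mem = (\<lambda>_. 0), clock = 0, partial = [], printed = []\<rparr>"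

fun exec_instr :: "nat list \<Rightarrow> instr \<Rightarrow> ram_state \<Rightarrow> ram_state" where
  "exec_instr inp (Const r k) s = s\<lparr>mem := (mem s)(r := k)\<rparr>"
| "exec_instr inp (Add r a b) s = s\<lparr>mem := (mem s)(r := mem s a + mem s b)\<rparr>"
| "exec_instr inp (Sub r a b) s = s\<lparr>mem := (mem s)(r := mem s a - mem s b)\<rparr>"
| "exec_instr inp (Load r a) s = s\<lparr>mem := (mem s)(r := mem s (mem s a))\<rparr>"
| "exec_instr inp (Store a r) s = s\<lparr>mem := (mem s)(mem s a := mem s r)\<rparr>"
| "exec_instr inp (Read r a) s =
     s\<lparr>mem := (mem s)(r := (if mem s a < length inp then inp ! mem s a else 0))\<rparr>"
| "exec_instr inp (Jump l) s = s\<lparr>pc := l\<rparr>"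
| "exec_instr inp (JumpZero r l) s = (if mem s r = 0 then s\<lparr>pc := l\<rparr> else s)"
| "exec_instr inp (Emit r) s = s\<lparr>partial := partial s @ [mem s r]\<rparr>"
| "exec_instr inp EndSol s =
     s\<lparr>partial := [], printed := printed s @ [(clock s, partial s)]\<rparr>"

definition halted :: "instr list \<Rightarrow> ram_state \<Rightarrow> bool" where
  "halted P s \<longleftrightarrow> length P \<le> pc s"

definition ram_step :: "instr list \<Rightarrow> nat list \<Rightarrow> ram_state \<Rightarrow> ram_state" where
  "ram_step P inp s =
     (if halted P s then s
      else exec_instr inp (P ! pc s) (s\<lparr>pc := Suc (pc s), clock := Suc (clock s)\<rparr>))"

definition ram_run :: "instr list \<Rightarrow> nat list \<Rightarrow> nat \<Rightarrow> ram_state" where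
  "ram_run P inp t = (ram_step P inp ^^ t) ram_init"

text \<open>The program halts, having printed each member of the family exactly once (as a list of
  its elements), and at most \<open>d\<close> time units pass between the start or the completion of a
  solution and the completion of the next solution or the end.\<close>

definition enumerates_with_delay ::
    "instr list \<Rightarrow> nat list \<Rightarrow> nat set set \<Rightarrow> nat \<Rightarrow> bool" where
  "enumerates_with_delay P inp F d \<longleftrightarrow>
     (\<exists>T. let s = ram_run P inp T; sols = map (\<lambda>(t, xs). set xs) (printed s) in
        halted P s \<and> partial s = [] \<and>
        distinct sols \<and> set sols = F \<and>
        successively (\<lambda>t t'. t' \<le> t + d) (0 # map fst (printed s) @ [clock s]))"

text \<open>Charging one time unit per instruction presupposes that registers hold machine words.
  A bound that is polynomial in the number of nodes corresponds to words of logarithmic length.\<close>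

definition words_below :: "instr list \<Rightarrow> nat list \<Rightarrow> nat \<Rightarrow> bool" where
  "words_below P inp b \<longleftrightarrow> (\<forall>t a. mem (ram_run P inp t) a < b)"

definition set_bits :: "nat \<Rightarrow> nat set \<Rightarrow> nat list" where
  "set_bits n A = map (\<lambda>i. of_bool (i \<in> A)) [0..<n]"

definition adjacency_matrix :: "nat \<Rightarrow> (nat \<times> nat) set \<Rightarrow> nat list" where
  "adjacency_matrix n E = concat (map (\<lambda>i. map (\<lambda>j. of_bool ((i, j) \<in> E)) [0..<n]) [0..<n])"

definition encode_instance ::
    "nat \<Rightarrow> nat mixed_graph \<Rightarrow> nat set \<Rightarrow> nat set \<Rightarrow> nat set \<Rightarrow> nat set \<Rightarrow> nat list" where
  "encode_instance n G X Y R I =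
     n # set_bits n X @ set_bits n Y @ set_bits n R @ set_bits n I @
     adjacency_matrix n (dir G) @ adjacency_matrix n (und G) @ adjacency_matrix n (bid G)"

end

theory Submission
  imports Defs
begin

text \<open>Let \<open>M\<close> be the set of anteriors of \<open>X \<union> Y \<union> I\<close>. An \<open>I\<close>-minimal m-separator is a subset of
  \<open>M\<close>, and a set \<open>Z\<close> with \<open>I \<subseteq> Z \<subseteq> M\<close> is an m-separator iff \<open>Z - I\<close> separates \<open>X\<close> from \<open>Y\<close> in
  an undirected graph on \<open>M - I\<close> and a second, non-deletable copy of \<open>M\<close>, whose nodes stand for
  the passages of a path through a collider. So the task is to list minimal vertex separators.

  A minimal separator \<open>S\<close> is the neighbourhood of its side \<open>C\<close>, the set of nodes reachable from \<open>X\<close>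
  without entering \<open>S\<close>. Given a side \<open>A\<close> and a neighbour \<open>v\<close> of \<open>A\<close>, there is a least side that
  contains \<open>A\<close> and \<open>v\<close>, and it is found by three graph searches. The sides \<open>C \<supseteq> A\<close> that avoid a
  set \<open>U\<close> are therefore the leaves of a binary tree: either \<open>v \<in> C\<close>, and \<open>A\<close> is replaced by the least
  side, or \<open>v \<notin> C\<close>, and \<open>v\<close> is added to \<open>U\<close>. In the second case \<open>A\<close> itself remains a solution,
  and in the first case a solution exists iff the least side avoids \<open>U\<close>, so no branch is
  a dead end. The next leaf is found by flipping the last left turn of the current one and
  descending from there, which takes \<open>n\<close> steps of quadratic time.

  The program consists of loops whose number of iterations is at most \<open>2 n\<close>, except for one loop
  over the solutions, so its delay can be read off the nesting depth.\<close>

section \<open>Minimal separators of undirected graphs\<close>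

text \<open>The obstacle is that a collider is tested against \<open>An G Z\<close>, so the walks
  that \<open>Z\<close> leaves open are not simply those that avoid \<open>Z\<close>. Hence
  colliders are passable whatever \<open>Z\<close> is, which is why their copies are not deletable.
  The edges of \<open>E\<close> are local: consecutive colliders are joined by a bidirected edge
  between copies, so no closure over collider chains is computed. Elements of \<open>I\<close>
  vanish as ordinary nodes but keep their copies. No stack of states is stored. The word of turns of
  the last leaf suffices to recompute the next one from the root, at the price of a constant number
  of quadratic searches per level. Word size needs its own argument: variable 8 is a computed cap of
  order \<open>n^2\<close>, and by a syntactic criterion no stored value exceeds it.\<close>

definition reach :: "('a \<times> 'a) set \<Rightarrow> 'a set \<Rightarrow> 'a set \<Rightarrow> 'a set" where
  "reach E S A = (E \<inter> UNIV \<times> - S)\<^sup>* `` A"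

definition nb :: "('a \<times> 'a) set \<Rightarrow> 'a set \<Rightarrow> 'a set" where
  "nb E A = E `` A - A"

text \<open>Holds even where \<open>A\<close> meets \<open>S\<close>, because only the targets of
  edges are tested against \<open>S\<close>.\<close>

lemma reach_refl: "A \<subseteq> reach E S A"
  by (auto simp: reach_def)

lemma reach_step: "u \<in> reach E S A \<Longrightarrow> (u, w) \<in> E \<Longrightarrow> w \<notin> S \<Longrightarrow> w \<in> reach E S A"
  by (auto simp: reach_def intro: rtrancl_into_rtrancl)

lemma reach_least:
  assumes "A \<subseteq> C" "\<And>u w. u \<in> C \<Longrightarrow> (u, w) \<in> E \<Longrightarrow> w \<notin> S \<Longrightarrow> w \<in> C"
  shows "reach E S A \<subseteq> C"
proof
  fix v assume "v \<in> reach E S A"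
  then obtain a where "a \<in> A" "(a, v) \<in> (E \<inter> UNIV \<times> - S)\<^sup>*" by (auto simp: reach_def)
  from this(2) show "v \<in> C"
    by (induction rule: rtrancl_induct) (use \<open>a \<in> A\<close> assms in auto)
qed

lemma reach_mono: "A \<subseteq> B \<Longrightarrow> S' \<subseteq> S \<Longrightarrow> reach E S A \<subseteq> reach E S' B"
  by (rule reach_least) (use reach_refl[of B E S'] in \<open>auto intro: reach_step\<close>)

lemma nb_reach: "nb E (reach E S A) \<subseteq> S"
  by (auto simp: nb_def intro: reach_step)

lemma reach_disjoint: "A \<inter> S = {} \<Longrightarrow> reach E S A \<inter> S = {}"
  using reach_least[of A "- S" E S] by auto

section \<open>Minimal separators and their two sides\<close>

locale separation =
  fixes E :: "('a \<times> 'a) set" and X Y D :: "'a set"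
  assumes E_sym: "sym E" and XD: "X \<inter> D = {}" and YD: "Y \<inter> D = {}"
begin

definition sep :: "'a set \<Rightarrow> bool" where
  "sep S \<longleftrightarrow> S \<subseteq> D \<and> reach E S X \<inter> Y = {}"

definition min_sep :: "'a set \<Rightarrow> bool" where
  "min_sep S \<longleftrightarrow> sep S \<and> (\<forall>S'. S' \<subset> S \<longrightarrow> \<not> sep S')"

text \<open>Since \<open>E\<close> is symmetric, a step from outside the part of \<open>X\<close>
  into it could be reversed, unless it starts in \<open>S\<close>. So the complement of that part,
  minus \<open>S\<close>, is closed under the search from \<open>Y\<close>.\<close>

lemma reach_XY_disjoint:
  assumes "sep S" shows "reach E S X \<inter> reach E S Y = {}"
proof -
  have "S \<subseteq> D" and d: "reach E S X \<inter> Y = {}" using assms by (auto simp: sep_def)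
  have "reach E S X \<inter> S = {}"
    using reach_disjoint[of X S E] XD \<open>S \<subseteq> D\<close> by blast
  then have "reach E S Y \<subseteq> - reach E S X - S"
    using d E_sym YD \<open>S \<subseteq> D\<close> by (intro reach_least) (auto dest: symD intro: reach_step)
  then show ?thesis by blast
qed

lemma min_sep_iff:
  "min_sep S \<longleftrightarrow> sep S \<and> S \<subseteq> E `` reach E S X \<and> S \<subseteq> E `` reach E S Y"
proof
  assume m: "min_sep S"
  then have s: "sep S" by (simp add: min_sep_def)
  have a: "s \<in> E `` reach E S X \<and> s \<in> E `` reach E S Y" if "s \<in> S" for s
  proof (rule ccontr)
    assume c: "\<not> ?thesis"
    have "s \<in> D" using that s by (auto simp: sep_def)
    have "sep (S - {s})"
    proof (cases "s \<in> E `` reach E S X")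
      \<comment> \<open>Without \<open>s\<close> in the separator the search from \<open>X\<close>
        gains nothing, because it never gets to \<open>s\<close>.\<close>
      case False
      then have "reach E (S - {s}) X \<subseteq> reach E S X"
        using reach_refl[of X E S] by (intro reach_least) (auto intro: reach_step)
      then show ?thesis using s by (auto simp: sep_def)
    next
      \<comment> \<open>Now \<open>s\<close> may join the part of \<open>X\<close>, but it does not
        touch the part of \<open>Y\<close>, so the complement of the latter stays closed.\<close>
      case True
      with c have "s \<notin> E `` reach E S Y" by blast
      moreover have "reach E S Y \<inter> S = {}"
        using s YD by (intro reach_disjoint) (auto simp: sep_def)
      moreover have "X \<inter> S = {}" using s XD by (auto simp: sep_def)
      ultimately have "reach E (S - {s}) X \<subseteq> - reach E S Y - (S - {s})"
        using reach_refl[of X E S] reach_XY_disjoint[OF s] E_sym that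
        by (intro reach_least) (auto dest: symD intro: reach_step)
      then show ?thesis using s reach_refl[of Y E S] by (auto simp: sep_def)
    qed
    then show False using m that by (auto simp: min_sep_def)
  qed
  then show "sep S \<and> S \<subseteq> E `` reach E S X \<and> S \<subseteq> E `` reach E S Y"
    using s by blast
next
  assume A: "sep S \<and> S \<subseteq> E `` reach E S X \<and> S \<subseteq> E `` reach E S Y"
  have "\<not> sep S'" if S': "S' \<subset> S" for S'
  proof
    assume s': "sep S'"
    obtain s where s: "s \<in> S" "s \<notin> S'" using S' by blast
    obtain u w where u: "u \<in> reach E S X" "(u, s) \<in> E" and w: "w \<in> reach E S Y" "(w, s) \<in> E"
      using A s by blast
    have "reach E S X \<subseteq> reach E S' X" "reach E S Y \<subseteq> reach E S' Y"
      using S' by (meson order_refl psubset_imp_subset reach_mono)+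
    then have "s \<in> reach E S' X" "s \<in> reach E S' Y"
      using u w s by (auto intro: reach_step)
    then show False using reach_XY_disjoint[OF s'] by blast
  qed
  then show "min_sep S" using A by (auto simp: min_sep_def)
qed

lemma min_sep_nb:
  assumes "min_sep S" shows "nb E (reach E S X) = S"
proof
  have "reach E S X \<inter> S = {}"
    using assms XD by (intro reach_disjoint) (auto simp: min_sep_def sep_def)
  then show "S \<subseteq> nb E (reach E S X)"
    using assms by (auto simp: min_sep_iff nb_def)
qed (rule nb_reach)

text \<open>Minimal separators are pairwise incomparable, whereas among the sides that contain a
  given side and one of its neighbours there is a least one, if there is any. The search therefore
  runs over sides.\<close>

definition side :: "'a set \<Rightarrow> bool" where
  "side C \<longleftrightarrow> (\<exists>S. min_sep S \<and> C = reach E S X)"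

lemma side_nb: "side C \<Longrightarrow> min_sep (nb E C) \<and> C = reach E (nb E C) X"
  using min_sep_nb by (auto simp: side_def)

lemma side_X: "side C \<Longrightarrow> X \<subseteq> C"
  using reach_refl by (fastforce simp: side_def)

lemma min_sep_image: "{S. min_sep S} = nb E ` {C. side C}"
  using min_sep_nb side_nb unfolding side_def by blast

lemma nb_inj: "inj_on (nb E) {C. side C}"
  by (rule inj_onI) (metis side_nb mem_Collect_eq)

section \<open>Least sides above a given set\<close>

definition grow :: "'a set \<Rightarrow> 'a set" where
  "grow B = reach E D B"

definition far :: "'a set \<Rightarrow> 'a set" where
  "far B = reach E (nb E (grow B)) Y"

text \<open>\<open>grow B\<close> adds to \<open>B\<close> what no separator can cut off, as only
  \<open>D\<close> is deletable. If it misses \<open>Y\<close>, its neighbourhood separates but may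
  contain nodes that do not touch the part of \<open>Y\<close>. Passing to
  \<open>nb E (far B)\<close> discards these, and \<open>star B\<close> is the resulting part of
  \<open>X\<close>.\<close>

definition star :: "'a set \<Rightarrow> 'a set" where
  "star B = reach E (nb E (far B)) X"

lemma nb_grow: "nb E (grow B) \<subseteq> D"
  unfolding grow_def by (rule nb_reach)

lemma nb_far: "nb E (far B) \<subseteq> nb E (grow B)"
  unfolding far_def by (rule nb_reach)

lemma far_grow_disjoint:
  assumes "grow B \<inter> Y = {}" shows "far B \<inter> grow B = {}"
proof -
  let ?T = "nb E (grow B)"
  have "far B \<subseteq> - grow B - ?T"
    unfolding far_def
  proof (rule reach_least)
    show "Y \<subseteq> - grow B - ?T" using assms nb_grow[of B] YD by blast
  next
    fix u w assume "u \<in> - grow B - ?T" "(u, w) \<in> E" "w \<notin> ?T"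
    then show "w \<in> - grow B - ?T" using E_sym by (auto simp: nb_def dest: symD)
  qed
  then show ?thesis by blast
qed

lemma star_far_disjoint:
  assumes "grow B \<inter> Y = {}" "X \<subseteq> B" shows "star B \<inter> far B = {}"
proof -
  let ?S = "nb E (far B)"
  have "star B \<subseteq> - far B - ?S"
    unfolding star_def
  proof (rule reach_least)
    have "X \<subseteq> grow B" using assms(2) reach_refl by (fastforce simp: grow_def)
    then show "X \<subseteq> - far B - ?S"
      using far_grow_disjoint[OF assms(1)] nb_grow[of B] nb_far[of B] XD by blast
  next
    fix u w assume "u \<in> - far B - ?S" "(u, w) \<in> E" "w \<notin> ?S"
    then show "w \<in> - far B - ?S" using E_sym by (auto simp: nb_def dest: symD)
  qed
  then show ?thesis by blast
qed

text \<open>A side \<open>C\<close> above \<open>B\<close> contains \<open>grow B\<close>, so the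
  part of \<open>Y\<close> that belongs to \<open>C\<close> lies in \<open>far B\<close>. Every node
  of \<open>nb E C\<close> touches that part. Were the search for \<open>star B\<close> to leave
  \<open>C\<close>, it would do so at such a node, which would then be in \<open>far B\<close>,
  against \<open>star_far_disjoint\<close>.\<close>

lemma star_least:
  assumes C: "side C" and B: "B \<subseteq> C" "X \<subseteq> B"
  shows "grow B \<inter> Y = {} \<and> star B \<subseteq> C"
proof -
  define S where "S = nb E C"
  have m: "min_sep S" and CS: "C = reach E S X" using side_nb[OF C] unfolding S_def by blast+
  have s: "sep S" using m by (simp add: min_sep_def)
  have g: "grow B \<subseteq> C"
    unfolding grow_def
  proof (rule reach_least)
    fix u w assume "u \<in> C" "(u, w) \<in> E" "w \<notin> D"
    then show "w \<in> C" using s CS reach_step[of u E S X w] unfolding sep_def by blast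
  qed (use B in auto)
  have CY: "C \<inter> reach E S Y = {}" using reach_XY_disjoint[OF s] CS by simp
  have Yg: "grow B \<inter> Y = {}" using g CY reach_refl[of Y E S] by blast
  have RS: "reach E S Y \<inter> S = {}" using s YD by (intro reach_disjoint) (auto simp: sep_def)
  have T: "w \<notin> nb E (grow B)" if "w \<in> reach E S Y" for w
  proof
    assume "w \<in> nb E (grow B)"
    then have "w \<in> E `` C" using g by (auto simp: nb_def)
    then have "w \<in> S" using that CY by (auto simp: nb_def S_def)
    then show False using that RS by blast
  qed
  have "reach E S Y \<subseteq> far B \<inter> reach E S Y"
    unfolding far_def
  proof (rule reach_least)
    fix u w assume u: "u \<in> reach E (nb E (grow B)) Y \<inter> reach E S Y" "(u, w) \<in> E" "w \<notin> S"
    then have "w \<in> reach E S Y" using reach_step[of u E S Y w] by blast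
    then show "w \<in> reach E (nb E (grow B)) Y \<inter> reach E S Y"
      using u T[of w] reach_step[of u E "nb E (grow B)" Y w] by blast
  qed (use reach_refl[of Y E] in simp)
  then have RF: "reach E S Y \<subseteq> far B" by blast
  have "star B \<subseteq> C \<inter> star B" unfolding star_def
  proof (rule reach_least)
    show "X \<subseteq> C \<inter> reach E (nb E (far B)) X"
      using reach_refl[of X E] side_X[OF C] by simp
  next
    fix u w assume u: "u \<in> C \<inter> reach E (nb E (far B)) X" "(u, w) \<in> E" "w \<notin> nb E (far B)"
    then have w: "w \<in> star B"
      unfolding star_def using reach_step[of u E "nb E (far B)" X w] by simp
    moreover have "w \<in> C"
    proof (rule ccontr)
      assume "w \<notin> C"
      then have "w \<in> S" using u by (auto simp: S_def nb_def)
      then have "w \<in> E `` reach E S Y" using m unfolding min_sep_iff by blast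
      then have "w \<in> far B" using RF u by (auto simp: nb_def)
      then show False using w star_far_disjoint[OF Yg B(2)] by blast
    qed
    ultimately show "w \<in> C \<inter> reach E (nb E (far B)) X" by (simp add: star_def)
  qed
  then show ?thesis using Yg by blast
qed

text \<open>The second hypothesis says that every element of \<open>B\<close> is connected to \<open>X\<close> within \<open>B\<close>.\<close>

lemma star_side:
  assumes B: "X \<subseteq> B" "B \<subseteq> reach E (- B) X" and Yg: "grow B \<inter> Y = {}"
  shows "side (star B) \<and> B \<subseteq> star B"
proof -
  let ?S = "nb E (far B)"
  have Bg: "B \<subseteq> grow B" unfolding grow_def by (rule reach_refl)
  have S: "?S \<subseteq> nb E (grow B)" "?S \<subseteq> D" using nb_far nb_grow by blast+
  have gS: "grow B \<inter> ?S = {}" using S(1) by (auto simp: nb_def)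
  have "B \<subseteq> star B" unfolding star_def
  proof -
    have "?S \<subseteq> - B" using Bg gS by blast
    then show "B \<subseteq> reach E ?S X" using B(2) reach_mono[of X X ?S "- B" E] by simp
  qed
  have "grow B \<subseteq> grow B \<inter> star B"
    unfolding grow_def
  proof (rule reach_least)
    show "B \<subseteq> reach E D B \<inter> star B" using \<open>B \<subseteq> star B\<close> reach_refl[of B E D] by simp
  next
    fix u w assume "u \<in> reach E D B \<inter> star B" "(u, w) \<in> E" "w \<notin> D"
    then show "w \<in> reach E D B \<inter> star B"
      using S(2) reach_step[of u E D B w] reach_step[of u E ?S X w] unfolding star_def by auto
  qed
  then have gs: "grow B \<subseteq> star B" by blast
  have Yf: "Y \<subseteq> far B" unfolding far_def by (rule reach_refl)
  have sep: "sep ?S"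
    using S(2) star_far_disjoint[OF Yg B(1)] Yf by (auto simp: sep_def star_def)
  have "far B \<subseteq> reach E ?S Y"
    unfolding far_def[of B] using S(1) by (intro reach_mono) (auto simp: far_def)
  then have "?S \<subseteq> E `` reach E ?S Y" by (auto simp: nb_def)
  moreover have "?S \<subseteq> E `` reach E ?S X"
    using S(1) gs by (auto simp: nb_def star_def)
  ultimately have "min_sep ?S" using sep min_sep_iff by blast
  then show ?thesis using \<open>B \<subseteq> star B\<close> by (auto simp: side_def star_def)
qed

text \<open>Together with \<open>insert_connected\<close> this supplies the connectivity that
  \<open>star_side\<close> asks of a side enlarged by one neighbour.\<close>

lemma side_connected:
  assumes "side C" shows "C \<subseteq> reach E (- C) X"
proof -
  have C: "C = reach E (nb E C) X" using side_nb[OF assms] by blast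
  have XC: "X \<subseteq> C" using side_X[OF assms] .
  have "reach E (nb E C) X \<subseteq> C \<inter> reach E (- C) X"
  proof (rule reach_least)
    show "X \<subseteq> C \<inter> reach E (- C) X" using XC reach_refl[of X E] by simp
  next
    fix u w assume "u \<in> C \<inter> reach E (- C) X" "(u, w) \<in> E" "w \<notin> nb E C"
    then show "w \<in> C \<inter> reach E (- C) X" 
      using reach_step[of u E "- C" X w] by (auto simp: nb_def)
  qed
  then show ?thesis using C by blast
qed

lemma insert_connected:
  assumes "side C" "v \<in> nb E C" shows "insert v C \<subseteq> reach E (- insert v C) X"
proof -
  have C: "C \<subseteq> reach E (- insert v C) X"
    using side_connected[OF assms(1)] reach_mono[of X X "- insert v C" "- C" E] by blast
  moreover obtain u where "u \<in> C" "(u, v) \<in> E" using assms(2) by (auto simp: nb_def)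
  ultimately show ?thesis using reach_step[of u E "- insert v C" X v] by blast
qed

lemma side_nb_D: "side C \<Longrightarrow> nb E C \<subseteq> D"
  using side_nb by (auto simp: min_sep_def sep_def)

definition sols :: "'a set \<times> 'a set \<Rightarrow> 'a set set" where
  "sols s = {C. side C \<and> fst s \<subseteq> C \<and> C \<inter> snd s = {}}"

text \<open>A larger side would have to leave \<open>A\<close> through a neighbour of
  \<open>A\<close>, and all of these are forbidden by \<open>U\<close>.\<close>

lemma sols_leaf:
  assumes "side A" "A \<inter> U = {}" "nb E A \<subseteq> U" shows "sols (A, U) = {A}"
proof -
  have "C = A" if C: "side C" "A \<subseteq> C" "C \<inter> U = {}" for C
  proof -
    have "reach E (nb E C) X \<subseteq> A"
    proof (rule reach_least)
      show "X \<subseteq> A" using side_X assms(1) .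
    next
      fix u w assume "u \<in> A" "(u, w) \<in> E" "w \<notin> nb E C"
      then show "w \<in> A" using C assms(3) by (auto simp: nb_def)
    qed
    then show ?thesis using side_nb[OF C(1)] C(2) by blast
  qed
  then show ?thesis using assms by (auto simp: sols_def)
qed

end

text \<open>A binary search tree over states in which the left child of a node need not exist (it does
  when \<open>feas\<close> holds) while the right child always does. A leaf at depth \<open>m\<close> is named by its list
  of turns, with \<open>True\<close> for left.\<close>

locale binary_tree =
  fixes feas :: "'s \<Rightarrow> bool" and l r :: "'s \<Rightarrow> 's"
begin

fun leaves :: "nat \<Rightarrow> 's \<Rightarrow> 's list" where
  "leaves 0 s = [s]"
| "leaves (Suc m) s = (if feas s then leaves m (l s) else []) @ leaves m (r s)"

text \<open>The leaves to the right of the one named \<open>w\<close>.\<close>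

fun later :: "nat \<Rightarrow> 's \<Rightarrow> bool list \<Rightarrow> 's list" where
  "later (Suc m) s (b # w) = (if b then later m (l s) w @ leaves m (r s) else later m (r s) w)"
| "later _ s _ = []"

text \<open>Follows the first \<open>p - 1\<close> turns of \<open>w\<close>, turns right if \<open>p > 0\<close>, and then goes left
  whenever that is feasible. With \<open>p\<close> the position of the last left turn of \<open>w\<close>, this leads to
  the next leaf.\<close>

fun descend :: "nat \<Rightarrow> nat \<Rightarrow> bool list \<Rightarrow> 's \<Rightarrow> 's \<times> bool list" where
  "descend p 0 w s = (s, [])"
| "descend p (Suc m) w s =
     (let b = (feas s \<and> (p = 0 \<or> 1 < p \<and> hd w));
          (s', w') = descend (p - 1) m (tl w) (if b then l s else r s)
      in (s', b # w'))"

fun fits :: "'s \<Rightarrow> bool list \<Rightarrow> bool" where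
  "fits s [] \<longleftrightarrow> True"
| "fits s (b # w) \<longleftrightarrow> (b \<longrightarrow> feas s) \<and> fits (if b then l s else r s) w"

text \<open>One-based, so that \<open>0\<close> can stand for the absence of left turns.\<close>

fun last_left :: "bool list \<Rightarrow> nat" where
  "last_left [] = 0"
| "last_left (b # w) = (if last_left w \<noteq> 0 then Suc (last_left w) else if b then 1 else 0)"

text \<open>Position \<open>0\<close> means a left turn wherever that is feasible, so the descent
  ends in the first leaf.\<close>

lemma leaves_descend:
  "leaves m s = fst (descend 0 m w s) # later m s (snd (descend 0 m w s))"
proof (induction m arbitrary: s w)
  case (Suc m)
  show ?case
    using Suc[of "l s" "tl w"] Suc[of "r s" "tl w"]
    by (simp add: Let_def case_prod_beta)
qed simp

text \<open>After the last left turn of \<open>w\<close> only right turns follow, so the subtree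
  below that turn is exhausted and the next leaf is the first one of the right sibling.
  \<open>fits\<close> ensures that the earlier left turns are feasible and hence repeated.\<close>

lemma later_descend:
  assumes "length w = m" "fits s w"
  shows "later m s w = (if last_left w = 0 then []
    else fst (descend (last_left w) m w s) # later m s (snd (descend (last_left w) m w s)))"
  using assms
proof (induction m arbitrary: s w)
  case (Suc m)
  then obtain b w' where w: "w = b # w'" "length w' = m" by (cases w) auto
  have f: "b \<Longrightarrow> feas s" "fits (if b then l s else r s) w'" using Suc.prems(2) w by auto
  note IH = Suc.IH[OF w(2) f(2)]
  show ?case
  proof (cases "last_left w' = 0")
    case True
    show ?thesis
      using IH f(1) True leaves_descend[of m "r s" w']
      by (auto simp: w Let_def case_prod_beta)
  next
    case False
    show ?thesis
      using IH f(1) False by (auto simp: w Let_def case_prod_beta)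
  qed
qed simp

lemma fits_descend: "fits s (snd (descend p m w s))"
  by (induction m arbitrary: p w s) (simp_all add: Let_def case_prod_beta)

end

section \<open>The search tree over sides\<close>

locale nat_separation = separation E X Y D for E and X Y D :: "nat set" +
  assumes finite_D: "finite D"
begin

text \<open>The least candidate is a function of the state, so descents repeated from the root meet
  the same tree; it is also what a scan upwards from \<open>0\<close> finds.\<close>

definition pick :: "nat set \<times> nat set \<Rightarrow> nat" where
  "pick s = (LEAST v. v \<in> nb E (fst s) - snd s)"

definition branching :: "nat set \<times> nat set \<Rightarrow> bool" where
  "branching s \<longleftrightarrow> nb E (fst s) - snd s \<noteq> {}"

definition feas :: "nat set \<times> nat set \<Rightarrow> bool" where
  "feas s \<longleftrightarrow> branching s \<and> grow (insert (pick s) (fst s)) \<inter> Y = {} \<and>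
     star (insert (pick s) (fst s)) \<inter> snd s = {}"

definition incl :: "nat set \<times> nat set \<Rightarrow> nat set \<times> nat set" where
  "incl s = (star (insert (pick s) (fst s)), snd s)"

text \<open>A state without a candidate is its own right child. This pads all branches to the same
  depth, as \<open>leaves\<close> expects.\<close>

definition excl :: "nat set \<times> nat set \<Rightarrow> nat set \<times> nat set" where
  "excl s = (if branching s then (fst s, insert (pick s) (snd s)) else s)"

sublocale binary_tree feas incl excl .

lemma pick: "branching s \<Longrightarrow> pick s \<in> nb E (fst s) - snd s"
  unfolding pick_def branching_def by (rule LeastI_ex) blast

text \<open>The test in \<open>feas\<close> is exact: every solution that contains
  \<open>pick s\<close> contains \<open>star\<close> of the enlarged set, so if any of them avoids
  \<open>snd s\<close>, that least side does.\<close>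

lemma sols_branch:
  assumes s: "side (fst s)" "fst s \<inter> snd s = {}" and b: "branching s"
  shows "feas s \<Longrightarrow> side (fst (incl s)) \<and> fst (incl s) \<inter> snd (incl s) = {} \<and>
      insert (pick s) (fst s) \<subseteq> fst (incl s)"
    and "sols s = (if feas s then sols (incl s) else {}) \<union> sols (excl s)"
    and "feas s \<Longrightarrow> sols (incl s) \<inter> sols (excl s) = {}"
proof -
  let ?B = "insert (pick s) (fst s)"
  have v: "pick s \<in> nb E (fst s)" "pick s \<notin> snd s" using pick[OF b] by auto
  have XB: "X \<subseteq> ?B" using side_X[OF s(1)] by blast
  have star: "side (star ?B) \<and> ?B \<subseteq> star ?B" if "grow ?B \<inter> Y = {}"
    using star_side[OF XB insert_connected[OF s(1) v(1)] that] .
  then show L: "side (fst (incl s)) \<and> fst (incl s) \<inter> snd (incl s) = {} \<and> ?B \<subseteq> fst (incl s)"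
    if "feas s" using that by (auto simp: feas_def incl_def)
  have "C \<in> (if feas s then sols (incl s) else {})"
    if C: "C \<in> sols s" "pick s \<in> C" for C
  proof -
    have "side C" "?B \<subseteq> C" "C \<inter> snd s = {}" using C by (auto simp: sols_def)
    moreover from star_least[OF this(1,2) XB] this
    have "feas s" using b by (auto simp: feas_def)
    ultimately show ?thesis using star_least[OF _ _ XB] by (auto simp: sols_def incl_def)
  qed
  moreover have "C \<in> sols (excl s)" if "C \<in> sols s" "pick s \<notin> C" for C
    using that b by (auto simp: sols_def excl_def)
  moreover have "C \<in> sols s" if "feas s" "C \<in> sols (incl s)" for C
    using L[OF that(1)] that(2) by (auto simp: sols_def incl_def)
  moreover have "C \<in> sols s" if "C \<in> sols (excl s)" for C
    using that b by (auto simp: sols_def excl_def)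
  ultimately show "sols s = (if feas s then sols (incl s) else {}) \<union> sols (excl s)"
    by (cases "feas s") (simp_all, blast+)
  show "sols (incl s) \<inter> sols (excl s) = {}" if "feas s"
    using b L[OF that] by (auto simp: sols_def excl_def incl_def)
qed

text \<open>Each branching decides one more element of \<open>D\<close>, so a depth of at least the
  number of undecided elements suffices. Distinctness comes from the disjointness of the two
  branches.\<close>

lemma leaves_sols:
  assumes "side (fst s)" "fst s \<inter> snd s = {}"
    and "card (D - (fst s \<union> snd s)) \<le> m \<or> \<not> branching s"
  shows "set (map fst (leaves m s)) = sols s \<and> distinct (map fst (leaves m s))"
  using assms
proof (induction m arbitrary: s)
  case 0
  have "\<not> branching s"
  proof
    assume b: "branching s"
    then have "D \<subseteq> fst s \<union> snd s" using 0 finite_D by auto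
    then show False using pick[OF b] side_nb_D[OF 0(1)] by (auto simp: nb_def)
  qed
  then have "sols (fst s, snd s) = {fst s}"
    using 0 by (intro sols_leaf) (auto simp: branching_def)
  then show ?case by simp
next
  case (Suc m)
  show ?case
  proof (cases "branching s")
    case False
    then have "\<not> feas s" "excl s = s" by (simp_all add: feas_def excl_def)
    then show ?thesis
      using Suc.IH[OF Suc.prems(1,2)] False by simp
  next
    case True
    have v: "pick s \<in> D - (fst s \<union> snd s)"
      using pick[OF True] side_nb_D[OF Suc.prems(1)] by (auto simp: nb_def)
    have c: "card (D - (fst t \<union> snd t)) \<le> m"
      if "insert (pick s) (fst s \<union> snd s) \<subseteq> fst t \<union> snd t" for t
    proof -
      have "card (D - (fst t \<union> snd t)) < card (D - (fst s \<union> snd s))"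
        using that v finite_D by (intro psubset_card_mono) auto
      then show ?thesis using Suc.prems(3) True by simp
    qed
    have R: "set (map fst (leaves m (excl s))) = sols (excl s) \<and>
        distinct (map fst (leaves m (excl s)))"
      using Suc.prems(1,2) True v by (intro Suc.IH disjI1 c) (auto simp: excl_def)
    show ?thesis
    proof (cases "feas s")
      case f: True
      have "snd s \<subseteq> snd (incl s)" by (simp add: incl_def)
      then have L: "set (map fst (leaves m (incl s))) = sols (incl s) \<and>
          distinct (map fst (leaves m (incl s)))"
        using sols_branch(1)[OF Suc.prems(1,2) True f]
        by (intro Suc.IH disjI1 c) auto
      show ?thesis
        using L R sols_branch(2,3)[OF Suc.prems(1,2) True] f by auto
    next
      case False
      then show ?thesis using R sols_branch(2)[OF Suc.prems(1,2) True] by auto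
    qed
  qed
qed

end

section \<open>From m-separation to vertex separation\<close>

text \<open>Loops are erased on the way: if the new head already occurs, the path is cut back to
  that occurrence.\<close>

lemma rtrancl_distinct_list:
  assumes "(u, w) \<in> r\<^sup>*"
  shows "\<exists>p. p \<noteq> [] \<and> hd p = u \<and> last p = w \<and> distinct p \<and> successively (\<lambda>a b. (a, b) \<in> r) p"
  using assms
proof (induction rule: converse_rtrancl_induct)
  case base
  show ?case by (rule exI[of _ "[w]"]) simp
next
  case (step u v)
  then obtain p where p: "p \<noteq> []" "hd p = v" "last p = w" "distinct p"
    "successively (\<lambda>a b. (a, b) \<in> r) p" by blast
  show ?case
  proof (cases "u \<in> set p")
    case False
    with p step.hyps(1) show ?thesis
      by (intro exI[of _ "u # p"]) (auto simp: successively_Cons)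
  next
    case True
    then obtain xs ys where "p = xs @ u # ys" by (meson split_list)
    with p show ?thesis
      by (intro exI[of _ "u # ys"]) (auto simp: successively_append_iff)
  qed
qed

lemma successively_rtrancl:
  "successively (\<lambda>a b. (a, b) \<in> r) p \<Longrightarrow> p \<noteq> [] \<Longrightarrow> (hd p, last p) \<in> r\<^sup>*"
  by (induction p rule: induct_list012) (auto intro: converse_rtrancl_into_rtrancl)

lemma successively_path_nodes:
  assumes "r \<subseteq> V \<times> V" "successively (\<lambda>a b. (a, b) \<in> r) p" "p \<noteq> []" "hd p \<in> V"
  shows "set p \<subseteq> V"
  using assms(2-) by (induction p rule: induct_list012) (use assms(1) in auto)

definition ant_edges :: "'v mixed_graph \<Rightarrow> ('v \<times> 'v) set" where
  "ant_edges G = dir G \<union> und G"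

text \<open>Stated for any \<open>r\<close> within \<open>ant_edges G\<close>, so as to serve
  ancestors and anteriors alike.\<close>

lemma path_iff_rtrancl:
  assumes "mixed_graph G" "r \<subseteq> ant_edges G"
  shows "(\<exists>p. path_between G U p W \<and> successively (\<lambda>S T. (S, T) \<in> r) p) \<longleftrightarrow>
    U \<in> nodes G \<and> (U, W) \<in> r\<^sup>*" (is "?L \<longleftrightarrow> ?R")
proof
  assume ?L
  then show ?R
    unfolding path_between_def by (metis hd_in_set successively_rtrancl subsetD)
next
  assume R: ?R
  then obtain p where p: "p \<noteq> []" "hd p = U" "last p = W" "distinct p"
    "successively (\<lambda>a b. (a, b) \<in> r) p" using rtrancl_distinct_list by metis
  have "r \<subseteq> nodes G \<times> nodes G"
    using assms unfolding mixed_graph_def ant_edges_def by blast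
  then have "set p \<subseteq> nodes G" using successively_path_nodes p R by metis
  moreover have "successively (adjacent G) p"
    by (rule successively_mono[OF p(5)]) (use assms(2) in \<open>auto simp: adjacent_def ant_edges_def\<close>)
  ultimately show ?L using p unfolding path_between_def by blast
qed

lemma ancestor_iff:
  "mixed_graph G \<Longrightarrow> ancestor G U W \<longleftrightarrow> U \<in> nodes G \<and> (U, W) \<in> (dir G)\<^sup>*"
  unfolding ancestor_def by (rule path_iff_rtrancl) (auto simp: ant_edges_def)

lemma anterior_iff:
  assumes "mixed_graph G"
  shows "anterior G U W \<longleftrightarrow> U \<in> nodes G \<and> (U, W) \<in> (ant_edges G)\<^sup>*"
  using path_iff_rtrancl[OF assms, of "ant_edges G" U W]
  unfolding anterior_def by (simp add: ant_edges_def)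

section \<open>Legal walks in ancestral graphs\<close>

locale ancestral =
  fixes G :: "'v mixed_graph"
  assumes anc: "ancestral_graph G"
begin

lemma mg: "mixed_graph G"
  using anc by (simp add: ancestral_graph_def)

abbreviation arr :: "'v \<Rightarrow> 'v \<Rightarrow> bool" where
  "arr \<equiv> arrowhead_at G"

lemma edges_in_nodes:
  "dir G \<subseteq> nodes G \<times> nodes G" "und G \<subseteq> nodes G \<times> nodes G" "bid G \<subseteq> nodes G \<times> nodes G"
  using mg by (auto simp: mixed_graph_def)

lemma und_sym: "(a, b) \<in> und G \<Longrightarrow> (b, a) \<in> und G"
  using mg by (auto simp: mixed_graph_def dest: symD)

lemma bid_sym: "(a, b) \<in> bid G \<Longrightarrow> (b, a) \<in> bid G"
  using mg by (auto simp: mixed_graph_def dest: symD)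

lemma adjacent_nodes: "adjacent G a b \<Longrightarrow> a \<in> nodes G \<and> b \<in> nodes G"
  using edges_in_nodes by (auto simp: adjacent_def)

lemma adjacent_sym: "adjacent G a b \<Longrightarrow> adjacent G b a"
  using und_sym bid_sym by (auto simp: adjacent_def)

lemma adjacent_irrefl: "\<not> adjacent G a a"
  using mg by (auto simp: adjacent_def mixed_graph_def irrefl_def)

lemma arr_adjacent: "arr a b \<Longrightarrow> adjacent G a b"
  by (auto simp: arrowhead_at_def adjacent_def)

text \<open>The two arrowheads could otherwise only stem from a pair of opposite directed edges,
  which would make \<open>a\<close> an anterior of \<open>b\<close>.\<close>

lemma both_arr:
  assumes "arr a b" "arr b a" shows "(a, b) \<in> bid G"
proof (rule ccontr)
  assume "(a, b) \<notin> bid G"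
  then have d: "(a, b) \<in> dir G" "(b, a) \<in> dir G"
    using assms bid_sym by (auto simp: arrowhead_at_def)
  then have "\<not> anterior G a b" using anc unfolding ancestral_graph_def by blast
  moreover have "anterior G a b"
    using d edges_in_nodes by (auto simp: anterior_iff[OF mg] ant_edges_def)
  ultimately show False by blast
qed

lemma arr_no_und: "arr a b \<Longrightarrow> (b, c) \<notin> und G"
  using anc bid_sym unfolding ancestral_graph_def arrowhead_at_def by blast

lemma no_arr: "adjacent G b c \<Longrightarrow> \<not> arr c b \<Longrightarrow> (b, c) \<in> ant_edges G"
  using bid_sym by (auto simp: adjacent_def arrowhead_at_def ant_edges_def)

lemma arr_no_arr: "arr a b \<Longrightarrow> adjacent G b c \<Longrightarrow> \<not> arr c b \<Longrightarrow> (b, c) \<in> dir G"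
  using no_arr[of b c] arr_no_und[of a b c] by (simp add: ant_edges_def)

lemma dir_no_arr: "(b, c) \<in> dir G \<Longrightarrow> \<not> arr c b"
proof
  assume b: "(b, c) \<in> dir G" and "arr c b"
  moreover then have "arr b c" by (simp add: arrowhead_at_def)
  ultimately have "(b, c) \<in> bid G" using both_arr by blast
  then have "\<not> anterior G b c" using anc by (auto simp: ancestral_graph_def)
  then show False
    using b edges_in_nodes by (auto simp: anterior_iff[OF mg] ant_edges_def)
qed

lemma An_step: "(a, b) \<in> dir G \<Longrightarrow> b \<in> An G Z \<Longrightarrow> a \<in> An G Z"
  using edges_in_nodes
  by (auto simp: An_def ancestor_iff[OF mg] intro: converse_rtrancl_into_rtrancl)

lemma An_self: "a \<in> nodes G \<Longrightarrow> a \<in> Z \<Longrightarrow> a \<in> An G Z"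
  by (auto simp: An_def ancestor_iff[OF mg])

abbreviation walk :: "'v list \<Rightarrow> bool" where
  "walk \<equiv> successively (adjacent G)"

text \<open>The condition of \<open>m_connected\<close> on interior nodes, but for walks that may
  repeat nodes and with the ends left free. Such walks can be cut, joined and rerouted.\<close>

fun legal :: "'v set \<Rightarrow> 'v list \<Rightarrow> bool" where
  "legal Z (a # b # c # xs) \<longleftrightarrow>
     (if arr a b \<and> arr c b then b \<in> An G Z else b \<notin> Z) \<and> legal Z (b # c # xs)"
| "legal Z _ \<longleftrightarrow> True"

text \<open>The two pieces overlap in two nodes, because whether a node is a collider depends on
  both of its neighbours.\<close>

lemma legal_append:
  "legal Z (xs @ a # b # ys) \<longleftrightarrow> legal Z (xs @ [a, b]) \<and> legal Z (a # b # ys)"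
proof (induction xs rule: induct_list012)
  case (3 x y zs)
  show ?case
    by (cases zs) (use 3 in auto)
qed (cases ys; auto)+

lemma legal_rev: "legal Z (rev p) = legal Z p"
proof (induction p rule: induct_list012)
  case (3 x y zs)
  show ?case
  proof (cases zs)
    case (Cons z zs')
    have "legal Z (rev (x # y # zs)) = legal Z (rev zs' @ z # y # [x])"
      by (simp add: Cons)
    also have "\<dots> \<longleftrightarrow> legal Z (rev (y # zs)) \<and> legal Z [z, y, x]"
      by (subst legal_append) (simp add: Cons)
    also have "\<dots> \<longleftrightarrow> legal Z (x # y # zs)"
      unfolding 3 by (auto simp: Cons)
    finally show ?thesis .
  qed auto
qed auto

text \<open>An arrowhead into a non-collider forces the next edge to be directed onwards. So the
  walk is directed up to its first collider, which is in \<open>An G Z\<close> and has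
  \<open>a\<close> as an ancestor, or it is directed to its end.\<close>

lemma directed_or_An:
  assumes "walk (a # b # xs)" "legal Z (a # b # xs)" "(a, b) \<in> dir G"
  shows "a \<in> An G Z \<or> successively (\<lambda>a b. (a, b) \<in> dir G) (a # b # xs)"
  using assms
proof (induction xs arbitrary: a b)
  case (Cons c xs)
  have ab: "arr a b" using Cons.prems(3) by (simp add: arrowhead_at_def)
  show ?case
  proof (cases "arr c b")
    case True
    then show ?thesis using ab Cons.prems An_step by auto
  next
    case False
    then have "(b, c) \<in> dir G" using arr_no_arr ab Cons.prems by auto
    then show ?thesis using Cons.IH[of b c] Cons.prems An_step by auto
  qed
qed simp

lemma legal_iff_nth:
  "legal Z p \<longleftrightarrow> (\<forall>i. 0 < i \<and> Suc i < length p \<longrightarrow>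
     (if collider G p i then p ! i \<in> An G Z else p ! i \<notin> Z))"
proof (induction Z p rule: legal.induct)
  case (1 Z a b c xs)
  have shift: "(\<forall>i. 0 < i \<and> Q i \<longrightarrow> R i) \<longleftrightarrow> (\<forall>i. Q (Suc i) \<longrightarrow> R (Suc i))" for Q R :: "nat \<Rightarrow> bool"
    by (metis Suc_pred zero_less_Suc)
  have split: "(\<forall>i. Q i) \<longleftrightarrow> Q 0 \<and> (\<forall>i. Q (Suc i))" for Q :: "nat \<Rightarrow> bool"
    by (metis not0_implies_Suc)
  show ?case
    using 1 unfolding shift
    by (subst split) (auto simp: collider_def)
qed auto

text \<open>Loops are cut out by induction on the length. The only danger is the repeated node
  \<open>q\<close>, which gets new neighbours and may become a collider or cease to be one.\<close>

lemma legal_m_connected: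
  assumes "walk p" "p \<noteq> []" "set p \<subseteq> nodes G" "legal Z p" "hd p \<notin> Z" "last p \<notin> Z"
  shows "m_connected G Z (hd p) (last p)"
  using assms
proof (induction "length p" arbitrary: p rule: less_induct)
  case less
  show ?case
  proof (cases "distinct p")
    case True
    have "if collider G p i then p ! i \<in> An G Z else p ! i \<notin> Z" if i: "i < length p" for i
    proof (cases "0 < i \<and> Suc i < length p")
      case True
      then show ?thesis using less.prems(4) legal_iff_nth by blast
    next
      case False
      then have "p ! i = hd p \<or> p ! i = last p"
        using i less.prems(2) by (cases "i = 0") (auto simp: hd_conv_nth last_conv_nth intro: arg_cong)
      then show ?thesis using False less.prems(5,6) by (auto simp: collider_def)
    qed
    then show ?thesis
      using True less.prems unfolding m_connected_def path_between_def by blast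
  next
    case False
    then obtain xs q ys zs where p: "p = xs @ q # ys @ q # zs"
      using not_distinct_decomp by (metis append_Cons append_Nil)
    define p' where "p' = xs @ q # zs"
    have "ys \<noteq> []"
      using less.prems(1) adjacent_irrefl by (auto simp: p successively_append_iff successively_Cons)
    then obtain r ys' where r: "ys = r # ys'" by (cases ys) auto
    obtain t ys'' where t: "ys = ys'' @ [t]" using \<open>ys \<noteq> []\<close> by (metis rev_exhaust)
    have w: "walk (xs @ [q])" "walk (q # ys @ [q])" "walk (q # zs)"
      using less.prems(1) \<open>ys \<noteq> []\<close>
      by (auto simp: p successively_append_iff successively_Cons)
    then have w': "walk p'" by (auto simp: p'_def successively_append_iff)
    have l1: "legal Z (xs @ [q, r])" "legal Z (q # ys @ [q])" "legal Z (t # q # zs)"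
    proof -
      have "legal Z (xs @ q # r # (ys' @ q # zs))" using less.prems(4) by (simp add: p r)
      then have "legal Z (xs @ [q, r])" "legal Z (q # r # (ys' @ q # zs))"
        using legal_append by blast+
      then show "legal Z (xs @ [q, r])" by simp
      have "legal Z ((q # ys'') @ t # q # zs)"
        using \<open>legal Z (q # r # _)\<close> r t by (metis append.assoc append_Cons append_Nil)
      then show "legal Z (q # ys @ [q])" "legal Z (t # q # zs)"
        using legal_append[of Z "q # ys''" t q zs] by (simp_all add: t)
    qed
    \<comment> \<open>If \<open>q\<close> is no collider after the cut, it was none at one of the
      two visits, so it is not in \<open>Z\<close>. If it is a collider but was none at either
      visit, the loop leaves \<open>q\<close> by a directed edge and does not return by one, so
      \<open>directed_or_An\<close> puts \<open>q\<close> into \<open>An G Z\<close>.\<close>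
    have key: "if arr a q \<and> arr c q then q \<in> An G Z else q \<notin> Z"
      if "legal Z [a, q, r]" "legal Z [t, q, c]" "adjacent G a q" for a c
    proof (cases "arr a q \<and> arr c q")
      case False
      then show ?thesis using that by (auto split: if_splits)
    next
      case True
      show ?thesis
      proof (cases "arr r q \<or> arr t q")
        case True
        then show ?thesis using that \<open>arr a q \<and> arr c q\<close> by (auto split: if_splits)
      next
        case nr: False
        have "adjacent G q r" using w(2) by (simp add: r)
        then have d: "(q, r) \<in> dir G" using arr_no_arr True nr by blast
        have "walk (q # r # ys' @ [q])" "legal Z (q # r # ys' @ [q])"
          using w(2) l1(2) by (simp_all add: r)
        then have "q \<in> An G Z \<or> successively (\<lambda>a b. (a, b) \<in> dir G) (q # r # ys' @ [q])"
          using directed_or_An d by blast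
        moreover have "q # r # ys' @ [q] = (q # ys'') @ [t, q]" using r t by simp
        ultimately have "q \<in> An G Z \<or> (t, q) \<in> dir G"
          by (auto simp: successively_append_iff successively_Cons split: if_splits)
        then show ?thesis using nr True by (auto simp: arrowhead_at_def)
      qed
    qed
    have "legal Z p'"
    proof (cases "xs = [] \<or> zs = []")
      case True
      then show ?thesis
      proof
        assume "xs = []"
        then show ?thesis using l1(3) by (cases zs) (auto simp: p'_def)
      next
        assume z: "zs = []"
        show ?thesis
        proof (cases xs rule: rev_cases)
          case (snoc as a)
          then have "legal Z (as @ a # q # [r])" using l1(1) by simp
          then show ?thesis using legal_append[of Z as a q "[r]"] by (simp add: p'_def z snoc)
        qed (simp add: p'_def z)
      qed
    next
      case False
      then obtain as a c cs where ac: "xs = as @ [a]" "zs = c # cs"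
        by (metis neq_Nil_conv rev_exhaust)
      have "legal Z (as @ a # q # [r])" using l1(1) ac by simp
      then have 1: "legal Z (as @ [a, q])" "legal Z [a, q, r]" using legal_append[of Z as a q "[r]"] by auto
      have 2: "legal Z (q # c # cs)" "legal Z [t, q, c]" using l1(3) ac by auto
      have "adjacent G a q" using w(1) ac by (simp add: successively_append_iff)
      then have "legal Z (a # q # c # cs)" using key[OF 1(2) 2(2)] 2(1) by simp
      then have "legal Z (as @ a # q # c # cs)" using 1 legal_append by blast
      then show ?thesis by (simp add: p'_def ac)
    qed
    moreover have "hd p' = hd p" "last p' = last p" "p' \<noteq> []" "set p' \<subseteq> nodes G" "length p' < length p"
      using less.prems(3) by (auto simp: p p'_def hd_append)
    ultimately show ?thesis using less w' by metis
  qed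
qed

text \<open>An arrowhead at \<open>u\<close> rules out undirected edges at \<open>u\<close>, and
  each directed edge puts an arrowhead at the next node.\<close>

lemma ant_dir:
  assumes "arr a u" "(u, s) \<in> (ant_edges G)\<^sup>*" shows "(u, s) \<in> (dir G)\<^sup>*"
proof -
  from assms(2) have "(u, s) \<in> (dir G)\<^sup>* \<and> (\<exists>a. arr a s)"
  proof (induction rule: rtrancl_induct)
    case base
    then show ?case using assms(1) by blast
  next
    case (step y z)
    then have "(y, z) \<in> dir G" using arr_no_und by (auto simp: ant_edges_def)
    then show ?case using step.IH by (auto simp: arrowhead_at_def intro: rtrancl_into_rtrancl)
  qed
  then show ?thesis by blast
qed

lemma legal_directed:
  "successively (\<lambda>a b. (a, b) \<in> dir G) p \<Longrightarrow> set p \<inter> Z = {} \<Longrightarrow> legal Z p"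
  by (induction Z p rule: legal.induct) (auto dest: dir_no_arr)

text \<open>An element of \<open>Z\<close> on a directed path from \<open>q\<close> would put
  \<open>q\<close> into \<open>An G Z\<close>.\<close>

lemma directed_avoiding:
  assumes "(q, x) \<in> (dir G)\<^sup>*" "q \<in> nodes G" "q \<notin> An G Z"
  obtains p where "hd (q # p) = q" "last (q # p) = x" "successively (\<lambda>a b. (a, b) \<in> dir G) (q # p)"
    "set (q # p) \<inter> Z = {}" "set (q # p) \<subseteq> nodes G" "walk (q # p)" "walk (rev (q # p))"
proof -
  obtain p where p: "p \<noteq> []" "hd p = q" "last p = x" "successively (\<lambda>a b. (a, b) \<in> dir G) p"
    using rtrancl_distinct_list[OF assms(1)] by blast
  have "v \<notin> Z" if "v \<in> set p" for v
  proof
    assume "v \<in> Z"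
    from that obtain xs ys where s: "p = xs @ v # ys" by (meson split_list)
    then have "successively (\<lambda>a b. (a, b) \<in> dir G) (xs @ [v])"
      using p(4) by (auto simp: successively_append_iff)
    then have "(hd (xs @ [v]), v) \<in> (dir G)\<^sup>*" using successively_rtrancl by fastforce
    moreover have "hd (xs @ [v]) = q" using p(2) s by (auto simp: hd_append)
    ultimately show False using assms(2,3) \<open>v \<in> Z\<close> by (auto simp: An_def ancestor_iff[OF mg])
  qed
  then have Z: "set p \<inter> Z = {}" by blast
  have n: "set p \<subseteq> nodes G" using successively_path_nodes p assms(2) edges_in_nodes(1) by metis
  have w: "walk p" by (rule successively_mono[OF p(4)]) (auto simp: adjacent_def)
  then have "walk (rev p)"
    unfolding successively_rev by (rule successively_mono) (use adjacent_sym in auto)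
  moreover obtain p' where "p = q # p'" using p(1,2) by (cases p) auto
  ultimately show thesis using that[of p'] p Z n w by simp
qed

definition antset :: "'v set \<Rightarrow> 'v set" where
  "antset W = {v \<in> nodes G. \<exists>s\<in>W. (v, s) \<in> (ant_edges G)\<^sup>*}"

lemma antset_step: "(a, b) \<in> ant_edges G \<Longrightarrow> b \<in> antset W \<Longrightarrow> a \<in> antset W"
  using edges_in_nodes
  by (auto simp: antset_def ant_edges_def intro: converse_rtrancl_into_rtrancl)

lemma antset_closed: "Z \<subseteq> antset W \<Longrightarrow> An G Z \<subseteq> antset W"
proof -
  have "(dir G)\<^sup>* \<subseteq> (ant_edges G)\<^sup>*" by (intro rtrancl_mono) (auto simp: ant_edges_def)
  then show "Z \<subseteq> antset W \<Longrightarrow> An G Z \<subseteq> antset W"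
    by (auto simp: An_def ancestor_iff[OF mg] antset_def subset_iff) (meson rtrancl_trans)
qed

text \<open>From \<open>b\<close> on the walk follows anterior edges until it ends in
  \<open>antset W\<close> or meets a collider, which is in \<open>An G Z\<close> and so in
  \<open>antset W\<close> by \<open>antset_closed\<close>.\<close>

lemma legal_anterior:
  assumes "walk (b # c # xs)" "legal Z (b # c # xs)" "(b, c) \<in> ant_edges G"
    "last (c # xs) \<in> antset W" "Z \<subseteq> antset W"
  shows "b \<in> antset W"
  using assms(1-4)
proof (induction xs arbitrary: b c)
  case Nil
  then show ?case using antset_step by auto
next
  case (Cons d xs)
  have "c \<in> antset W"
  proof (cases "arr b c \<and> arr d c")
    case True
    then show ?thesis using Cons.prems antset_closed[OF assms(5)] by auto
  next
    case False
    have cd: "adjacent G c d" using Cons.prems by simp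
    \<comment> \<open>An arrowhead at \<open>c\<close> coming from \<open>d\<close> would meet an
      undirected edge between \<open>b\<close> and \<open>c\<close>, which is excluded.\<close>
    have "(c, d) \<in> ant_edges G"
    proof (cases "arr d c")
      case True
      then have "(b, c) \<in> und G" using False Cons.prems(3) by (auto simp: arrowhead_at_def ant_edges_def)
      then show ?thesis using True arr_no_und und_sym by blast
    qed (use no_arr cd in blast)
    then show ?thesis using Cons.IH[of c d] Cons.prems by auto
  qed
  then show ?case using antset_step Cons.prems(3) by blast
qed

text \<open>This justifies the restriction to \<open>M\<close>. Colliders are in
  \<open>An G Z\<close>; a non-collider lacks an arrowhead on one side, and
  \<open>legal_anterior\<close> applies to the walk in that direction.\<close>

lemma legal_in_antset:
  assumes "walk p" "legal Z p" "hd p \<in> antset W" "last p \<in> antset W" "Z \<subseteq> antset W"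
  shows "set p \<subseteq> antset W"
proof
  fix b assume "b \<in> set p"
  then obtain xs ys where p: "p = xs @ b # ys" by (meson split_list)
  show "b \<in> antset W"
  proof (cases "xs = [] \<or> ys = []")
    case True
    then show ?thesis using assms(3,4) p by auto
  next
    case False
    then obtain as a c cs where ac: "xs = as @ [a]" "ys = c # cs"
      by (metis neq_Nil_conv rev_exhaust)
    have "legal Z (as @ a # b # (c # cs))" using assms(2) by (simp add: p ac)
    then have l: "legal Z (as @ [a, b])" "legal Z (a # b # c # cs)" using legal_append by blast+
    have w: "walk (as @ [a, b])" "walk (b # c # cs)" "adjacent G b a" "adjacent G b c"
      using assms(1) adjacent_sym by (auto simp: p ac successively_append_iff)
    consider "arr a b \<and> arr c b" | "\<not> arr a b" | "\<not> arr c b" by blast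
    then show ?thesis
    proof cases
      case 1
      then show ?thesis using l(2) antset_closed[OF assms(5)] by auto
    next
      case 2
      have "walk (rev (as @ [a, b]))"
        unfolding successively_rev
        by (rule successively_mono[OF w(1)]) (use adjacent_sym in auto)
      moreover have "legal Z (rev (as @ [a, b]))" using l(1) legal_rev by metis
      moreover have "last (a # rev as) \<in> antset W"
        using assms(3) by (auto simp: p ac last_rev hd_append)
      ultimately show ?thesis
        using legal_anterior[of b a "rev as" Z W] no_arr[OF w(3) 2] assms(5) by simp
    next
      case 3
      then show ?thesis
        using legal_anterior[of b c cs Z W] no_arr[OF w(4)] w l(2) assms(4,5) by (simp add: p ac)
    qed
  qed
qed

lemma m_connected_legal:
  assumes "m_connected G Z U W"
  obtains p where "walk p" "p \<noteq> []" "hd p = U" "last p = W" "set p \<subseteq> nodes G" "legal Z p"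
    "U \<notin> Z" "W \<notin> Z"
proof -
  obtain p where p: "path_between G U p W"
    "\<forall>i<length p. if collider G p i then p ! i \<in> An G Z else p ! i \<notin> Z"
    using assms by (auto simp: m_connected_def)
  have ne: "p \<noteq> []" "hd p = U" "last p = W" "walk p" "set p \<subseteq> nodes G"
    using p(1) by (auto simp: path_between_def)
  have "\<not> collider G p 0" "\<not> collider G p (length p - 1)" by (auto simp: collider_def)
  then have "p ! 0 \<notin> Z" "p ! (length p - 1) \<notin> Z" using p(2) ne(1) by fastforce+
  then have "U \<notin> Z" "W \<notin> Z" using ne by (auto simp: hd_conv_nth last_conv_nth)
  moreover have "legal Z p" using p(2) by (auto simp: legal_iff_nth)
  ultimately show thesis using that ne by blast
qed

end

section \<open>The undirected graph of an instance\<close>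

locale separator_instance = ancestral G for G :: "nat mixed_graph" +
  fixes n :: nat and X Y R I :: "nat set"
  assumes nodes: "nodes G = {0..<n}"
    and X: "X \<subseteq> nodes G" and Y: "Y \<subseteq> nodes G" and R: "R \<subseteq> nodes G"
    and XR: "X \<inter> R = {}" and YR: "Y \<inter> R = {}" and XY: "X \<inter> Y = {}" and IR: "I \<subseteq> R"
begin

definition M :: "nat set" where
  "M = antset (X \<union> Y \<union> I)"

text \<open>\<open>I\<close> belongs to every separator in question and minimal ones lie within
  \<open>M\<close>, so these are the nodes about which a choice remains.\<close>

definition D :: "nat set" where
  "D = R \<inter> M - I"

text \<open>The node \<open>n + q\<close> stands for passing through \<open>q\<close> as a collider. It cannot be deleted.\<close>

definition E :: "(nat \<times> nat) set" where
  "E = {(u, w). u \<in> M - I \<and> w \<in> M - I \<and> adjacent G u w} \<union>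
    {(u, n + q) | u q. u \<in> M - I \<and> q \<in> M \<and> arr u q} \<union>
    {(n + q, u) | u q. u \<in> M - I \<and> q \<in> M \<and> arr u q} \<union>
    {(n + q, n + r) | q r. q \<in> M \<and> r \<in> M \<and> (q, r) \<in> bid G}"

lemma M_less: "v \<in> M \<Longrightarrow> v < n"
  using nodes by (auto simp: M_def antset_def)

lemma XYI_M: "X \<subseteq> M" "Y \<subseteq> M" "I \<subseteq> M"
  using X Y R IR by (auto simp: M_def antset_def)

lemma E_sym: "sym E"
  using adjacent_sym bid_sym by (auto simp: sym_def E_def)

sublocale nat_separation E X Y D
proof
  show "finite D" by (rule finite_subset[of D "{0..<n}"]) (use M_less in \<open>auto simp: D_def\<close>)
qed (use E_sym XR YR in \<open>auto simp: D_def\<close>)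

text \<open>The search follows the walk: a node passed as a non-collider is represented by itself, a
  collider \<open>a\<close> by \<open>n + a\<close>. In the second case the next edge must have an
  arrowhead at \<open>a\<close> as well, since the edges of \<open>E\<close> at the copy are
  those.\<close>

lemma reach_legal:
  assumes "walk (a # b # xs)" "legal Z (a # b # xs)" "set (a # b # xs) \<subseteq> M" "I \<subseteq> Z"
    "last (b # xs) \<notin> Z" "S \<subseteq> Z \<inter> M"
    and "(a \<in> reach E S X \<and> a \<notin> Z) \<or> (n + a \<in> reach E S X \<and> arr b a)"
  shows "last (b # xs) \<in> reach E S X"
  using assms(1-3,5,7)
proof (induction xs arbitrary: a b)
  case Nil
  then have "(a, b) \<in> E \<and> a \<in> reach E S X \<or> (n + a, b) \<in> E \<and> n + a \<in> reach E S X"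
    using assms(4) by (auto simp: E_def)
  then show ?case using reach_step[of _ E S X b] Nil assms(6) by auto
next
  case (Cons c xs)
  have ab: "adjacent G a b" "a \<in> M" "b \<in> M" using Cons.prems by auto
  show ?case
  proof (cases "arr a b \<and> arr c b")
    case True
    have "n + b \<notin> S" using M_less assms(6) by fastforce
    have "(a, n + b) \<in> E \<and> a \<in> reach E S X \<or> (n + a, n + b) \<in> E \<and> n + a \<in> reach E S X"
      using Cons.prems(5) ab True assms(4) both_arr[of a b] by (auto simp: E_def)
    then have "n + b \<in> reach E S X" using reach_step[of _ E S X "n + b"] \<open>n + b \<notin> S\<close> by auto
    then show ?thesis using Cons.IH[of b c] Cons.prems True by auto
  next
    case False
    then have "b \<notin> Z" using Cons.prems(2) by auto
    then have "(a, b) \<in> E \<and> a \<in> reach E S X \<or> (n + a, b) \<in> E \<and> n + a \<in> reach E S X"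
      using Cons.prems ab assms(4) by (auto simp: E_def)
    then have "b \<in> reach E S X" using reach_step[of _ E S X b] \<open>b \<notin> Z\<close> assms(6) by auto
    then show ?thesis using Cons.IH[of b c] Cons.prems \<open>b \<notin> Z\<close> by auto
  qed
qed

text \<open>A connecting path stays inside \<open>M\<close> by \<open>legal_in_antset\<close>, and
  \<open>reach_legal\<close> would trace it from \<open>X\<close> to \<open>Y\<close>.\<close>

lemma separator_of_sep:
  assumes S: "sep S"
  shows "m_separator G X Y (I \<union> S)"
proof -
  let ?Z = "I \<union> S"
  have SD: "S \<subseteq> D" using S by (simp add: sep_def)
  have ZM: "?Z \<subseteq> M" using SD XYI_M by (auto simp: D_def)
  have "\<not> m_connected G ?Z U W" if U: "U \<in> X" and W: "W \<in> Y" for U W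
  proof
    assume "m_connected G ?Z U W"
    then obtain p where p: "walk p" "p \<noteq> []" "hd p = U" "last p = W" "set p \<subseteq> nodes G"
      "legal ?Z p" "U \<notin> ?Z" "W \<notin> ?Z" by (rule m_connected_legal)
    have "set p \<subseteq> M"
    proof -
      have "hd p \<in> M" "last p \<in> M" using p(3,4) U W XYI_M by auto
      then show ?thesis using legal_in_antset[OF p(1,6)] ZM unfolding M_def by simp
    qed
    have "U \<noteq> W" using U W XY by blast
    then obtain b xs where pb: "p = U # b # xs"
      using p(2-4) by (cases p; cases "tl p") auto
    have "U \<in> reach E S X" using U reach_refl[of X E S] by blast
    moreover have "S \<subseteq> ?Z \<inter> M" using SD by (auto simp: D_def)
    ultimately have "last (b # xs) \<in> reach E S X"
      using reach_legal[of U b xs ?Z S] p \<open>set p \<subseteq> M\<close> unfolding pb by simp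
    then show False using S W p(4) pb unfolding sep_def by auto
  qed
  then show ?thesis by (auto simp: m_separator_def)
qed

text \<open>In the converse direction, an illegal collider of a walk from \<open>X\<close> is an ancestor of
  \<open>X\<close> or \<open>Y\<close>. In the first case the walk is restarted there, in the second case it is
  completed there.\<close>

definition xwalk :: "nat set \<Rightarrow> nat list \<Rightarrow> bool" where
  "xwalk Z p \<longleftrightarrow> p \<noteq> [] \<and> hd p \<in> X \<and> walk p \<and> legal Z p \<and> set p \<subseteq> nodes G"

text \<open>One step of the search in \<open>E\<close> is matched by a walk with the same last edge,
  though possibly with another beginning. Keeping both \<open>u\<close> and \<open>w\<close> at the
  end tells the next step whether \<open>w\<close> was entered with an arrowhead.\<close>

lemma xwalk_extend:
  assumes Z: "I \<subseteq> Z" "X \<inter> Z = {}" "Y \<inter> Z = {}"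
    and p: "xwalk Z (ps @ [u])" and u: "u \<in> M" "adjacent G u w"
    and uZ: "u \<notin> Z \<or> (ps \<noteq> [] \<and> arr (last ps) u \<and> arr w u)"
  shows "\<not> m_separator G X Y Z \<or> (\<exists>ps'. xwalk Z (ps' @ [u, w]))"
proof (cases ps rule: rev_cases)
  case Nil
  then show ?thesis
    using p u adjacent_nodes by (intro disjI2 exI[of _ "[]"]) (auto simp: xwalk_def)
next
  case (snoc qs a)
  have nd: "u \<in> nodes G" "w \<in> nodes G" using u adjacent_nodes by auto
  have l: "legal Z (qs @ [a, u])" and w: "walk (qs @ [a, u])" and hd: "hd (qs @ [a, u]) \<in> X"
    and n: "set (qs @ [a, u]) \<subseteq> nodes G"
    using p snoc by (auto simp: xwalk_def)
  show ?thesis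
  proof (cases "legal Z [a, u, w]")
    case True
    then have "legal Z (qs @ a # u # [w])" using l legal_append by blast
    then have "xwalk Z ((qs @ [a]) @ [u, w])"
      using w hd n nd u(2) by (auto simp: xwalk_def successively_append_iff hd_append)
    then show ?thesis by blast
  next
    case False
    \<comment> \<open>By the hypothesis on \<open>u\<close>, a triple that is not legal can only be
      a collider outside \<open>An G Z\<close>.\<close>
    then have c: "arr a u" "arr w u" "u \<notin> An G Z" using uZ snoc by (auto split: if_splits)
    have uZ: "u \<notin> Z" using c(3) An_self nd by blast
    obtain s where s: "s \<in> X \<union> Y \<union> I" "(u, s) \<in> (dir G)\<^sup>*"
      using u(1) ant_dir[OF c(1)] by (auto simp: M_def antset_def)
    have "s \<notin> I"
      using c(3) s(2) Z(1) nd by (auto simp: An_def ancestor_iff[OF mg])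
    obtain p where p: "hd (u # p) = u" "last (u # p) = s"
      "successively (\<lambda>a b. (a, b) \<in> dir G) (u # p)" "set (u # p) \<inter> Z = {}"
      "set (u # p) \<subseteq> nodes G" "walk (u # p)" "walk (rev (u # p))"
      using directed_avoiding[OF s(2) nd(1) c(3)] .
    have lp: "legal Z (u # p)" using legal_directed p by blast
    \<comment> \<open>The directed path leaves \<open>u\<close> by a tail, so \<open>u\<close> is a
      non-collider where the path is joined on, and this is legal since \<open>u\<close> is not in
      \<open>Z\<close>.\<close>
    have pu: "\<not> arr b u" if "p = b # p'" for b p'
      using p(3) that dir_no_arr by auto
    show ?thesis
    proof (cases "s \<in> X")
      case True
      have "legal Z (rev p @ [u, w])"
      proof (cases p)
        case (Cons b p')
        have "legal Z (rev p' @ [b, u])"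
          using lp legal_rev[of Z "u # p"] Cons by simp
        moreover have "legal Z (b # u # [w])" using pu Cons uZ by auto
        ultimately have "legal Z (rev p' @ b # u # [w])" using legal_append by blast
        then show ?thesis by (simp add: Cons)
      qed simp
      moreover have "hd (rev p @ [u, w]) = s"
        using p(2) by (cases p rule: rev_cases) auto
      moreover have "walk (rev p @ [u, w])"
        using p(7) u(2) by (auto simp: successively_append_iff)
      ultimately have "xwalk Z (rev p @ [u, w])" using True p(5) nd by (auto simp: xwalk_def)
      then show ?thesis by blast
    next
      case False
      then have sY: "s \<in> Y" using s \<open>s \<notin> I\<close> by blast
      let ?q = "qs @ a # u # p"
      have "legal Z (a # u # p)" using pu lp uZ by (cases p) auto
      then have lq: "legal Z ?q" using l legal_append by blast
      have "walk ?q" using w p(6) by (auto simp: successively_append_iff)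
      moreover have "set ?q \<subseteq> nodes G" using n p(5) by auto
      moreover have "hd ?q \<in> X" using hd by (auto simp: hd_append)
      moreover have "last ?q = s" using p(2) by simp
      ultimately have "m_connected G Z (hd ?q) s"
        using legal_m_connected[of ?q Z] lq Z(2,3) sY by auto
      then show ?thesis using \<open>hd ?q \<in> X\<close> sY by (auto simp: m_separator_def)
    qed
  qed
qed

text \<open>Whatever the search in \<open>E\<close> finds is the end of a legal walk from
  \<open>X\<close>, so an element of \<open>Y\<close> among it would be m-connected to
  \<open>X\<close> by \<open>legal_m_connected\<close>.\<close>

lemma sep_of_separator:
  assumes Z: "I \<subseteq> Z" "Z \<subseteq> R" and m: "m_separator G X Y Z"
  shows "sep (Z \<inter> M - I)"
proof -
  let ?S = "Z \<inter> M - I"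
  have ZXY: "X \<inter> Z = {}" "Y \<inter> Z = {}" using Z XR YR by auto
  note ext = xwalk_extend[OF Z(1) ZXY]
  \<comment> \<open>For a copy \<open>n + q\<close> the walk must arrive with an arrowhead at
    \<open>q\<close>, so that \<open>q\<close> becomes a collider as soon as the next edge has one
    there.\<close>
  define P where "P v \<longleftrightarrow> (v \<in> M \<and> v \<notin> Z \<and> (\<exists>ps. xwalk Z (ps @ [v]))) \<or>
    (\<exists>q\<in>M. v = n + q \<and> (\<exists>ps. ps \<noteq> [] \<and> xwalk Z (ps @ [q]) \<and> arr (last ps) q))" for v
  have "reach E ?S X \<subseteq> {v. P v}"
  proof (rule reach_least)
    show "X \<subseteq> {v. P v}"
    proof
      fix x assume "x \<in> X"
      then have "xwalk Z ([] @ [x])" using X by (auto simp: xwalk_def)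
      then show "x \<in> {v. P v}" using \<open>x \<in> X\<close> XYI_M ZXY unfolding P_def by blast
    qed
  next
    fix u v assume u: "u \<in> {v. P v}" and e: "(u, v) \<in> E" and v: "v \<notin> ?S"
    have **: "\<exists>ps'. xwalk Z ((ps' @ [u]) @ [w])"
      if "xwalk Z (ps @ [u])" "u \<in> M" "adjacent G u w"
        "u \<notin> Z \<or> (ps \<noteq> [] \<and> arr (last ps) u \<and> arr w u)" for u w ps
      using ext[OF that] m by simp
    have low: "u \<notin> Z \<and> (\<exists>ps. xwalk Z (ps @ [u]))" if "u \<in> M"
      using u that by (auto simp: P_def dest: M_less)
    have high: "\<exists>ps. ps \<noteq> [] \<and> xwalk Z (ps @ [q]) \<and> arr (last ps) q" if "u = n + q" for q
      using u that by (auto simp: P_def dest: M_less)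
    consider (a) "u \<in> M" "v \<in> M - I" "adjacent G u v"
      | (b) q where "v = n + q" "u \<in> M" "q \<in> M" "arr u q"
      | (c) q where "u = n + q" "q \<in> M" "v \<in> M - I" "arr v q"
      | (d) q r where "u = n + q" "v = n + r" "q \<in> M" "r \<in> M" "(q, r) \<in> bid G"
      using e by (auto simp: E_def)
    then show "v \<in> {v. P v}"
    proof cases
      case a
      then have "v \<notin> Z" using v by blast
      then show ?thesis using ** low a unfolding P_def by blast
    next
      case b
      then obtain ps where "xwalk Z (ps @ [u])" "u \<notin> Z" using low by blast
      then obtain ps' where "xwalk Z ((ps' @ [u]) @ [q])"
        using **[of ps u q] b arr_adjacent by blast
      then have "\<exists>ps. ps \<noteq> [] \<and> xwalk Z (ps @ [q]) \<and> arr (last ps) q"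
        using b by (intro exI[of _ "ps' @ [u]"]) simp
      then show ?thesis using b by (auto simp: P_def)
    next
      case c
      then have "v \<notin> Z" using v by blast
      then show ?thesis using ** high[OF c(1)] c arr_adjacent adjacent_sym unfolding P_def by blast
    next
      case d
      then have ar: "arr q r" "arr r q" using bid_sym by (auto simp: arrowhead_at_def)
      obtain ps where "ps \<noteq> []" "xwalk Z (ps @ [q])" "arr (last ps) q" using high d by blast
      then obtain ps' where "xwalk Z ((ps' @ [q]) @ [r])"
        using **[of ps q r] d ar arr_adjacent by blast
      then have "\<exists>ps. ps \<noteq> [] \<and> xwalk Z (ps @ [r]) \<and> arr (last ps) r"
        using ar by (intro exI[of _ "ps' @ [q]"]) simp
      then show ?thesis using d by (auto simp: P_def)
    qed
  qed
  moreover have "\<not> P y" if y: "y \<in> Y" for y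
  proof
    assume "P y"
    moreover have "y < n" using y XYI_M M_less by blast
    ultimately obtain ps where "xwalk Z (ps @ [y])" by (auto simp: P_def)
    then have "m_connected G Z (hd (ps @ [y])) y" "hd (ps @ [y]) \<in> X"
      using legal_m_connected[of "ps @ [y]" Z] ZXY y by (auto simp: xwalk_def)
    then show False using m y by (auto simp: m_separator_def)
  qed
  ultimately show ?thesis using Z unfolding sep_def by (auto simp: D_def)
qed

text \<open>By the two directions above, intersecting a separator with \<open>M\<close> keeps it a
  separator. So a minimal one is contained in \<open>M\<close>, where both notions of minimality
  compare the same sets.\<close>

theorem minimal_m_separators:
  "{Z. minimal_m_separator G X Y I Z \<and> I \<subseteq> Z \<and> Z \<subseteq> R} = (\<union>) I ` {S. min_sep S}"
proof -
  have ID: "I \<inter> S = {}" if "sep S" for S using that unfolding sep_def by (auto simp: D_def)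
  have strip: "sep (Z - I)" if "Z \<subseteq> M" "I \<subseteq> Z" "Z \<subseteq> R" "m_separator G X Y Z" for Z
    using sep_of_separator[of Z] that by (simp add: Int_absorb2)
  have 1: "minimal_m_separator G X Y I (I \<union> S) \<and> I \<union> S \<subseteq> R" if S: "min_sep S" for S
  proof -
    have s: "sep S" using S by (simp add: min_sep_def)
    have SD: "S \<subseteq> D" using s by (simp add: sep_def)
    have "\<not> m_separator G X Y Z'" if Z': "Z' \<subset> I \<union> S" "I \<subseteq> Z'" for Z'
    proof
      assume "m_separator G X Y Z'"
      moreover have "Z' \<subseteq> M" "Z' \<subseteq> R" using Z' SD XYI_M IR by (auto simp: D_def)
      ultimately have "sep (Z' - I)" using strip Z' by blast
      moreover have "Z' - I \<subset> S" using Z' ID[OF s] by blast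
      ultimately show False using S by (auto simp: min_sep_def)
    qed
    then show ?thesis
      using separator_of_sep[OF s] SD IR unfolding minimal_m_separator_def D_def by blast
  qed
  have 2: "\<exists>S. min_sep S \<and> Z = I \<union> S"
    if Z: "minimal_m_separator G X Y I Z" "I \<subseteq> Z" "Z \<subseteq> R" for Z
  proof -
    have mZ: "m_separator G X Y Z" using Z by (simp add: minimal_m_separator_def)
    let ?S = "Z \<inter> M - I"
    have s: "sep ?S" using sep_of_separator[OF Z(2,3) mZ] .
    have eq: "I \<union> S' = Z" if "sep S'" "S' \<subseteq> ?S" for S'
    proof -
      have "\<not> I \<union> S' \<subset> Z"
        using separator_of_sep[OF that(1)] Z(1) Un_upper1[of I S']
        unfolding minimal_m_separator_def by metis
      moreover have "I \<union> S' \<subseteq> Z" using that(2) Z(2) by blast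
      ultimately show ?thesis by blast
    qed
    have "\<not> sep S'" if sub: "S' \<subset> ?S" for S'
    proof
      assume "sep S'"
      then have "I \<union> S' = Z" using eq sub by blast
      moreover obtain x where "x \<in> ?S" "x \<notin> S'" using sub by blast
      ultimately show False by blast
    qed
    then show ?thesis using s eq[of ?S] by (auto simp: min_sep_def)
  qed
  show ?thesis
  proof (rule subset_antisym; rule subsetI)
    fix Z assume "Z \<in> {Z. minimal_m_separator G X Y I Z \<and> I \<subseteq> Z \<and> Z \<subseteq> R}"
    then show "Z \<in> (\<union>) I ` {S. min_sep S}" using 2[of Z] by auto
  next
    fix Z assume "Z \<in> (\<union>) I ` {S. min_sep S}"
    then obtain S where "min_sep S" "Z = I \<union> S" by blast
    then show "Z \<in> {Z. minimal_m_separator G X Y I Z \<and> I \<subseteq> Z \<and> Z \<subseteq> R}"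
      using 1[of S] by simp
  qed
qed

end

section \<open>A language of bounded loops for the random access machine\<close>

type_synonym store = "nat \<Rightarrow> nat \<Rightarrow> nat"

definition upd :: "nat \<Rightarrow> nat \<Rightarrow> nat \<Rightarrow> store \<Rightarrow> store" where
  "upd x i v m = m(x := (m x)(i := v))"

lemma upd_apply: "upd x i v m y j = (if y = x \<and> j = i then v else m y j)"
  by (simp add: upd_def)

datatype exp = Num nat | Arr nat exp | Inp exp | Plus exp exp | Minus exp exp

primrec eval :: "nat list \<Rightarrow> exp \<Rightarrow> store \<Rightarrow> nat" where
  "eval inp (Num k) m = k"
| "eval inp (Arr x e) m = m x (eval inp e m)"
| "eval inp (Inp e) m = (if eval inp e m < length inp then inp ! eval inp e m else 0)"
| "eval inp (Plus a b) m = eval inp a m + eval inp b m"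
| "eval inp (Minus a b) m = eval inp a m - eval inp b m"

text \<open>In \<open>For x y c\<close> the counter \<open>x\<close> runs from \<open>0\<close> up
  to the value of \<open>y\<close>. There is no unbounded loop, so the semantics is a total function
  and running times can be bounded by recursion on the syntax.\<close>

datatype com =
    Skip
  | Put nat exp exp
  | Out exp
  | Seq com com (infixr \<open>;;\<close> 60)
  | If exp com com
  | For nat nat com

text \<open>A scalar variable is entry \<open>0\<close> of an array.\<close>

abbreviation Var :: "nat \<Rightarrow> exp" where
  "Var x \<equiv> Arr x (Num 0)"

abbreviation Set :: "nat \<Rightarrow> exp \<Rightarrow> com" where
  "Set x e \<equiv> Put x (Num 0) e"

abbreviation loop_step :: "nat \<Rightarrow> (store \<Rightarrow> store) \<Rightarrow> store \<Rightarrow> store" where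
  "loop_step x f s \<equiv> upd x 0 (Suc (f s x 0)) (f s)"

primrec sem :: "nat list \<Rightarrow> com \<Rightarrow> store \<Rightarrow> store" where
  "sem inp Skip m = m"
| "sem inp (Put x i e) m = upd x (eval inp i m) (eval inp e m) m"
| "sem inp (Out e) m = m"
| "sem inp (c1 ;; c2) m = sem inp c2 (sem inp c1 m)"
| "sem inp (If e c1 c2) m = (if eval inp e m \<noteq> 0 then sem inp c1 m else sem inp c2 m)"
| "sem inp (For x y c) m = (loop_step x (sem inp c) ^^ m y 0) (upd x 0 0 m)"

primrec outp :: "nat list \<Rightarrow> com \<Rightarrow> store \<Rightarrow> nat list" where
  "outp inp Skip m = []"
| "outp inp (Put x i e) m = []"
| "outp inp (Out e) m = [eval inp e m]"
| "outp inp (c1 ;; c2) m = outp inp c1 m @ outp inp c2 (sem inp c1 m)"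
| "outp inp (If e c1 c2) m = (if eval inp e m \<noteq> 0 then outp inp c1 m else outp inp c2 m)"
| "outp inp (For x y c) m =
     concat (map (\<lambda>k. outp inp c ((loop_step x (sem inp c) ^^ k) (upd x 0 0 m))) [0..<m y 0])"

primrec writes :: "com \<Rightarrow> nat set" where
  "writes Skip = {}"
| "writes (Put x i e) = {x}"
| "writes (Out e) = {}"
| "writes (c1 ;; c2) = writes c1 \<union> writes c2"
| "writes (If e c1 c2) = writes c1 \<union> writes c2"
| "writes (For x y c) = insert x (writes c)"

lemma sem_frame: "z \<notin> writes c \<Longrightarrow> sem inp c m z = m z"
proof (induction c arbitrary: m)
  case (For x y c)
  have "(loop_step x (sem inp c) ^^ k) (upd x 0 0 m) z = m z" for k
    by (induction k) (use For in \<open>auto simp: upd_def\<close>)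
  then show ?case by simp
qed (auto simp: upd_def)

lemma loop_counter:
  assumes "x \<notin> writes c"
  shows "(loop_step x (sem inp c) ^^ k) (upd x 0 0 m) x 0 = k"
    and "z \<notin> writes c \<Longrightarrow> z \<noteq> x \<Longrightarrow> (loop_step x (sem inp c) ^^ k) (upd x 0 0 m) z = m z"
  by (induction k) (auto simp: upd_def sem_frame[OF assms] sem_frame[of z])

text \<open>The step may assume the value of the counter and that arrays not written keep their
  contents, so \<open>J\<close> needs to mention only what changes.\<close>

lemma For_iterate:
  assumes x: "x \<notin> writes c"
    and init: "J 0 (upd x 0 0 m)"
    and step: "\<And>k s. k < m y 0 \<Longrightarrow> J k s \<Longrightarrow> s x 0 = k \<Longrightarrow>
      (\<And>z. z \<notin> writes (For x y c) \<Longrightarrow> s z = m z) \<Longrightarrow> J (Suc k) (upd x 0 (Suc k) (sem inp c s))"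
  shows "k \<le> m y 0 \<Longrightarrow> J k ((loop_step x (sem inp c) ^^ k) (upd x 0 0 m))"
proof (induction k)
  case (Suc k)
  let ?s = "(loop_step x (sem inp c) ^^ k) (upd x 0 0 m)"
  have "J (Suc k) (upd x 0 (Suc k) (sem inp c ?s))"
    using Suc loop_counter[OF x] by (intro step) auto
  then show ?case using loop_counter(1)[OF x, of k inp m] sem_frame[OF x] by simp
qed (simp add: init)

lemma For_invariant:
  assumes "x \<notin> writes c" "J 0 (upd x 0 0 m)"
    and "\<And>k s. k < m y 0 \<Longrightarrow> J k s \<Longrightarrow> s x 0 = k \<Longrightarrow>
      (\<And>z. z \<notin> writes (For x y c) \<Longrightarrow> s z = m z) \<Longrightarrow> J (Suc k) (upd x 0 (Suc k) (sem inp c s))"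
  shows "J (m y 0) (sem inp (For x y c) m)"
  unfolding sem.simps
  by (rule For_iterate[where J = J and x = x and y = y and c = c and inp = inp and m = m])
    (fact assms order_refl)+

text \<open>Entry \<open>i\<close> of array \<open>x\<close>, where \<open>8 \<le> x < 64\<close>, lives at address \<open>64 * i + x\<close>. The addresses
  below 8 hold temporary values.\<close>

definition address :: "nat \<Rightarrow> nat \<Rightarrow> instr list" where
  "address d x = [Add d d d, Add d d d, Add d d d, Add d d d, Add d d d, Add d d d,
     Const (Suc d) x, Add d d (Suc d)]"

primrec code_exp :: "exp \<Rightarrow> nat \<Rightarrow> instr list" where
  "code_exp (Num k) d = [Const d k]"
| "code_exp (Arr x e) d = code_exp e d @ address d x @ [Load d d]"
| "code_exp (Inp e) d = code_exp e d @ [Read d d]"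
| "code_exp (Plus a b) d = code_exp a d @ code_exp b (Suc d) @ [Add d d (Suc d)]"
| "code_exp (Minus a b) d = code_exp a d @ code_exp b (Suc d) @ [Sub d d (Suc d)]"

primrec code_length :: "com \<Rightarrow> nat" where
  "code_length Skip = 0"
| "code_length (Put x i e) = length (code_exp i 0 @ address 0 x @ code_exp e 1) + 1"
| "code_length (Out e) = length (code_exp e 0) + 1"
| "code_length (c1 ;; c2) = code_length c1 + code_length c2"
| "code_length (If e c1 c2) = length (code_exp e 0) + 2 + code_length c1 + code_length c2"
| "code_length (For x y c) = code_length c + 6"

text \<open>Jump targets are absolute, hence the start position \<open>b\<close>. Entry
  \<open>0\<close> of an array has the number of the array as its address, so the loop head can use
  \<open>x\<close> and \<open>y\<close> as registers; their truncated difference is zero exactly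
  when the loop is over.\<close>

primrec code :: "com \<Rightarrow> nat \<Rightarrow> instr list" where
  "code Skip b = []"
| "code (Put x i e) b = code_exp i 0 @ address 0 x @ code_exp e 1 @ [Store 0 1]"
| "code (Out e) b = code_exp e 0 @ [Emit 0]"
| "code (c1 ;; c2) b = code c1 b @ code c2 (b + code_length c1)"
| "code (If e c1 c2) b =
     (let b1 = b + length (code_exp e 0) + 1; b2 = b1 + code_length c1 + 1
      in code_exp e 0 @ [JumpZero 0 b2] @ code c1 b1 @ [Jump (b2 + code_length c2)] @ code c2 b2)"
| "code (For x y c) b =
     [Const x 0, Sub 0 y x, JumpZero 0 (b + code_length c + 6)] @ code c (b + 3) @
     [Const 0 1, Add x x 0, Jump (b + 1)]"

lemma length_code: "length (code c b) = code_length c"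
  by (induction c arbitrary: b) (auto simp: Let_def)

text \<open>The value at depth \<open>d\<close> goes to temporary \<open>d\<close>, and the second
  operand to the one above. An array access uses temporary \<open>d + 1\<close> for the array
  number, hence \<open>d < 7\<close>.\<close>

primrec wf_exp :: "exp \<Rightarrow> nat \<Rightarrow> bool" where
  "wf_exp (Num k) d \<longleftrightarrow> d < 8"
| "wf_exp (Arr x e) d \<longleftrightarrow> 8 \<le> x \<and> x < 64 \<and> d < 7 \<and> wf_exp e d"
| "wf_exp (Inp e) d \<longleftrightarrow> wf_exp e d"
| "wf_exp (Plus a b) d \<longleftrightarrow> wf_exp a d \<and> wf_exp b (Suc d)"
| "wf_exp (Minus a b) d \<longleftrightarrow> wf_exp a d \<and> wf_exp b (Suc d)"

primrec wf_com :: "com \<Rightarrow> bool" where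
  "wf_com Skip \<longleftrightarrow> True"
| "wf_com (Put x i e) \<longleftrightarrow> 8 \<le> x \<and> x < 64 \<and> wf_exp i 0 \<and> wf_exp e 1"
| "wf_com (Out e) \<longleftrightarrow> wf_exp e 0"
| "wf_com (c1 ;; c2) \<longleftrightarrow> wf_com c1 \<and> wf_com c2"
| "wf_com (If e c1 c2) \<longleftrightarrow> wf_exp e 0 \<and> wf_com c1 \<and> wf_com c2"
| "wf_com (For x y c) \<longleftrightarrow> 8 \<le> x \<and> x < 64 \<and> 8 \<le> y \<and> y < 64 \<and> x \<noteq> y \<and>
     x \<notin> writes c \<and> y \<notin> writes c \<and> wf_com c"

lemma wf_exp_less: "wf_exp e d \<Longrightarrow> d < 8"
  by (induction e arbitrary: d) auto

text \<open>The conditions under which all register values stay below \<open>W\<close> and no loop has more than \<open>N\<close>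
  iterations.\<close>

primrec safe_exp :: "nat \<Rightarrow> nat list \<Rightarrow> exp \<Rightarrow> store \<Rightarrow> bool" where
  "safe_exp W inp (Num k) m \<longleftrightarrow> k < W"
| "safe_exp W inp (Arr x e) m \<longleftrightarrow> safe_exp W inp e m \<and> 64 * eval inp e m + x < W"
| "safe_exp W inp (Inp e) m \<longleftrightarrow> safe_exp W inp e m \<and> eval inp (Inp e) m < W"
| "safe_exp W inp (Plus a b) m \<longleftrightarrow>
     safe_exp W inp a m \<and> safe_exp W inp b m \<and> eval inp a m + eval inp b m < W"
| "safe_exp W inp (Minus a b) m \<longleftrightarrow> safe_exp W inp a m \<and> safe_exp W inp b m"

primrec safe :: "nat \<Rightarrow> nat \<Rightarrow> nat list \<Rightarrow> com \<Rightarrow> store \<Rightarrow> bool" where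
  "safe W N inp Skip m \<longleftrightarrow> True"
| "safe W N inp (Put x i e) m \<longleftrightarrow>
     safe_exp W inp i m \<and> safe_exp W inp e m \<and> 64 * eval inp i m + x < W"
| "safe W N inp (Out e) m \<longleftrightarrow> safe_exp W inp e m"
| "safe W N inp (c1 ;; c2) m \<longleftrightarrow> safe W N inp c1 m \<and> safe W N inp c2 (sem inp c1 m)"
| "safe W N inp (If e c1 c2) m \<longleftrightarrow> safe_exp W inp e m \<and>
     (if eval inp e m \<noteq> 0 then safe W N inp c1 m else safe W N inp c2 m)"
| "safe W N inp (For x y c) m \<longleftrightarrow> m y 0 \<le> N \<and>
     (\<forall>k<m y 0. safe W N inp c ((loop_step x (sem inp c) ^^ k) (upd x 0 0 m)))"

text \<open>A loop costs 3 for setting the counter and for the final test, and 5 in each iteration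
  for test, increment and jump.\<close>

primrec cost :: "nat \<Rightarrow> com \<Rightarrow> nat" where
  "cost N Skip = 0"
| "cost N (Put x i e) = code_length (Put x i e)"
| "cost N (Out e) = code_length (Out e)"
| "cost N (c1 ;; c2) = cost N c1 + cost N c2"
| "cost N (If e c1 c2) = length (code_exp e 0) + 2 + cost N c1 + cost N c2"
| "cost N (For x y c) = 3 + N * (cost N c + 5)"

primrec cost_factor :: "com \<Rightarrow> nat" where
  "cost_factor Skip = 0"
| "cost_factor (Put x i e) = code_length (Put x i e)"
| "cost_factor (Out e) = code_length (Out e)"
| "cost_factor (c1 ;; c2) = cost_factor c1 + cost_factor c2"
| "cost_factor (If e c1 c2) = length (code_exp e 0) + 2 + cost_factor c1 + cost_factor c2"
| "cost_factor (For x y c) = 8 + cost_factor c"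

primrec loop_depth :: "com \<Rightarrow> nat" where
  "loop_depth Skip = 0"
| "loop_depth (Put x i e) = 0"
| "loop_depth (Out e) = 0"
| "loop_depth (c1 ;; c2) = max (loop_depth c1) (loop_depth c2)"
| "loop_depth (If e c1 c2) = max (loop_depth c1) (loop_depth c2)"
| "loop_depth (For x y c) = Suc (loop_depth c)"

lemma cost_le:
  assumes "0 < N" "loop_depth c \<le> k"
  shows "cost N c \<le> cost_factor c * N ^ k"
  using assms(2)
proof (induction c arbitrary: k)
  case (If e c1 c2)
  have "1 \<le> N ^ k" using assms(1) by simp
  then have "(length (code_exp e 0) + 2) * 1 \<le> (length (code_exp e 0) + 2) * N ^ k"
    by (rule mult_le_mono2)
  moreover have "cost N c1 \<le> cost_factor c1 * N ^ k" "cost N c2 \<le> cost_factor c2 * N ^ k"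
    using If by auto
  ultimately show ?case by (simp add: algebra_simps)
next
  case (Seq c1 c2)
  then have "cost N c1 \<le> cost_factor c1 * N ^ k" "cost N c2 \<le> cost_factor c2 * N ^ k" by auto
  then show ?case by (simp add: algebra_simps)
next
  case (For x y c)
  then obtain j where k: "k = Suc j" "loop_depth c \<le> j" by (cases k) auto
  have 1: "1 \<le> N ^ j" "1 \<le> N ^ k" using assms(1) by auto
  have "N * (cost N c + 5) \<le> N * (cost_factor c * N ^ j + 5 * N ^ j)"
    using For.IH[OF k(2)] 1 by (intro mult_le_mono2 add_mono) auto
  moreover have "3 \<le> 3 * N ^ k" using 1 by simp
  ultimately have "cost N (For x y c) \<le> 3 * N ^ k + N * (cost_factor c * N ^ j + 5 * N ^ j)"
    unfolding cost.simps by linarith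
  also have "\<dots> = cost_factor (For x y c) * N ^ k" by (simp add: k algebra_simps)
  finally show ?case .
next
  case (Put x i e)
  have "code_length (Put x i e) * 1 \<le> code_length (Put x i e) * N ^ k"
    using assms(1) by (intro mult_le_mono2) simp
  then show ?case by simp
next
  case (Out e)
  have "code_length (Out e) * 1 \<le> code_length (Out e) * N ^ k"
    using assms(1) by (intro mult_le_mono2) simp
  then show ?case by simp
qed simp

section \<open>Correctness of the compiled code\<close>

definition code_at :: "instr list \<Rightarrow> nat \<Rightarrow> instr list \<Rightarrow> bool" where
  "code_at P b cs \<longleftrightarrow> b + length cs \<le> length P \<and> (\<forall>i<length cs. P ! (b + i) = cs ! i)"

lemma code_at_iff:
  "code_at P b cs \<longleftrightarrow> b + length cs \<le> length P \<and> take (length cs) (drop b P) = cs"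
  by (auto simp: code_at_def list_eq_iff_nth_eq)

lemma code_at_append:
  "code_at P b (cs @ ds) \<longleftrightarrow> code_at P b cs \<and> code_at P (b + length cs) ds"
  unfolding code_at_iff by (auto simp: take_add add.commute)

lemma code_at_Nil: "code_at P b [] \<longleftrightarrow> b \<le> length P"
  by (simp add: code_at_def)

lemma code_at_Cons: "code_at P b (c # cs) \<longleftrightarrow> b < length P \<and> P ! b = c \<and> code_at P (Suc b) cs"
  unfolding code_at_def by (auto simp: All_less_Suc2 less_Suc_eq_0_disj)

text \<open>The memory bound is demanded at every intermediate step, since
  \<open>words_below\<close> speaks of all times.\<close>

definition runs ::
    "instr list \<Rightarrow> nat list \<Rightarrow> nat \<Rightarrow> ram_state \<Rightarrow> nat \<Rightarrow> ram_state \<Rightarrow> bool" where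
  "runs P inp W s t s' \<longleftrightarrow> (ram_step P inp ^^ t) s = s' \<and> clock s' = clock s + t \<and>
     (\<forall>k\<le>t. \<forall>a. mem ((ram_step P inp ^^ k) s) a < W)"

lemma runs_refl: "(\<And>a. mem s a < W) \<Longrightarrow> runs P inp W s 0 s"
  by (simp add: runs_def)

lemma runs_bounded: "runs P inp W s t s' \<Longrightarrow> mem s a < W \<and> mem s' a < W"
  by (auto simp: runs_def)

lemma runs_trans:
  assumes "runs P inp W s t s'" "runs P inp W s' t' s''"
  shows "runs P inp W s (t + t') s''"
proof -
  have "(ram_step P inp ^^ (t + k)) s = (ram_step P inp ^^ k) s'" for k
    using assms(1) by (subst add.commute) (simp add: funpow_add runs_def)
  moreover have "mem ((ram_step P inp ^^ k) s) a < W" if "k \<le> t + t'" for k a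
  proof (cases "k \<le> t")
    case False
    then have "k = t + (k - t)" "k - t \<le> t'" using that by auto
    then show ?thesis using assms(2) calculation[of "k - t"] unfolding runs_def by metis
  qed (use assms(1) in \<open>auto simp: runs_def\<close>)
  ultimately show ?thesis using assms by (auto simp: runs_def)
qed

lemma runs_instr:
  assumes "pc s < length P" "\<And>a. mem s a < W"
    and "s' = exec_instr inp (P ! pc s) (s\<lparr>pc := Suc (pc s), clock := Suc (clock s)\<rparr>)"
    and "\<And>a. mem s' a < W"
  shows "runs P inp W s 1 s'"
proof -
  have "ram_step P inp s = s'" using assms(1,3) by (simp add: ram_step_def halted_def)
  moreover have "clock s' = Suc (clock s)"
    unfolding assms(3) by (cases "P ! pc s") auto
  ultimately show ?thesis using assms(2,4) by (auto simp: runs_def le_Suc_eq)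
qed

fun target :: "instr \<Rightarrow> (nat \<Rightarrow> nat) \<Rightarrow> nat" where
  "target (Const r k) \<mu> = r"
| "target (Add r a b) \<mu> = r"
| "target (Sub r a b) \<mu> = r"
| "target (Load r a) \<mu> = r"
| "target (Read r a) \<mu> = r"
| "target (Store a r) \<mu> = \<mu> a"
| "target _ \<mu> = 0"

fun result :: "nat list \<Rightarrow> instr \<Rightarrow> (nat \<Rightarrow> nat) \<Rightarrow> nat" where
  "result inp (Const r k) \<mu> = k"
| "result inp (Add r a b) \<mu> = \<mu> a + \<mu> b"
| "result inp (Sub r a b) \<mu> = \<mu> a - \<mu> b"
| "result inp (Load r a) \<mu> = \<mu> (\<mu> a)"
| "result inp (Read r a) \<mu> = (if \<mu> a < length inp then inp ! \<mu> a else 0)"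
| "result inp (Store a r) \<mu> = \<mu> r"
| "result inp _ \<mu> = 0"

fun writing :: "instr \<Rightarrow> bool" where
  "writing (Jump l) = False"
| "writing (JumpZero r l) = False"
| "writing (Emit r) = False"
| "writing EndSol = False"
| "writing _ = True"

definition written :: "nat list \<Rightarrow> instr \<Rightarrow> (nat \<Rightarrow> nat) \<Rightarrow> (nat \<Rightarrow> nat)" where
  "written inp i \<mu> = \<mu>(target i \<mu> := result inp i \<mu>)"

fun line_ok :: "nat \<Rightarrow> nat list \<Rightarrow> instr list \<Rightarrow> (nat \<Rightarrow> nat) \<Rightarrow> bool" where
  "line_ok W inp [] \<mu> \<longleftrightarrow> True"
| "line_ok W inp (i # is) \<mu> \<longleftrightarrow>
     writing i \<and> result inp i \<mu> < W \<and> line_ok W inp is (written inp i \<mu>)"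

lemma runs_line:
  assumes "code_at P (pc s) is" "\<And>a. mem s a < W" "line_ok W inp is (mem s)"
  shows "\<exists>s'. runs P inp W s (length is) s' \<and> pc s' = pc s + length is \<and>
    mem s' = fold (written inp) is (mem s) \<and> partial s' = partial s \<and> printed s' = printed s"
  using assms
proof (induction "is" arbitrary: s)
  case Nil
  then show ?case using runs_refl by (intro exI[of _ s]) auto
next
  case (Cons i "is")
  let ?s = "exec_instr inp i (s\<lparr>pc := Suc (pc s), clock := Suc (clock s)\<rparr>)"
  have i: "pc s < length P" "P ! pc s = i" "code_at P (Suc (pc s)) is"
    using Cons.prems(1) by (auto simp: code_at_Cons)
  have s: "mem ?s = written inp i (mem s)" "pc ?s = Suc (pc s)" "partial ?s = partial s"
    "printed ?s = printed s"
    using Cons.prems(3) by (cases i; simp add: written_def)+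
  have b: "mem ?s a < W" for a using Cons.prems(2,3) s(1) by (simp add: written_def)
  have "runs P inp W s 1 ?s"
    using runs_instr[OF i(1) Cons.prems(2) _ b] i(2) by blast
  moreover obtain s' where "runs P inp W ?s (length is) s'" "pc s' = pc ?s + length is"
    "mem s' = fold (written inp) is (mem ?s)" "partial s' = partial ?s" "printed s' = printed ?s"
    using Cons.IH[of ?s] i(3) s b Cons.prems(3) by auto
  ultimately show ?case using s runs_trans[of P inp W s 1 ?s "length is" s'] by auto
qed

definition represents :: "store \<Rightarrow> (nat \<Rightarrow> nat) \<Rightarrow> bool" where
  "represents m \<mu> \<longleftrightarrow> (\<forall>x i. 8 \<le> x \<and> x < 64 \<longrightarrow> \<mu> (64 * i + x) = m x i)"

lemma represents_cong: "represents m \<mu> \<Longrightarrow> (\<And>a. 8 \<le> a \<Longrightarrow> \<mu>' a = \<mu> a) \<Longrightarrow> represents m \<mu>'"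
  by (auto simp: represents_def)

text \<open>Array numbers are below 64, so an address determines the array as its residue and the
  index as its quotient; no other entry is touched.\<close>

lemma represents_upd:
  assumes "represents m \<mu>" "8 \<le> x" "x < 64"
    and "\<mu>' (64 * i + x) = v" "\<And>a. 8 \<le> a \<Longrightarrow> a \<noteq> 64 * i + x \<Longrightarrow> \<mu>' a = \<mu> a"
  shows "represents (upd x i v m) \<mu>'"
proof -
  have "\<mu>' (64 * j + y) = upd x i v m y j" if y: "8 \<le> y" "y < 64" for y j
  proof (cases "y = x \<and> j = i")
    case False
    then have "64 * j + y \<noteq> 64 * i + x" using y assms(3)
      by (metis div_mult_self4 div_less add.commute add_cancel_right_left mod_mult_self4 mod_less
        zero_neq_numeral)
    then have "\<mu>' (64 * j + y) = \<mu> (64 * j + y)" using assms(5) y by simp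
    then show ?thesis using False assms(1) y by (auto simp: represents_def upd_apply)
  qed (simp add: upd_apply assms(4))
  then show ?thesis by (simp add: represents_def)
qed

text \<open>Six doublings multiply by 64, as the machine has no multiplication. The final address is
  the largest value that occurs.\<close>

lemma address_line:
  assumes "64 * \<mu> d + x < W"
  shows "line_ok W inp (address d x) \<mu>"
    and "fold (written inp) (address d x) \<mu> = \<mu>(Suc d := x, d := 64 * \<mu> d + x)"
  using assms by (simp_all add: address_def written_def fun_upd_twist[of d "Suc d"]
    mult_2[symmetric])

text \<open>Temporaries below \<open>d\<close> hold pending operands and must survive, and so must
  the addresses from 8 on, which hold the store.\<close>

lemma runs_code_exp:
  assumes "code_at P (pc s) (code_exp e d)" "\<And>a. mem s a < W" "represents m (mem s)"
    and "wf_exp e d" "safe_exp W inp e m"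
  shows "\<exists>s'. runs P inp W s (length (code_exp e d)) s' \<and> pc s' = pc s + length (code_exp e d) \<and>
    mem s' d = eval inp e m \<and> (\<forall>a. a < d \<or> 8 \<le> a \<longrightarrow> mem s' a = mem s a) \<and>
    partial s' = partial s \<and> printed s' = printed s"
  using assms
proof (induction e arbitrary: d s)
  case (Num k)
  then show ?case using runs_line[of P s "[Const d k]" W inp] by (auto simp: written_def)
next
  case (Arr x e)
  obtain s1 where s1: "runs P inp W s (length (code_exp e d)) s1"
    "pc s1 = pc s + length (code_exp e d)" "mem s1 d = eval inp e m"
    "\<forall>a. a < d \<or> 8 \<le> a \<longrightarrow> mem s1 a = mem s a" "partial s1 = partial s" "printed s1 = printed s"
    using Arr.IH[of s d] Arr.prems by (auto simp: code_at_append)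
  have v: "fold (written inp) (address d x) (mem s1) =
      (mem s1)(Suc d := x, d := 64 * mem s1 d + x)"
    using address_line(2)[of "mem s1" d x W inp] Arr.prems(5) s1(3) by auto
  have d: "d < 7" using Arr.prems(4) by simp
  have val: "mem s1 (64 * eval inp e m + x) = m x (eval inp e m)"
    using Arr.prems(3,4) s1(4) by (simp add: represents_def)
  let ?is = "address d x @ [Load d d]"
  have ok: "line_ok W inp (is @ js) \<mu> \<longleftrightarrow>
      line_ok W inp is \<mu> \<and> line_ok W inp js (fold (written inp) is \<mu>)" for "is" js \<mu>
    by (induction "is" arbitrary: \<mu>) auto
  have b1: "mem s1 a < W" for a using runs_bounded s1(1) by blast
  have "m x (eval inp e m) < W" using val b1 by metis
  obtain s2 where s2: "runs P inp W s1 (length ?is) s2" "pc s2 = pc s1 + length ?is"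
    "mem s2 = fold (written inp) ?is (mem s1)" "partial s2 = partial s1" "printed s2 = printed s1"
  proof -
    have "code_at P (pc s1) ?is" using Arr.prems(1) s1(2) by (simp add: code_at_append)
    moreover have "line_ok W inp ?is (mem s1)"
      unfolding ok v using address_line(1)[of "mem s1" d x W inp] Arr.prems(5) s1(3) val
        \<open>m x (eval inp e m) < W\<close> Arr.prems(4) d
      by simp
    ultimately show thesis using runs_line[of P s1 ?is W inp] b1 that by blast
  qed
  have "mem s2 d = m x (eval inp e m)" "\<forall>a. a < d \<or> 8 \<le> a \<longrightarrow> mem s2 a = mem s1 a"
    using s2(3) v val d s1(3) Arr.prems(4) by (auto simp: written_def)
  then show ?case
    using runs_trans[OF s1(1) s2(1)] s1 s2 by (intro exI[of _ s2]) auto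
next
  case (Inp e)
  obtain s1 where s1: "runs P inp W s (length (code_exp e d)) s1"
    "pc s1 = pc s + length (code_exp e d)" "mem s1 d = eval inp e m"
    "\<forall>a. a < d \<or> 8 \<le> a \<longrightarrow> mem s1 a = mem s a" "partial s1 = partial s" "printed s1 = printed s"
    using Inp.IH[of s d] Inp.prems by (auto simp: code_at_append)
  have b1: "mem s1 a < W" for a using runs_bounded s1(1) by blast
  have d: "d < 8" using Inp.prems(4) wf_exp_less by auto
  obtain s2 where s2: "runs P inp W s1 (length [Read d d]) s2" "pc s2 = pc s1 + length [Read d d]"
    "mem s2 = fold (written inp) [Read d d] (mem s1)" "partial s2 = partial s1"
    "printed s2 = printed s1"
  proof -
    have "code_at P (pc s1) [Read d d]" using Inp.prems(1) s1(2) by (simp add: code_at_append)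
    moreover have "line_ok W inp [Read d d] (mem s1)" using Inp.prems(5) s1(3) by auto
    ultimately show thesis using runs_line[of P s1 "[Read d d]" W inp] b1 that by blast
  qed
  show ?case
    using runs_trans[OF s1(1) s2(1)] s1 s2 d by (intro exI[of _ s2]) (auto simp: written_def)
next
  case (Plus a b)
  obtain s1 where s1: "runs P inp W s (length (code_exp a d)) s1"
    "pc s1 = pc s + length (code_exp a d)" "mem s1 d = eval inp a m"
    "\<forall>a. a < d \<or> 8 \<le> a \<longrightarrow> mem s1 a = mem s a" "partial s1 = partial s" "printed s1 = printed s"
  proof -
    have "code_at P (pc s) (code_exp a d)" using Plus.prems(1) by (simp add: code_at_append)
    then show thesis
      using Plus.IH(1)[of s d] Plus.prems(2-5) that by auto
  qed
  have b1: "mem s1 a < W" for a using runs_bounded s1(1) by blast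
  have r1: "represents m (mem s1)" using represents_cong[OF Plus.prems(3)] s1(4) by blast
  obtain s2 where s2: "runs P inp W s1 (length (code_exp b (Suc d))) s2"
    "pc s2 = pc s1 + length (code_exp b (Suc d))" "mem s2 (Suc d) = eval inp b m"
    "\<forall>a. a < Suc d \<or> 8 \<le> a \<longrightarrow> mem s2 a = mem s1 a" "partial s2 = partial s1"
    "printed s2 = printed s1"
  proof -
    have "code_at P (pc s1) (code_exp b (Suc d))"
      using Plus.prems(1) s1(2) by (simp add: code_at_append)
    then show thesis
      using Plus.IH(2)[of s1 "Suc d"] Plus.prems(4,5) b1 r1 that by auto
  qed
  have b2: "mem s2 a < W" for a using runs_bounded s2(1) by blast
  have d: "d < 8" using Plus.prems(4) wf_exp_less by auto
  let ?is = "[Add d d (Suc d)]"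
  obtain s3 where s3: "runs P inp W s2 (length ?is) s3" "pc s3 = pc s2 + length ?is"
    "mem s3 = fold (written inp) ?is (mem s2)" "partial s3 = partial s2" "printed s3 = printed s2"
  proof -
    have "code_at P (pc s2) ?is"
      using Plus.prems(1) s1(2) s2(2) by (simp add: code_at_append add.assoc)
    moreover have "mem s2 d = eval inp a m" using s2(4) s1(3) by simp
    then have "line_ok W inp ?is (mem s2)"
      using Plus.prems(5) s2(3) by (simp)
    ultimately show thesis using runs_line[of P s2 ?is W inp] b2 that by blast
  qed
  show ?case
    using runs_trans[OF runs_trans[OF s1(1) s2(1)] s3(1)] s1 s2 s3 d
    by (intro exI[of _ s3]) (simp add: add.assoc written_def)
next
  case (Minus a b)
  obtain s1 where s1: "runs P inp W s (length (code_exp a d)) s1"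
    "pc s1 = pc s + length (code_exp a d)" "mem s1 d = eval inp a m"
    "\<forall>a. a < d \<or> 8 \<le> a \<longrightarrow> mem s1 a = mem s a" "partial s1 = partial s" "printed s1 = printed s"
  proof -
    have "code_at P (pc s) (code_exp a d)" using Minus.prems(1) by (simp add: code_at_append)
    then show thesis
      using Minus.IH(1)[of s d] Minus.prems(2-5) that by auto
  qed
  have b1: "mem s1 a < W" for a using runs_bounded s1(1) by blast
  have r1: "represents m (mem s1)" using represents_cong[OF Minus.prems(3)] s1(4) by blast
  obtain s2 where s2: "runs P inp W s1 (length (code_exp b (Suc d))) s2"
    "pc s2 = pc s1 + length (code_exp b (Suc d))" "mem s2 (Suc d) = eval inp b m"
    "\<forall>a. a < Suc d \<or> 8 \<le> a \<longrightarrow> mem s2 a = mem s1 a" "partial s2 = partial s1"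
    "printed s2 = printed s1"
  proof -
    have "code_at P (pc s1) (code_exp b (Suc d))"
      using Minus.prems(1) s1(2) by (simp add: code_at_append)
    then show thesis
      using Minus.IH(2)[of s1 "Suc d"] Minus.prems(4,5) b1 r1 that by auto
  qed
  have b2: "mem s2 a < W" for a using runs_bounded s2(1) by blast
  have d: "d < 8" using Minus.prems(4) wf_exp_less by auto
  let ?is = "[Sub d d (Suc d)]"
  obtain s3 where s3: "runs P inp W s2 (length ?is) s3" "pc s3 = pc s2 + length ?is"
    "mem s3 = fold (written inp) ?is (mem s2)" "partial s3 = partial s2" "printed s3 = printed s2"
  proof -
    have "code_at P (pc s2) ?is"
      using Minus.prems(1) s1(2) s2(2) by (simp add: code_at_append add.assoc)
    moreover have "mem s2 d = eval inp a m" using s2(4) s1(3) by simp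
    then have "line_ok W inp ?is (mem s2)"
      using b2[of d] s2(3) by (simp add: less_imp_diff_less)
    ultimately show thesis using runs_line[of P s2 ?is W inp] b2 that by blast
  qed
  show ?case
    using runs_trans[OF runs_trans[OF s1(1) s2(1)] s3(1)] s1 s2 s3 d
    by (intro exI[of _ s3]) (simp add: add.assoc written_def)
qed

text \<open>Branches and loops take varying time, so \<open>cost\<close> is only an upper bound and
  the exact time is left existential.\<close>

lemma runs_code:
  assumes "code_at P (pc s) (code c (pc s))" "\<And>a. mem s a < W" "represents m (mem s)"
    and "wf_com c" "safe W N inp c m" "64 \<le> W" "N < W"
  shows "\<exists>t s'. t \<le> cost N c \<and> runs P inp W s t s' \<and> pc s' = pc s + code_length c \<and>
    represents (sem inp c m) (mem s') \<and> partial s' = partial s @ outp inp c m \<and>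
    printed s' = printed s"
  using assms(1-5)
proof (induction c arbitrary: s m)
  case Skip
  then show ?case using runs_refl by (intro exI[of _ 0] exI[of _ s]) auto
next
  case (Put x i e)
  have at: "code_at P (pc s) (code_exp i 0)"
    "code_at P (pc s + length (code_exp i 0)) (address 0 x)"
    "code_at P (pc s + length (code_exp i 0) + length (address 0 x)) (code_exp e 1)"
    "code_at P (pc s + length (code_exp i 0) + length (address 0 x) + length (code_exp e 1))
      [Store 0 1]"
    using Put.prems(1) by (simp_all add: code_at_append)
  have sf: "safe_exp W inp i m" "safe_exp W inp e m" "64 * eval inp i m + x < W"
    and wf: "8 \<le> x" "x < 64" "wf_exp i 0" "wf_exp e 1"
    using Put.prems(4,5) by auto
  obtain s1 where s1: "runs P inp W s (length (code_exp i 0)) s1"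
    "pc s1 = pc s + length (code_exp i 0)" "mem s1 0 = eval inp i m"
    "\<forall>a. a < 0 \<or> 8 \<le> a \<longrightarrow> mem s1 a = mem s a" "partial s1 = partial s" "printed s1 = printed s"
    using runs_code_exp[OF at(1) Put.prems(2,3) wf(3) sf(1)] by blast
  have b1: "mem s1 a < W" for a using runs_bounded s1(1) by blast
  obtain s2 where s2: "runs P inp W s1 (length (address 0 x)) s2"
    "pc s2 = pc s1 + length (address 0 x)"
    "mem s2 = (mem s1)(Suc 0 := x, 0 := 64 * eval inp i m + x)"
    "partial s2 = partial s1" "printed s2 = printed s1"
    using runs_line[of P s1 "address 0 x" W inp] at(2) b1 s1(2,3) sf(3)
      address_line[of "mem s1" 0 x W inp] by auto
  have b2: "mem s2 a < W" for a using runs_bounded s2(1) by blast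
  have same2: "mem s2 a = mem s a" if "8 \<le> a" for a using that s1(4) s2(3) by simp
  then have "represents m (mem s2)" using represents_cong Put.prems(3) by blast
  moreover have "code_at P (pc s2) (code_exp e 1)" using at(3) s1(2) s2(2) by simp
  ultimately obtain s3 where s3: "runs P inp W s2 (length (code_exp e 1)) s3"
    "pc s3 = pc s2 + length (code_exp e 1)" "mem s3 1 = eval inp e m"
    "\<forall>a. a < 1 \<or> 8 \<le> a \<longrightarrow> mem s3 a = mem s2 a" "partial s3 = partial s2" "printed s3 = printed s2"
    using runs_code_exp[of P s2 e 1 W m inp] b2 wf(4) sf(2) by blast
  have b3: "mem s3 a < W" for a using runs_bounded s3(1) by blast
  have m0: "mem s3 0 = 64 * eval inp i m + x" using s3(4) s2(3) by simp
  have "code_at P (pc s3) [Store 0 1]" using at(4) s1(2) s2(2) s3(2) by simp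
  moreover have "line_ok W inp [Store 0 1] (mem s3)" using b3 by simp
  ultimately obtain s4 where s4: "runs P inp W s3 (length [Store 0 1]) s4"
    "pc s4 = pc s3 + length [Store 0 1]" "mem s4 = fold (written inp) [Store 0 1] (mem s3)"
    "partial s4 = partial s3" "printed s4 = printed s3"
    using runs_line[of P s3 "[Store 0 1]" W inp] b3 by blast
  have mem4: "mem s4 = (mem s3)(64 * eval inp i m + x := eval inp e m)"
    using s4(3) m0 s3(3) by (simp add: written_def)
  have "represents (sem inp (Put x i e) m) (mem s4)"
    unfolding sem.simps
    by (rule represents_upd[OF Put.prems(3) wf(1,2)])
      (use mem4 s3(4) same2 in simp_all)
  moreover have "runs P inp W s (cost N (Put x i e)) s4"
    using runs_trans[OF runs_trans[OF runs_trans[OF s1(1) s2(1)] s3(1)] s4(1)]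
    by (simp add: add.assoc)
  ultimately show ?case
    using s1 s2 s3 s4 by (intro exI[of _ "cost N (Put x i e)"] exI[of _ s4]) simp
next
  case (Out e)
  have at: "code_at P (pc s) (code_exp e 0)" "code_at P (pc s + length (code_exp e 0)) [Emit 0]"
    using Out.prems(1) by (simp_all add: code_at_append)
  obtain s1 where s1: "runs P inp W s (length (code_exp e 0)) s1"
    "pc s1 = pc s + length (code_exp e 0)" "mem s1 0 = eval inp e m"
    "\<forall>a. a < 0 \<or> 8 \<le> a \<longrightarrow> mem s1 a = mem s a" "partial s1 = partial s" "printed s1 = printed s"
    using runs_code_exp[OF at(1) Out.prems(2,3)] Out.prems(4,5) by auto
  have b1: "mem s1 a < W" for a using runs_bounded s1(1) by blast
  let ?s = "exec_instr inp (Emit 0) (s1\<lparr>pc := Suc (pc s1), clock := Suc (clock s1)\<rparr>)"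
  have r1: "runs P inp W s1 1 ?s"
    using at(2) s1(2) b1 by (intro runs_instr) (auto simp: code_at_Cons)
  have "runs P inp W s (cost N (Out e)) ?s" using runs_trans[OF s1(1) r1] by simp
  moreover have "represents m (mem ?s)"
    using represents_cong[OF Out.prems(3)] s1(4) by simp
  ultimately show ?case
    using s1 by (intro exI[of _ "cost N (Out e)"] exI[of _ ?s]) simp
next
  case (Seq c1 c2)
  have at: "code_at P (pc s) (code c1 (pc s))"
    "code_at P (pc s + code_length c1) (code c2 (pc s + code_length c1))"
    using Seq.prems(1) by (simp_all add: code_at_append length_code)
  obtain t1 s1 where s1: "t1 \<le> cost N c1" "runs P inp W s t1 s1" "pc s1 = pc s + code_length c1"
    "represents (sem inp c1 m) (mem s1)" "partial s1 = partial s @ outp inp c1 m"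
    "printed s1 = printed s"
    using Seq.IH(1)[OF at(1) Seq.prems(2,3)] Seq.prems(4,5) by auto
  have b1: "mem s1 a < W" for a using runs_bounded s1(2) by blast
  obtain t2 s2 where s2: "t2 \<le> cost N c2" "runs P inp W s1 t2 s2" "pc s2 = pc s1 + code_length c2"
    "represents (sem inp c2 (sem inp c1 m)) (mem s2)"
    "partial s2 = partial s1 @ outp inp c2 (sem inp c1 m)" "printed s2 = printed s1"
    using Seq.IH(2)[of s1 "sem inp c1 m"] at(2) b1 s1(3,4) Seq.prems(4,5) by auto
  show ?case
    using runs_trans[OF s1(2) s2(2)] s1 s2 by (intro exI[of _ "t1 + t2"] exI[of _ s2]) simp
next
  case (If e c1 c2)
  define b1 b2 where "b1 = pc s + length (code_exp e 0) + 1" and "b2 = b1 + code_length c1 + 1"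
  have at: "code_at P (pc s) (code_exp e 0)" "b1 - 1 < length P" "P ! (b1 - 1) = JumpZero 0 b2"
    "code_at P b1 (code c1 b1)" "b2 - 1 < length P" "P ! (b2 - 1) = Jump (b2 + code_length c2)"
    "code_at P b2 (code c2 b2)"
    using If.prems(1)
    by (simp_all add: b1_def b2_def code_at_append code_at_Cons Let_def length_code)
  obtain s1 where s1: "runs P inp W s (length (code_exp e 0)) s1"
    "pc s1 = b1 - 1" "mem s1 0 = eval inp e m"
    "\<forall>a. a < 0 \<or> 8 \<le> a \<longrightarrow> mem s1 a = mem s a" "partial s1 = partial s" "printed s1 = printed s"
    using runs_code_exp[OF at(1) If.prems(2,3)] If.prems(4,5) by (auto simp: b1_def)
  have m1: "mem s1 a < W" for a using runs_bounded s1(1) by blast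
  let ?s2 = "exec_instr inp (JumpZero 0 b2) (s1\<lparr>pc := Suc (pc s1), clock := Suc (clock s1)\<rparr>)"
  have mem2: "mem ?s2 = mem s1" by simp
  have r2: "runs P inp W s1 1 ?s2"
    using at(2,3) s1(2) m1 by (intro runs_instr) auto
  have rep2: "represents m (mem ?s2)"
    unfolding mem2 using represents_cong[OF If.prems(3)] s1(4) by simp
  have bd2: "mem ?s2 a < W" for a using m1 by simp
  have r12: "runs P inp W s (length (code_exp e 0) + 1) ?s2" using runs_trans[OF s1(1) r2] .
  have out2: "partial ?s2 = partial s" "printed ?s2 = printed s" using s1(5,6) by simp_all
  show ?case
  proof (cases "eval inp e m = 0")
    case False
    have pc2: "pc ?s2 = b1" using False s1(2,3) by (simp add: b1_def)
    obtain t3 s3 where s3: "t3 \<le> cost N c1" "runs P inp W ?s2 t3 s3" "pc s3 = b1 + code_length c1"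
      "represents (sem inp c1 m) (mem s3)" "partial s3 = partial s @ outp inp c1 m"
      "printed s3 = printed s"
      using If.IH(1)[of ?s2 m] at(4) bd2 rep2 If.prems(4,5) False unfolding pc2 out2 by auto
    let ?s4 = "exec_instr inp (Jump (b2 + code_length c2))
      (s3\<lparr>pc := Suc (pc s3), clock := Suc (clock s3)\<rparr>)"
    have b3: "mem s3 a < W" for a using runs_bounded s3(2) by blast
    have r4: "runs P inp W s3 1 ?s4"
      using at(5,6) s3(3) b3 by (intro runs_instr) (auto simp: b2_def)
    show ?thesis
      using runs_trans[OF runs_trans[OF r12 s3(2)] r4] s3 False
      by (intro exI[of _ "length (code_exp e 0) + 1 + t3 + 1"] exI[of _ ?s4])
        (simp add: b1_def b2_def)
  next
    case True
    have pc2: "pc ?s2 = b2" using True s1(3) by simp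
    obtain t3 s3 where s3: "t3 \<le> cost N c2" "runs P inp W ?s2 t3 s3" "pc s3 = b2 + code_length c2"
      "represents (sem inp c2 m) (mem s3)" "partial s3 = partial s @ outp inp c2 m"
      "printed s3 = printed s"
      using If.IH(2)[of ?s2 m] at(7) bd2 rep2 If.prems(4,5) True unfolding pc2 out2 by auto
    show ?thesis
      using runs_trans[OF r12 s3(2)] s3 True
      by (intro exI[of _ "length (code_exp e 0) + 1 + t3"] exI[of _ s3])
        (simp add: b1_def b2_def)
  qed
next
  case (For x y c)
  let ?b = "pc s"
  define st where "st k = (loop_step x (sem inp c) ^^ k) (upd x 0 0 m)" for k
  have wf: "8 \<le> x" "x < 64" "8 \<le> y" "y < 64" "x \<noteq> y" "x \<notin> writes c" "y \<notin> writes c" "wf_com c"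
    using For.prems(4) by auto
  have sf: "m y 0 \<le> N" "\<And>k. k < m y 0 \<Longrightarrow> safe W N inp c (st k)"
    using For.prems(5) by (auto simp: st_def)
  have st: "st k x 0 = k" "st k y 0 = m y 0" for k
    using loop_counter[OF wf(6), where k = k and inp = inp and m = m] wf by (auto simp: st_def)
  have at: "code_at P ?b [Const x 0]" "code_at P (?b + 1) [Sub 0 y x]"
    "?b + 2 < length P" "P ! (?b + 2) = JumpZero 0 (?b + code_length c + 6)"
    "code_at P (?b + 3) (code c (?b + 3))"
    "code_at P (?b + 3 + code_length c) [Const 0 1, Add x x 0]"
    "?b + 5 + code_length c < length P" "P ! (?b + 5 + code_length c) = Jump (?b + 1)"
    using For.prems(1)
    by (simp_all add: code_at_append code_at_Cons code_at_Nil length_code numeral_eq_Suc)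
  have loop_head: "\<exists>s3. runs P inp W s1 2 s3 \<and>
      pc s3 = (if m y 0 \<le> k then ?b + code_length c + 6 else ?b + 3) \<and>
      represents (st k) (mem s3) \<and> partial s3 = partial s1 \<and> printed s3 = printed s1"
    if s1: "pc s1 = ?b + 1" "\<And>a. mem s1 a < W" "represents (st k) (mem s1)" for k s1
  proof -
    have xy: "mem s1 x = k" "mem s1 y = m y 0"
      using s1(3) wf st[of k] by (simp_all add: represents_def) (metis add_0 mult_0_right)+
    have "line_ok W inp [Sub 0 y x] (mem s1)"
      using s1(2)[of y] by (simp add: less_imp_diff_less)
    then obtain s2 where s2: "runs P inp W s1 1 s2" "pc s2 = ?b + 2"
      "mem s2 = (mem s1)(0 := m y 0 - k)" "partial s2 = partial s1" "printed s2 = printed s1"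
      using runs_line[of P s1 "[Sub 0 y x]" W inp] at(2) s1(1,2) xy by (auto simp: written_def)
    define s3 where "s3 = exec_instr inp (JumpZero 0 (?b + code_length c + 6))
      (s2\<lparr>pc := Suc (pc s2), clock := Suc (clock s2)\<rparr>)"
    have mem3: "mem s3 = mem s2" by (simp add: s3_def)
    have b2: "mem s2 a < W" for a using runs_bounded s2(1) by blast
    have r3: "runs P inp W s2 1 s3"
      using at(3,4) s2(2) b2 mem3 by (intro runs_instr) (auto simp: s3_def)
    have "represents (st k) (mem s3)"
      unfolding mem3 using represents_cong[OF s1(3)] s2(3) by simp
    moreover have "pc s3 = (if m y 0 \<le> k then ?b + code_length c + 6 else ?b + 3)"
      "partial s3 = partial s1" "printed s3 = printed s1"
      using s2 by (simp_all add: s3_def)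
    moreover have "runs P inp W s1 2 s3" using runs_trans[OF s2(1) r3] by (simp only: one_add_one)
    ultimately show ?thesis by blast
  qed
  \<comment> \<open>\<open>j\<close> counts the iterations still to go; the extra 2 is the final
    test.\<close>
  have loop: "\<exists>t s'. t \<le> j * (cost N c + 5) + 2 \<and> runs P inp W s1 t s' \<and>
      pc s' = ?b + code_length c + 6 \<and> represents (st (m y 0)) (mem s') \<and>
      partial s' = partial s1 @ concat (map (\<lambda>k. outp inp c (st k)) [k..<m y 0]) \<and>
      printed s' = printed s1"
    if "k + j = m y 0" "pc s1 = ?b + 1" "\<And>a. mem s1 a < W" "represents (st k) (mem s1)" for j k s1
    using that
  proof (induction j arbitrary: k s1)
    case (0 k s1)
    note head = loop_head[OF 0(2-4)]
    then obtain s3 where s3: "runs P inp W s1 2 s3" "pc s3 = ?b + code_length c + 6"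
      "represents (st k) (mem s3)" "partial s3 = partial s1" "printed s3 = printed s1"
      using 0(1) by auto
    then show ?case using 0(1) by (intro exI[of _ 2] exI[of _ s3]) simp
  next
    case (Suc j k s1)
    have k: "k < m y 0" using Suc.prems(1) by simp
    obtain s3 where s3: "runs P inp W s1 2 s3" "pc s3 = ?b + 3"
      "represents (st k) (mem s3)" "partial s3 = partial s1" "printed s3 = printed s1"
      using loop_head[OF Suc.prems(2-4)] k by auto
    have b3: "mem s3 a < W" for a using runs_bounded s3(1) by blast
    obtain t4 s4 where s4: "t4 \<le> cost N c" "runs P inp W s3 t4 s4"
      "pc s4 = ?b + 3 + code_length c" "represents (sem inp c (st k)) (mem s4)"
      "partial s4 = partial s3 @ outp inp c (st k)" "printed s4 = printed s3"
      using For.IH[of s3 "st k"] at(5) s3(2,3) b3 wf(8) sf(2)[OF k] by auto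
    have b4: "mem s4 a < W" for a using runs_bounded s4(2) by blast
    have x4: "mem s4 x = k"
      using s4(4) wf(1,2) st(1)[of k] sem_frame[OF wf(6)]
      by (simp add: represents_def) (metis add_0 mult_0_right)
    have "code_at P (pc s4) [Const 0 1, Add x x 0]" using at(6) s4(3) by simp
    moreover have "line_ok W inp [Const 0 1, Add x x 0] (mem s4)"
      using x4 wf(1) k sf(1) assms(6,7) by (simp add: written_def)
    ultimately obtain s5 where s5: "runs P inp W s4 2 s5" "pc s5 = pc s4 + 2"
      "mem s5 = (mem s4)(0 := 1, x := Suc k)" "partial s5 = partial s4" "printed s5 = printed s4"
      using runs_line[of P s4 "[Const 0 1, Add x x 0]" W inp] b4 x4 wf(1)
      by (auto simp: written_def numeral_2_eq_2)
    have b5: "mem s5 a < W" for a using runs_bounded s5(1) by blast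
    have "represents (st (Suc k)) (mem s5)"
    proof -
      have "st (Suc k) = upd x 0 (Suc k) (sem inp c (st k))"
        using st(1)[of k] sem_frame[OF wf(6)] by (simp add: st_def)
      moreover have "represents (upd x 0 (Suc k) (sem inp c (st k))) (mem s5)"
        by (rule represents_upd[OF s4(4) wf(1,2)]) (use s5(3) in simp_all)
      ultimately show ?thesis by simp
    qed
    moreover define s6 where
      "s6 = exec_instr inp (Jump (?b + 1)) (s5\<lparr>pc := Suc (pc s5), clock := Suc (clock s5)\<rparr>)"
    have p6: "pc s6 = ?b + 1" "mem s6 = mem s5" "partial s6 = partial s5" "printed s6 = printed s5"
      by (simp_all add: s6_def)
    have "pc s5 = ?b + 5 + code_length c" using s5(2) s4(3) by simp
    then have r6: "runs P inp W s5 1 s6"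
      using at(7,8) b5 p6(2) by (intro runs_instr) (auto simp: s6_def)
    ultimately obtain t7 s7 where s7: "t7 \<le> j * (cost N c + 5) + 2" "runs P inp W s6 t7 s7"
      "pc s7 = ?b + code_length c + 6" "represents (st (m y 0)) (mem s7)"
      "partial s7 = partial s6 @ concat (map (\<lambda>k. outp inp c (st k)) [Suc k..<m y 0])"
      "printed s7 = printed s6"
      using Suc.IH[of "Suc k" s6] Suc.prems(1) p6 b5 by auto
    have "runs P inp W s1 (2 + t4 + 2 + 1 + t7) s7"
      using runs_trans[OF runs_trans[OF runs_trans[OF runs_trans[OF s3(1) s4(2)] s5(1)] r6] s7(2)] .
    moreover have "[k..<m y 0] = k # [Suc k..<m y 0]" using k upt_conv_Cons by blast
    ultimately show ?case
      using s7 p6 s5 s4 s3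
      by (intro exI[of _ "2 + t4 + 2 + 1 + t7"] exI[of _ s7]) simp
  qed
  have "line_ok W inp [Const x 0] (mem s)" using assms(6) by simp
  then obtain s1 where s1: "runs P inp W s 1 s1" "pc s1 = ?b + 1" "mem s1 = (mem s)(x := 0)"
    "partial s1 = partial s" "printed s1 = printed s"
    using runs_line[OF at(1) For.prems(2), of inp] by (auto simp: written_def)
  have b1: "mem s1 a < W" for a using runs_bounded s1(1) by blast
  have "represents (st 0) (mem s1)"
    using represents_upd[OF For.prems(3) wf(1,2), of "mem s1" 0 0] s1(3) by (simp add: st_def)
  then obtain t2 s2 where s2: "t2 \<le> m y 0 * (cost N c + 5) + 2" "runs P inp W s1 t2 s2"
    "pc s2 = ?b + code_length c + 6" "represents (st (m y 0)) (mem s2)"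
    "partial s2 = partial s1 @ concat (map (\<lambda>k. outp inp c (st k)) [0..<m y 0])"
    "printed s2 = printed s1"
    using loop[of 0 "m y 0" s1] s1(2) b1 by auto
  have "m y 0 * (cost N c + 5) \<le> N * (cost N c + 5)" using sf(1) by (rule mult_le_mono1)
  then have "1 + t2 \<le> cost N (For x y c)" using s2(1) unfolding cost.simps by linarith
  then show ?case
    using runs_trans[OF s1(1) s2(2)] s2 s1
    by (intro exI[of _ "1 + t2"] exI[of _ s2]) (simp add: st_def)
qed

text \<open>Variable 8 holds a bound on all values and variables 9 and 10 are the bounds of all loops.
  A value that could exceed the bound is cut off: \<open>a - (a - B) = min a B\<close> in truncated
  subtraction.\<close>

primrec small :: "exp \<Rightarrow> bool" where
  "small (Num k) \<longleftrightarrow> k \<le> 1"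
| "small (Arr x e) \<longleftrightarrow> True"
| "small (Inp e) \<longleftrightarrow> True"
| "small (Plus a b) \<longleftrightarrow> False"
| "small (Minus a b) \<longleftrightarrow> small a \<or> b = Minus a (Var 8)"

abbreviation Capped :: "exp \<Rightarrow> exp" where
  "Capped a \<equiv> Minus a (Minus a (Var 8))"

text \<open>With all entries and inputs bounded by \<open>B\<close> and \<open>B\<close> positive, a
  value is at most \<open>magnitude e * B\<close>. \<open>moderate\<close> limits all intermediate
  values to \<open>g * B\<close> in this way.\<close>

primrec magnitude :: "exp \<Rightarrow> nat" where
  "magnitude (Num k) = k"
| "magnitude (Arr x e) = 1"
| "magnitude (Inp e) = 1"
| "magnitude (Plus a b) = magnitude a + magnitude b"
| "magnitude (Minus a b) = magnitude a"

primrec moderate :: "nat \<Rightarrow> exp \<Rightarrow> bool" where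
  "moderate g (Num k) \<longleftrightarrow> k \<le> g"
| "moderate g (Arr x e) \<longleftrightarrow> x < 64 \<and> moderate g e \<and> magnitude e \<le> g"
| "moderate g (Inp e) \<longleftrightarrow> moderate g e"
| "moderate g (Plus a b) \<longleftrightarrow> moderate g a \<and> moderate g b \<and> magnitude a + magnitude b \<le> g"
| "moderate g (Minus a b) \<longleftrightarrow> moderate g a \<and> moderate g b"

primrec static :: "nat \<Rightarrow> com \<Rightarrow> bool" where
  "static g Skip \<longleftrightarrow> True"
| "static g (Put x i e) \<longleftrightarrow> x \<notin> {8, 9, 10} \<and> x < 64 \<and> moderate g i \<and> magnitude i \<le> g \<and>
     moderate g e \<and> small e"
| "static g (Out e) \<longleftrightarrow> moderate g e"
| "static g (c1 ;; c2) \<longleftrightarrow> static g c1 \<and> static g c2"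
| "static g (If e c1 c2) \<longleftrightarrow> moderate g e \<and> static g c1 \<and> static g c2"
| "static g (For x y c) \<longleftrightarrow> x \<notin> {8, 9, 10} \<and> y \<in> {9, 10} \<and>
     x \<notin> writes c \<and> static g c"

definition bounded_store :: "nat \<Rightarrow> nat \<Rightarrow> store \<Rightarrow> bool" where
  "bounded_store B N m \<longleftrightarrow> (\<forall>x i. m x i \<le> B) \<and> m 8 0 = B \<and> m 9 0 \<le> N \<and> m 10 0 \<le> N"

context
  fixes inp :: "nat list" and B N g W :: nat
  assumes inp: "\<And>v. v \<in> set inp \<Longrightarrow> v \<le> B" and B: "1 \<le> B" and W: "64 * (g * B) + 64 < W" "B < W"
begin

lemma eval_magnitude: "bounded_store B N m \<Longrightarrow> eval inp e m \<le> magnitude e * B"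
proof (induction e)
  case (Num k)
  show ?case using mult_le_mono2[OF B, of k] by simp
qed (use inp in \<open>auto simp: bounded_store_def algebra_simps\<close>)

lemma eval_small: "bounded_store B N m \<Longrightarrow> small e \<Longrightarrow> eval inp e m \<le> B"
proof (induction e)
  case (Num k)
  then show ?case using B by simp
next
  case (Minus a b)
  then show ?case by (auto simp: bounded_store_def intro: le_trans[OF diff_le_self])
qed (use inp in \<open>auto simp: bounded_store_def\<close>)

lemma moderate_safe:
  assumes "bounded_store B N m" "moderate g e"
  shows "safe_exp W inp e m"
  using assms(2)
proof (induction e)
  case (Num k)
  have "k * 1 \<le> g * B" using Num B by (intro mult_le_mono) auto
  then show ?case using W by simp
next
  case (Arr x e)
  have "eval inp e m \<le> g * B"
    using le_trans[OF eval_magnitude[OF assms(1), of e] mult_le_mono1] Arr.prems by simp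
  then show ?case using Arr W by simp
next
  case (Inp e)
  have "eval inp (Inp e) m \<le> B" using eval_small[OF assms(1), of "Inp e"] by simp
  then show ?case using Inp W by simp
next
  case (Plus a b)
  have "eval inp (Plus a b) m \<le> g * B"
    using le_trans[OF eval_magnitude[OF assms(1), of "Plus a b"] mult_le_mono1] Plus.prems
    by simp
  then show ?case using Plus W by simp
qed auto

text \<open>A \<open>small\<close> expression never exceeds \<open>B\<close>, so the bound survives
  every assignment as long as variables 8, 9 and 10 are left alone. Word size is thereby settled by
  a check of the syntax.\<close>

lemma static_safe:
  assumes "static g c" "bounded_store B N m"
  shows "safe W N inp c m \<and> bounded_store B N (sem inp c m)"
  using assms
proof (induction c arbitrary: m)
  case (Put x i e)
  have "eval inp i m \<le> g * B"
    using le_trans[OF eval_magnitude[OF Put.prems(2), of i] mult_le_mono1] Put.prems(1) by simp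
  moreover have "bounded_store B N (sem inp (Put x i e) m)"
    using eval_small[OF Put.prems(2), of e] Put.prems by (auto simp: bounded_store_def upd_apply)
  ultimately show ?case using moderate_safe[OF Put.prems(2)] Put.prems(1) W by simp
next
  case (Out e)
  then show ?case using moderate_safe by simp
next
  case (If e c1 c2)
  then show ?case using moderate_safe[of m e] by simp
next
  case (For x y c)
  let ?st = "\<lambda>k. (loop_step x (sem inp c) ^^ k) (upd x 0 0 m)"
  have x: "x \<notin> {8, 9, 10}" "static g c" "x \<notin> writes c" using For.prems(1) by auto
  have "m y 0 \<le> N" "m y 0 \<le> B" using For.prems by (auto simp: bounded_store_def)
  have bs: "bounded_store B N (upd x 0 v s)" if "bounded_store B N s" "v \<le> B" for v s
    using that x(1) by (auto simp: bounded_store_def upd_apply)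
  have 0: "bounded_store B N (?st 0)" using bs[OF For.prems(2), of 0] by simp
  have "bounded_store B N (?st k)" if "k \<le> m y 0" for k
    using that
  proof (induction k)
    case (Suc k)
    let ?s = "sem inp c (?st k)"
    have s: "bounded_store B N ?s" using For.IH[OF x(2)] Suc by simp
    have "?s x 0 = k" using loop_counter(1)[OF x(3), of k inp m] sem_frame[OF x(3)] by simp
    then show ?case using bs[OF s] Suc.prems \<open>m y 0 \<le> B\<close> by simp
  qed (use 0 in simp)
  then show ?case using For.IH[OF x(2)] \<open>m y 0 \<le> N\<close> by simp
qed auto

end

text \<open>After an initialization \<open>c0\<close>, the command \<open>c\<close> is repeated while variable 11 is not zero,
  and each repetition completes one solution.\<close>

definition program :: "com \<Rightarrow> com \<Rightarrow> instr list" where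
  "program c0 c = code c0 0 @ [JumpZero 11 (code_length c0 + code_length c + 3)] @
     code c (code_length c0 + 1) @ [EndSol, Jump (code_length c0)]"

lemma represents_0: "represents m \<mu> \<Longrightarrow> 8 \<le> x \<Longrightarrow> x < 64 \<Longrightarrow> \<mu> x = m x 0"
  unfolding represents_def by (metis add_0 mult_0_right)

text \<open>\<open>t0\<close> is the time of the latest completed solution and \<open>e\<close>
  bounds the time passed since then: at first the initialization, later only the jump back, hence
  \<open>1 \<le> e\<close>. The 2 in the bound on \<open>d\<close> stands for the test and
  \<open>EndSol\<close>.\<close>

lemma program_loop:
  fixes c0 c :: com
  defines "P \<equiv> program c0 c" and "L \<equiv> code_length c0"
  assumes wf: "wf_com c" and W: "64 \<le> W" "N < W"
    and d: "e + cost N c + 2 \<le> d" "1 \<le> e"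
    and K: "\<And>k. k < K \<Longrightarrow> (sem inp c ^^ k) m 11 0 \<noteq> 0 \<and> safe W N inp c ((sem inp c ^^ k) m)"
      "(sem inp c ^^ K) m 11 0 = 0"
    and s: "pc s = L" "\<And>a. mem s a < W" "represents m (mem s)" "partial s = []"
    and t0: "clock s \<le> t0 + e"
  shows "\<exists>t s' ts. runs P inp W s t s' \<and> halted P s' \<and> partial s' = [] \<and> length ts = K \<and>
    printed s' = printed s @ zip ts (map (\<lambda>k. outp inp c ((sem inp c ^^ k) m)) [0..<K]) \<and>
    successively (\<lambda>t t'. t' \<le> t + d) (t0 # ts @ [clock s'])"
  using K s t0
proof (induction K arbitrary: m s t0)
  case 0
  have P: "L < length P" "P ! L = JumpZero 11 (L + code_length c + 3)"
    and len: "length P = L + code_length c + 3"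
    by (simp_all add: P_def L_def program_def length_code nth_append)
  let ?s = "exec_instr inp (JumpZero 11 (L + code_length c + 3))
    (s\<lparr>pc := Suc (pc s), clock := Suc (clock s)\<rparr>)"
  have "mem s 11 = 0"
    using 0(2) represents_0[OF 0(5), of 11] by simp
  then have "halted P ?s" "clock ?s \<le> t0 + d" "partial ?s = []" "printed ?s = printed s"
    using len 0(6,7) d by (simp_all add: halted_def)
  moreover have "runs P inp W s 1 ?s"
    using P 0(3,4) by (intro runs_instr) auto
  ultimately show ?case by (intro exI[of _ 1] exI[of _ ?s] exI[of _ "[]"]) simp
next
  case (Suc K)
  have at: "code_at P (L + 1) (code c (L + 1))" "L < length P" "P ! L = JumpZero 11 (L + code_length c + 3)"
    "L + 1 + code_length c < length P" "P ! (L + 1 + code_length c) = EndSol"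
    "L + 2 + code_length c < length P" "P ! (L + 2 + code_length c) = Jump L"
    by (simp_all add: P_def L_def program_def length_code nth_append code_at_def)
  let ?s1 = "exec_instr inp (JumpZero 11 (L + code_length c + 3))
    (s\<lparr>pc := Suc (pc s), clock := Suc (clock s)\<rparr>)"
  have go: "m 11 0 \<noteq> 0" "safe W N inp c m" using Suc.prems(1)[of 0] by auto
  have "mem s 11 \<noteq> 0"
    using go(1) represents_0[OF Suc.prems(5), of 11] by simp
  then have s1: "pc ?s1 = L + 1" "mem ?s1 = mem s" "partial ?s1 = []" "printed ?s1 = printed s"
    "clock ?s1 = clock s + 1"
    using Suc.prems(3,6) by simp_all
  have r1: "runs P inp W s 1 ?s1"
    using at(2,3) Suc.prems(3,4) by (intro runs_instr) auto
  obtain t2 s2 where s2: "t2 \<le> cost N c" "runs P inp W ?s1 t2 s2" "pc s2 = L + 1 + code_length c"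
    "represents (sem inp c m) (mem s2)" "partial s2 = outp inp c m" "printed s2 = printed s"
    using runs_code[of P ?s1 c W m N inp] at(1) s1 Suc.prems(4,5) wf go(2) W by auto
  have b2: "mem s2 a < W" for a using runs_bounded s2(2) by blast
  have c2: "clock s2 = clock s + 1 + t2" using s2(2) s1(5) by (simp add: runs_def)
  let ?s3 = "exec_instr inp EndSol (s2\<lparr>pc := Suc (pc s2), clock := Suc (clock s2)\<rparr>)"
  have r3: "runs P inp W s2 1 ?s3"
    using at(4,5) s2(3) b2 by (intro runs_instr) auto
  let ?s4 = "exec_instr inp (Jump L) (?s3\<lparr>pc := Suc (pc ?s3), clock := Suc (clock ?s3)\<rparr>)"
  have r4: "runs P inp W ?s3 1 ?s4"
    using at(6,7) s2(3) b2 by (intro runs_instr) auto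
  have s4: "pc ?s4 = L" "mem ?s4 = mem s2" "partial ?s4 = []"
    "printed ?s4 = printed s @ [(clock s2 + 1, outp inp c m)]" "clock ?s4 = clock s2 + 2"
    using s2(5,6) by simp_all
  have K': "(sem inp c ^^ k) (sem inp c m) = (sem inp c ^^ Suc k) m" for k
    by (simp add: funpow_swap1)
  have "\<exists>t s' ts. runs P inp W ?s4 t s' \<and> halted P s' \<and> partial s' = [] \<and> length ts = K \<and>
    printed s' = printed ?s4 @ zip ts (map (\<lambda>k. outp inp c ((sem inp c ^^ k) (sem inp c m))) [0..<K]) \<and>
    successively (\<lambda>t t'. t' \<le> t + d) ((clock s2 + 1) # ts @ [clock s'])"
  proof (rule Suc.IH)
    show "clock ?s4 \<le> clock s2 + 1 + e" using d by simp
  qed (use Suc.prems(1)[of "Suc _"] Suc.prems(2) s4 b2 s2(4) in \<open>simp_all add: K' del: funpow.simps\<close>)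
  then obtain t5 s5 ts where s5: "runs P inp W ?s4 t5 s5" "halted P s5" "partial s5 = []"
    "length ts = K"
    "printed s5 = printed ?s4 @ zip ts (map (\<lambda>k. outp inp c ((sem inp c ^^ k) (sem inp c m))) [0..<K])"
    "successively (\<lambda>t t'. t' \<le> t + d) ((clock s2 + 1) # ts @ [clock s5])"
    by blast
  have "runs P inp W s (1 + t2 + 1 + 1 + t5) s5"
    using runs_trans[OF runs_trans[OF runs_trans[OF runs_trans[OF r1 s2(2)] r3] r4] s5(1)] .
  moreover have "map (\<lambda>k. outp inp c ((sem inp c ^^ k) m)) [0..<Suc K] =
      outp inp c m # map (\<lambda>k. outp inp c ((sem inp c ^^ k) (sem inp c m))) [0..<K]"
    by (subst upt_conv_Cons) (simp_all add: K' map_Suc_upt[symmetric] del: upt_Suc funpow.simps)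
  moreover have "clock s2 + 1 \<le> t0 + d" using c2 s2(1) d Suc.prems(7) by simp
  ultimately show ?case
    using s5 s4(4)
    by (intro exI[of _ "1 + t2 + 1 + 1 + t5"] exI[of _ s5] exI[of _ "(clock s2 + 1) # ts"])
      (simp del: upt_Suc)
qed

theorem program_enumerates:
  fixes inp c0 c
  defines "m \<equiv> sem inp c0 (\<lambda>_ _. 0)"
  assumes wf: "wf_com c0" "wf_com c" and W: "64 \<le> W" "N < W"
    and c0: "safe W N inp c0 (\<lambda>_ _. 0)" "outp inp c0 (\<lambda>_ _. 0) = []"
    and K: "\<And>k. k < K \<Longrightarrow> (sem inp c ^^ k) m 11 0 \<noteq> 0 \<and> safe W N inp c ((sem inp c ^^ k) m)"
      "(sem inp c ^^ K) m 11 0 = 0"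
    and F: "distinct (map (\<lambda>k. set (outp inp c ((sem inp c ^^ k) m))) [0..<K])"
      "(\<lambda>k. set (outp inp c ((sem inp c ^^ k) m))) ` {..<K} = F"
    and d: "cost N c0 + cost N c + 3 \<le> d"
  shows "enumerates_with_delay (program c0 c) inp F d \<and> words_below (program c0 c) inp W"
proof -
  let ?P = "program c0 c"
  have W0: "0 < W" using W by simp
  have "code_at ?P 0 (code c0 0)" by (simp add: program_def code_at_def nth_append)
  then obtain t1 s1 where s1: "t1 \<le> cost N c0" "runs ?P inp W ram_init t1 s1" "pc s1 = code_length c0"
    "represents m (mem s1)" "partial s1 = []" "printed s1 = []"
    using runs_code[of ?P ram_init c0 W "\<lambda>_ _. 0" N inp] W0 wf(1) c0 W
    by (auto simp: ram_init_def represents_def m_def)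
  have b1: "mem s1 a < W" for a using runs_bounded s1(2) by blast
  have c1: "clock s1 = t1" using s1(2) by (simp add: runs_def ram_init_def)
  obtain t2 s2 ts where s2: "runs ?P inp W s1 t2 s2" "halted ?P s2" "partial s2 = []" "length ts = K"
    "printed s2 = zip ts (map (\<lambda>k. outp inp c ((sem inp c ^^ k) m)) [0..<K])"
    "successively (\<lambda>t t'. t' \<le> t + d) (0 # ts @ [clock s2])"
    using program_loop[OF wf(2) W, where e = "cost N c0 + 1" and d = d and K = K and inp = inp
        and m = m and s = s1 and ?c0.0 = c0 and ?t0.0 = 0] d K s1(1,3-6) b1 c1 by auto
  have r: "runs ?P inp W ram_init (t1 + t2) s2" using runs_trans[OF s1(2) s2(1)] .
  then have fin: "ram_run ?P inp (t1 + t2) = s2" by (simp add: runs_def ram_run_def)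
  have "map (\<lambda>(t, xs). set xs) (printed s2) =
      map (\<lambda>k. set (outp inp c ((sem inp c ^^ k) m))) [0..<K]"
    unfolding s2(5) by (rule nth_equalityI) (simp_all add: s2(4))
  moreover have "map fst (printed s2) = ts" unfolding s2(5) using s2(4) by simp
  ultimately have "enumerates_with_delay ?P inp F d"
    unfolding enumerates_with_delay_def Let_def
    using s2 F by (intro exI[of _ "t1 + t2"]) (auto simp: fin atLeast0LessThan)
  moreover have "words_below ?P inp W"
    unfolding words_below_def
  proof (intro allI)
    fix t a
    \<comment> \<open>A halted state is a fixed point, so the memory bound for the run up to halting
      extends to all later times.\<close>
    have h: "ram_step ?P inp s2 = s2" using s2(2) by (simp add: ram_step_def)
    have "(ram_step ?P inp ^^ k) s2 = s2" for k by (induction k) (simp_all add: h)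
    then have "ram_run ?P inp (k + (t1 + t2)) = s2" for k
      using fin by (simp add: ram_run_def funpow_add)
    then have "ram_run ?P inp t = s2" if "t1 + t2 \<le> t"
      using that by (metis le_add_diff_inverse2)
    then show "mem (ram_run ?P inp t) a < W"
      using r by (cases "t \<le> t1 + t2") (auto simp: runs_def ram_run_def)
  qed
  ultimately show ?thesis by blast
qed

section \<open>The program\<close>

text \<open>The graph has \<open>N = 2 * n\<close> nodes. Variables and arrays are addressed by numbers:
  8 bound on all values, 9 \<open>n\<close>, 10 \<open>N\<close>, 11 whether to continue, 12 to 14 and 48 loop counters,
  15 and 26 length and content of the queue, 16 current node of the search, 17 and 18 the
  branching node and whether it exists, 19 result of a feasibility test, 20 position of the last
  left turn (plus one, or zero), 21 current turn, 22 running position in the input,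
  23 multiples of \<open>N\<close>, 24 matrix of the reversed anterior edges, 25 matrix of the graph \<open>E\<close>,
  27 to 31 the sets \<open>X\<close>, \<open>Y\<close>, \<open>D\<close>, \<open>I\<close>, \<open>M\<close>, 32 to 34 row positions of the three matrices in the
  input, 35 \<open>X \<union> Y \<union> I\<close>, 36 the empty set, 37 and 38 the current state \<open>(A, U)\<close>, 39 the set \<open>B\<close>
  whose \<open>star\<close> is computed in 44 by way of 40 to 43, 45 current turns, 46 neighbours
  of \<open>A\<close>, 47 the least side.\<close>

definition arr_set :: "nat \<Rightarrow> (nat \<Rightarrow> nat) \<Rightarrow> nat set" where
  "arr_set N f = {i. i < N \<and> f i \<noteq> 0}"

definition mat :: "nat \<Rightarrow> (nat \<Rightarrow> nat) \<Rightarrow> (nat \<times> nat) set" where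
  "mat N f = {(u, w). u < N \<and> w < N \<and> f (u * N + w) \<noteq> 0}"

lemma upd_same: "upd x i v m x = (m x)(i := v)"
  by (simp add: upd_def)

lemma upd_other: "y \<noteq> x \<Longrightarrow> upd x i v m y = m y"
  by (simp add: upd_def)

lemmas upd_simps = upd_same upd_other

section \<open>Graph search with a queue\<close>

definition push :: "nat \<Rightarrow> exp \<Rightarrow> com" where
  "push rs e = Put 26 (Var 15) e ;; Set 15 (Capped (Plus (Var 15) (Num 1))) ;; Put rs e (Num 1)"

lemma writes_push [simp]: "writes (push rs e) = {26, 15, rs}"
  by (auto simp: push_def)

definition clear :: "nat \<Rightarrow> com" where
  "clear x = For 12 10 (Put x (Var 12) (Num 0))"

text \<open>Rows are located by a lookup in array 23, which holds the multiples of \<open>N\<close>,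
  because there is no multiplication.\<close>

definition entry :: "nat \<Rightarrow> exp \<Rightarrow> exp \<Rightarrow> exp" where
  "entry mt i j = Arr mt (Plus (Arr 23 i) j)"

text \<open>Each node enters the queue at most once, so \<open>N\<close> iterations of the outer
  loop are enough; those beyond the end of the queue do nothing. With the scan of a row this is
  quadratic. The sum of two entries serves as a disjunction.\<close>

definition reach_com :: "nat \<Rightarrow> nat \<Rightarrow> nat \<Rightarrow> nat \<Rightarrow> com" where
  "reach_com mt sd bl rs =
     clear rs ;;
     Set 15 (Num 0) ;;
     For 12 10 (If (Arr sd (Var 12)) (push rs (Var 12)) Skip) ;;
     For 14 10 (If (Minus (Var 15) (Var 14))
       (Set 16 (Arr 26 (Var 14)) ;;
        For 13 10 (If (entry mt (Var 16) (Var 13))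
          (If (Plus (Arr bl (Var 13)) (Arr rs (Var 13))) Skip (push rs (Var 13))) Skip))
       Skip)"

definition queue :: "nat \<Rightarrow> nat \<Rightarrow> store \<Rightarrow> bool" where
  "queue N rs s \<longleftrightarrow> inj_on (s 26) {..<s 15 0} \<and> s 26 ` {..<s 15 0} = arr_set N (s rs)"

lemma queue_upd: "x \<notin> {15, 26, rs} \<Longrightarrow> queue N rs (upd x i v s) = queue N rs s"
  by (simp add: queue_def upd_other)

lemma queue_card: "queue N rs s \<Longrightarrow> s 15 0 = card (arr_set N (s rs))"
  unfolding queue_def by (metis card_image card_lessThan)

lemma queue_le: "queue N rs s \<Longrightarrow> s 15 0 \<le> N"
  using card_mono[of "{..<N}" "arr_set N (s rs)"] queue_card by (fastforce simp: arr_set_def)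

text \<open>The cap in \<open>push\<close> is there for the syntactic word bound. As the queue lists
  distinct nodes below \<open>N\<close>, it never takes effect.\<close>

lemma queue_push:
  assumes q: "queue N rs s" and v: "s x 0 = v" "v < N" "s rs v = 0"
    and ids: "x \<notin> {15, 26, rs}" "rs \<notin> {8, 15, 26}" and cap: "N \<le> s 8 0"
  defines "s' \<equiv> upd rs v 1 (upd 15 0 (Suc (s 15 0)) (upd 26 (s 15 0) v s))"
  shows "sem inp (push rs (Var x)) s = s'" "queue N rs s'"
    "arr_set N (s' rs) = insert v (arr_set N (s rs))"
proof -
  have R: "arr_set N (s' rs) = insert v (arr_set N (s rs))" "v \<notin> arr_set N (s rs)"
    using v ids by (auto simp: s'_def upd_simps arr_set_def)
  then show "arr_set N (s' rs) = insert v (arr_set N (s rs))" by simp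
  have "card (insert v (arr_set N (s rs))) \<le> card {..<N}"
    using v by (intro card_mono) (auto simp: arr_set_def)
  moreover have "finite (arr_set N (s rs))" by (simp add: arr_set_def)
  ultimately have "s 15 0 < N" using R(2) queue_card[OF q] by simp
  then show "sem inp (push rs (Var x)) s = s'"
    using v ids cap by (simp add: push_def s'_def upd_simps)
  have e: "s' 26 = (s 26)(s 15 0 := v)" "s' 15 0 = Suc (s 15 0)"
    using ids by (auto simp: s'_def upd_simps)
  have "s' 26 ` {..<s' 15 0} = insert v (s 26 ` {..<s 15 0})"
    unfolding e by (auto simp: lessThan_Suc)
  moreover have "\<forall>i<s 15 0. s 26 i \<noteq> v" using q R(2) by (auto simp: queue_def)
  then have "inj_on (s' 26) {..<s' 15 0}"
    using q unfolding e queue_def by (auto simp: inj_on_def less_Suc_eq)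
  ultimately show "queue N rs s'" using q R(1) by (simp add: queue_def)
qed

definition layout :: "nat \<Rightarrow> store \<Rightarrow> bool" where
  "layout N s \<longleftrightarrow> s 10 0 = N \<and> N \<le> s 8 0 \<and> (\<forall>u<N. s 23 u = u * N)"

lemma layout_cong: "layout N m \<Longrightarrow> s 8 = m 8 \<Longrightarrow> s 10 = m 10 \<Longrightarrow> s 23 = m 23 \<Longrightarrow> layout N s"
  by (simp add: layout_def)

lemma sem_clear:
  assumes "m 10 0 = N" "x \<notin> {10, 12}"
  shows "arr_set N (sem inp (clear x) m x) = {}"
proof -
  have "\<forall>i<m 10 0. sem inp (clear x) m x i = 0"
    unfolding clear_def
    by (rule For_invariant[where J = "\<lambda>k s. \<forall>i<k. s x i = 0"])
      (use assms in \<open>auto simp: upd_simps less_Suc_eq\<close>)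
  then show ?thesis using assms by (simp add: arr_set_def)
qed

lemma sem_reach_seeds:
  fixes inp
  assumes q: "queue N rs m" "arr_set N (m rs) = {}" and m: "layout N m"
    and ids: "rs \<notin> {8, 10, 12, 15, 23, 26}" "sd \<notin> {12, 15, 26, rs}"
  defines "s \<equiv> sem inp (For 12 10 (If (Arr sd (Var 12)) (push rs (Var 12)) Skip)) m"
  shows "queue N rs s \<and> arr_set N (s rs) = arr_set N (m sd)"
proof -
  have "queue N rs s \<and> arr_set N (s rs) = arr_set (m 10 0) (m sd)"
    unfolding s_def
  proof (rule For_invariant[where J = "\<lambda>k s. queue N rs s \<and> arr_set N (s rs) = arr_set k (m sd)"])
    show "12 \<notin> writes (If (Arr sd (Var 12)) (push rs (Var 12)) Skip)"
      using ids by (simp add: push_def)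
  next
    show "queue N rs (upd 12 0 0 m) \<and> arr_set N (upd 12 0 0 m rs) = arr_set 0 (m sd)"
      using q ids by (simp add: queue_def upd_simps arr_set_def)
  next
    fix k s
    assume k: "k < m 10 0" "s 12 0 = k" and J: "queue N rs s \<and> arr_set N (s rs) = arr_set k (m sd)"
      and fr: "\<And>z. z \<notin> writes (For 12 10 (If (Arr sd (Var 12)) (push rs (Var 12)) Skip)) \<Longrightarrow> s z = m z"
    have w: "writes (For 12 10 (If (Arr sd (Var 12)) (push rs (Var 12)) Skip)) = {12, 26, 15, rs}"
      by (auto simp: push_def)
    have f: "s sd = m sd" "s 8 = m 8" using ids by (intro fr; auto simp: w)+
    have N: "m 10 0 = N" "N \<le> m 8 0" using m by (auto simp: layout_def)
    have "k \<notin> arr_set N (s rs)" using J by (simp add: arr_set_def)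
    then have z: "s rs k = 0" using k(1) N by (simp add: arr_set_def)
    show "queue N rs (upd 12 0 (Suc k) (sem inp (If (Arr sd (Var 12)) (push rs (Var 12)) Skip) s)) \<and>
      arr_set N (upd 12 0 (Suc k) (sem inp (If (Arr sd (Var 12)) (push rs (Var 12)) Skip) s) rs) =
      arr_set (Suc k) (m sd)"
    proof (cases "m sd k = 0")
      case True
      then have "arr_set (Suc k) (m sd) = arr_set k (m sd)" by (auto simp: arr_set_def less_Suc_eq)
      then show ?thesis using True J ids k(2) f by (simp add: queue_upd upd_other)
    next
      case False
      then have "arr_set (Suc k) (m sd) = insert k (arr_set k (m sd))"
        by (auto simp: arr_set_def less_Suc_eq)
      moreover let ?s = "upd rs k 1 (upd 15 0 (Suc (s 15 0)) (upd 26 (s 15 0) k s))"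
      have "sem inp (push rs (Var 12)) s = ?s" "queue N rs ?s"
        "arr_set N (?s rs) = insert k (arr_set N (s rs))"
        using queue_push[of N rs s 12 k] J k z ids N f by auto
      moreover have "sem inp (If (Arr sd (Var 12)) (push rs (Var 12)) Skip) s =
          sem inp (push rs (Var 12)) s"
        using False f k(2) by simp
      ultimately show ?thesis using J ids by (simp add: queue_upd upd_other del: sem.simps)
    qed
  qed
  then show ?thesis using m by (simp add: layout_def)
qed

text \<open>The upper bound \<open>C\<close> will be the whole reachable set. That old queue entries
  persist lets the outer loop identify expanded nodes by their queue positions.\<close>

lemma sem_reach_scan:
  fixes inp
  assumes q: "queue N rs m" and m: "layout N m" and u: "m 16 0 = u" "u < N"
    and R: "arr_set N (m rs) \<subseteq> C"
      "\<And>w. (u, w) \<in> mat N (m mt) \<Longrightarrow> w \<notin> arr_set N (m bl) \<Longrightarrow> w \<in> C"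
    and ids: "{mt, bl, rs} \<inter> {8, 10, 13, 15, 16, 23, 26} = {}" "rs \<notin> {mt, bl}"
  defines "c \<equiv> For 13 10 (If (entry mt (Var 16) (Var 13))
          (If (Plus (Arr bl (Var 13)) (Arr rs (Var 13))) Skip (push rs (Var 13))) Skip)"
  shows "queue N rs (sem inp c m) \<and> arr_set N (m rs) \<subseteq> arr_set N (sem inp c m rs) \<and>
    arr_set N (sem inp c m rs) \<subseteq> C \<and> m 15 0 \<le> sem inp c m 15 0 \<and>
    (\<forall>h<m 15 0. sem inp c m 26 h = m 26 h) \<and>
    (\<forall>w. (u, w) \<in> mat N (m mt) \<longrightarrow> w \<notin> arr_set N (m bl) \<longrightarrow> w \<in> arr_set N (sem inp c m rs))"
proof -
  let ?body = "If (entry mt (Var 16) (Var 13))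
          (If (Plus (Arr bl (Var 13)) (Arr rs (Var 13))) Skip (push rs (Var 13))) Skip"
  define J where "J k s \<longleftrightarrow> queue N rs s \<and> arr_set N (m rs) \<subseteq> arr_set N (s rs) \<and>
    arr_set N (s rs) \<subseteq> C \<and> m 15 0 \<le> s 15 0 \<and> (\<forall>h<m 15 0. s 26 h = m 26 h) \<and>
    (\<forall>w<k. (u, w) \<in> mat N (m mt) \<longrightarrow> w \<notin> arr_set N (m bl) \<longrightarrow> w \<in> arr_set N (s rs))" for k s
  have w: "writes ?body = {26, 15, rs}" by (auto simp: push_def)
  have N: "m 10 0 = N" "N \<le> m 8 0" "m 23 u = u * N" using m u by (auto simp: layout_def)
  have "J (m 10 0) (sem inp (For 13 10 ?body) m)"
  proof (rule For_invariant)
    show "13 \<notin> writes ?body" using ids by (simp add: w)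
    show "J 0 (upd 13 0 0 m)" using q R ids by (simp add: J_def queue_upd upd_other)
  next
    fix k s
    assume k: "k < m 10 0" "s 13 0 = k" and Jk: "J k s"
      and fr: "\<And>z. z \<notin> writes (For 13 10 ?body) \<Longrightarrow> s z = m z"
    have f: "s mt = m mt" "s bl = m bl" "s 8 = m 8" "s 16 = m 16" "s 23 = m 23"
      using ids by (intro fr; auto simp: w)+
    have kN: "k < N" using k N by simp
    have drop: "J (Suc k) (upd 13 0 (Suc k) s')"
      if "J k s'" "(u, k) \<in> mat N (m mt) \<Longrightarrow> k \<notin> arr_set N (m bl) \<Longrightarrow> k \<in> arr_set N (s' rs)" for s'
      using that ids unfolding J_def by (auto simp: queue_upd upd_other less_Suc_eq)
    show "J (Suc k) (upd 13 0 (Suc k) (sem inp ?body s))"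
    proof (cases "m mt (u * N + k) \<noteq> 0 \<and> m bl k = 0 \<and> s rs k = 0")
      case False
      then have "sem inp ?body s = s"
        using f k u N by (auto simp: entry_def)
      then show ?thesis
        using False Jk kN by (auto intro!: drop simp: mat_def arr_set_def)
    next
      case True
      let ?s = "upd rs k 1 (upd 15 0 (Suc (s 15 0)) (upd 26 (s 15 0) k s))"
      have p: "sem inp (push rs (Var 13)) s = ?s" "queue N rs ?s"
        "arr_set N (?s rs) = insert k (arr_set N (s rs))"
        using queue_push[of N rs s 13 k] Jk k(2) kN True ids N f by (auto simp: J_def)
      have "sem inp ?body s = ?s"
        using True f k(2) u N p(1) by (simp add: entry_def)
      moreover have "k \<in> C" using True kN u R(2)[of k] by (auto simp: mat_def arr_set_def)
      moreover have "J k ?s"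
        unfolding J_def p(3) using Jk p(2) \<open>k \<in> C\<close> ids by (auto simp: J_def upd_simps)
      ultimately show ?thesis using p(3) by (auto intro!: drop)
    qed
  qed
  then show ?thesis
    unfolding c_def J_def N(1) by (auto simp: mat_def)
qed

lemma sem_reach:
  assumes m: "layout N m"
    and ids: "{mt, sd, bl, rs} \<inter> {8, 10, 12, 13, 14, 15, 16, 23, 26} = {}" "rs \<notin> {mt, sd, bl}"
  shows "arr_set N (sem inp (reach_com mt sd bl rs) m rs) =
    reach (mat N (m mt)) (arr_set N (m bl)) (arr_set N (m sd))" (is "_ = ?R")
proof -
  let ?E = "mat N (m mt)" and ?B = "arr_set N (m bl)" and ?A = "arr_set N (m sd)"
  define m1 where "m1 = sem inp (clear rs ;; Set 15 (Num 0)) m"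
  define m2 where "m2 = sem inp (For 12 10 (If (Arr sd (Var 12)) (push rs (Var 12)) Skip)) m1"
  let ?scan = "For 13 10 (If (entry mt (Var 16) (Var 13))
          (If (Plus (Arr bl (Var 13)) (Arr rs (Var 13))) Skip (push rs (Var 13))) Skip)"
  let ?body = "If (Minus (Var 15) (Var 14)) (Set 16 (Arr 26 (Var 14)) ;; ?scan) Skip"
  have f1: "m1 z = m z" if "z \<notin> {12, 15, rs}" for z
    unfolding m1_def using that by (intro sem_frame) (auto simp: clear_def)
  have f2: "m2 z = m z" if "z \<notin> {12, 15, 26, rs}" for z
    using f1[of z] that
      sem_frame[of z "For 12 10 (If (Arr sd (Var 12)) (push rs (Var 12)) Skip)" inp m1]
    by (simp add: m2_def del: sem.simps)
  have l1: "layout N m1" and l2: "layout N m2"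
    using ids by (intro layout_cong[OF m] f1 f2; simp)+
  have N: "m 10 0 = N" using m by (simp add: layout_def)
  have e1: "arr_set N (m1 rs) = {}"
    using sem_clear[where m = m and N = N and x = rs and inp = inp] N ids by (simp add: m1_def upd_simps)
  have "m1 15 0 = 0" by (simp add: m1_def upd_simps)
  then have q1: "queue N rs m1" using e1 by (simp add: queue_def)
  have "queue N rs m2 \<and> arr_set N (m2 rs) = arr_set N (m1 sd)"
    unfolding m2_def by (rule sem_reach_seeds[OF q1 e1 l1]) (use ids in auto)
  moreover have "m1 sd = m sd" using ids by (intro f1) auto
  ultimately have q2: "queue N rs m2" "arr_set N (m2 rs) = ?A" by simp_all
  \<comment> \<open>The nodes at queue positions below \<open>h\<close> have been expanded. After
    \<open>N\<close> iterations these are all marked nodes, so the marked set is closed.\<close>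
  define J where "J h s \<longleftrightarrow> queue N rs s \<and> ?A \<subseteq> arr_set N (s rs) \<and> arr_set N (s rs) \<subseteq> ?R \<and>
    (\<forall>i<h. i < s 15 0 \<longrightarrow> (\<forall>w. (s 26 i, w) \<in> ?E \<longrightarrow> w \<notin> ?B \<longrightarrow> w \<in> arr_set N (s rs)))" for h s
  have w: "writes (For 14 10 ?body) = {14, 16, 13, 26, 15, rs}" by (auto simp: push_def)
  have "J (m2 10 0) (sem inp (For 14 10 ?body) m2)"
  proof (rule For_invariant)
    show "14 \<notin> writes ?body" using ids by (simp add: push_def)
    show "J 0 (upd 14 0 0 m2)"
      using q2 ids reach_refl[of ?A ?E ?B] by (simp add: J_def queue_upd upd_other)
  next
    fix h s
    assume h: "h < m2 10 0" "s 14 0 = h" and Jh: "J h s"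
      and fr: "\<And>z. z \<notin> writes (For 14 10 ?body) \<Longrightarrow> s z = m2 z"
    have f: "s z = m z" if "z \<notin> {12, 13, 14, 15, 16, 26, rs}" for z
      using fr[of z] f2[of z] that by (simp add: w)
    show "J (Suc h) (upd 14 0 (Suc h) (sem inp ?body s))"
    proof (cases "h < s 15 0")
      case False
      then have "sem inp ?body s = s" using h(2) by simp
      then show ?thesis using Jh False ids by (auto simp: J_def queue_upd upd_other less_Suc_eq)
    next
      case True
      let ?u = "s 26 h"
      let ?s1 = "upd 16 0 ?u s"
      let ?s2 = "sem inp ?scan ?s1"
      have body: "sem inp ?body s = ?s2" using True h(2) by (simp del: sem.simps(6))
      have Js: "queue N rs s" "?A \<subseteq> arr_set N (s rs)" "arr_set N (s rs) \<subseteq> ?R"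
        "\<And>i w. i < h \<Longrightarrow> i < s 15 0 \<Longrightarrow> (s 26 i, w) \<in> ?E \<Longrightarrow> w \<notin> ?B \<Longrightarrow> w \<in> arr_set N (s rs)"
        using Jh unfolding J_def by blast+
      have "?u \<in> s 26 ` {..<s 15 0}" using True by simp
      then have uR: "?u \<in> arr_set N (s rs)" using Js(1) unfolding queue_def by simp
      then have u: "?u < N" "?u \<in> ?R" using subsetD[OF Js(3)] by (simp_all add: arr_set_def)
      have f1: "?s1 mt = m mt" "?s1 bl = m bl" "?s1 rs = s rs" "?s1 15 = s 15" "?s1 26 = s 26"
        using ids f by (auto simp: upd_simps)
      have l: "layout N ?s1"
        using ids by (intro layout_cong[OF m]; simp add: upd_simps f)
      have q1: "queue N rs ?s1" using Js(1) ids by (simp add: queue_upd)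
      have "queue N rs ?s2 \<and> arr_set N (?s1 rs) \<subseteq> arr_set N (?s2 rs) \<and>
        arr_set N (?s2 rs) \<subseteq> ?R \<and> ?s1 15 0 \<le> ?s2 15 0 \<and> (\<forall>h<?s1 15 0. ?s2 26 h = ?s1 26 h) \<and>
        (\<forall>w. (?u, w) \<in> mat N (?s1 mt) \<longrightarrow> w \<notin> arr_set N (?s1 bl) \<longrightarrow> w \<in> arr_set N (?s2 rs))"
      proof (rule sem_reach_scan[OF q1 l])
        show "arr_set N (?s1 rs) \<subseteq> ?R" using Js(3) f1(3) by simp
        show "w \<in> ?R" if "(?u, w) \<in> mat N (?s1 mt)" "w \<notin> arr_set N (?s1 bl)" for w
          using that reach_step[OF u(2)] f1(1,2) by simp
      qed (use ids u(1) in \<open>auto simp: upd_simps\<close>)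
      then have r: "queue N rs ?s2" "arr_set N (s rs) \<subseteq> arr_set N (?s2 rs)"
        "arr_set N (?s2 rs) \<subseteq> ?R" "s 15 0 \<le> ?s2 15 0" "\<forall>h<s 15 0. ?s2 26 h = s 26 h"
        "\<forall>w. (?u, w) \<in> ?E \<longrightarrow> w \<notin> ?B \<longrightarrow> w \<in> arr_set N (?s2 rs)"
        unfolding f1 by blast+
      have "w \<in> arr_set N (?s2 rs)"
        if "i < Suc h" "(?s2 26 i, w) \<in> ?E" "w \<notin> ?B" for i w
      proof (cases "i = h")
        case False
        then have "i < h" "?s2 26 i = s 26 i" using that(1) True r(5) by auto
        then show ?thesis using Js(4)[of i w] subsetD[OF r(2)] that(2,3) True by simp
      qed (use r(5,6) True that in auto)
      then have "J (Suc h) ?s2"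
        unfolding J_def using r(1,3) subset_trans[OF Js(2) r(2)] by simp
      then show ?thesis unfolding body using ids by (simp add: J_def queue_upd upd_other)
    qed
  qed
  then have fin: "J N (sem inp (reach_com mt sd bl rs) m)"
    using f2[of 10] ids N by (simp add: reach_com_def m1_def m2_def)
  let ?s = "sem inp (reach_com mt sd bl rs) m"
  have "?R \<subseteq> arr_set N (?s rs)"
  proof (rule reach_least)
    show "?A \<subseteq> arr_set N (?s rs)" using fin by (simp add: J_def)
  next
    fix u w assume u: "u \<in> arr_set N (?s rs)" "(u, w) \<in> ?E" "w \<notin> ?B"
    have q: "queue N rs ?s" using fin by (simp add: J_def)
    then obtain i where "i < ?s 15 0" "u = ?s 26 i" using u(1) by (auto simp: queue_def)
    moreover have "i < N" using \<open>i < ?s 15 0\<close> queue_le[OF q] by simp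
    ultimately show "w \<in> arr_set N (?s rs)" using fin u unfolding J_def by blast
  qed
  moreover have "arr_set N (?s rs) \<subseteq> ?R" using fin unfolding J_def by blast
  ultimately show ?thesis by blast
qed

lemma arr_set_put: "v < N \<Longrightarrow> k \<noteq> 0 \<Longrightarrow> arr_set N (f(v := k)) = insert v (arr_set N f)"
  by (auto simp: arr_set_def)

lemma arr_set_less: "i \<in> arr_set N f \<Longrightarrow> i < N"
  by (simp add: arr_set_def)

section \<open>Neighbourhoods, least sides and one branching step\<close>

definition nb_com :: "nat \<Rightarrow> nat \<Rightarrow> nat \<Rightarrow> com" where
  "nb_com mt a t =
     clear t ;;
     For 12 10 (If (Arr a (Var 12))
       (For 13 10 (If (entry mt (Var 12) (Var 13))
         (If (Arr a (Var 13)) Skip (Put t (Var 13) (Num 1))) Skip))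
       Skip)"

lemma writes_clear [simp]: "writes (clear x) = {12, x}"
  by (simp add: clear_def)

lemma sem_nb_row:
  fixes inp
  assumes m: "layout N m" "m 12 0 = u" "u < N"
    and ids: "{mt, a, t} \<inter> {8, 10, 12, 13, 23} = {}" "t \<noteq> mt" "t \<noteq> a"
  defines "c \<equiv> For 13 10 (If (entry mt (Var 12) (Var 13))
         (If (Arr a (Var 13)) Skip (Put t (Var 13) (Num 1))) Skip)"
  shows "arr_set N (sem inp c m t) =
    arr_set N (m t) \<union> {w. (u, w) \<in> mat N (m mt) \<and> w \<notin> arr_set N (m a)}"
proof -
  let ?body = "If (entry mt (Var 12) (Var 13))
         (If (Arr a (Var 13)) Skip (Put t (Var 13) (Num 1))) Skip"
  let ?G = "\<lambda>k. {w. w < k \<and> (u, w) \<in> mat N (m mt) \<and> w \<notin> arr_set N (m a)}"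
  have N: "m 10 0 = N" "m 23 u = u * N" using m by (auto simp: layout_def)
  have "arr_set N (sem inp (For 13 10 ?body) m t) = arr_set N (m t) \<union> ?G (m 10 0)"
  proof (rule For_invariant[where J = "\<lambda>k s. arr_set N (s t) = arr_set N (m t) \<union> ?G k"])
    show "13 \<notin> writes ?body" using ids by auto
    show "arr_set N (upd 13 0 0 m t) = arr_set N (m t) \<union> ?G 0" using ids by (simp add: upd_other)
  next
    fix k s
    assume k: "k < m 10 0" "s 13 0 = k" and J: "arr_set N (s t) = arr_set N (m t) \<union> ?G k"
      and fr: "\<And>z. z \<notin> writes (For 13 10 ?body) \<Longrightarrow> s z = m z"
    have f: "s mt = m mt" "s a = m a" "s 12 = m 12" "s 23 = m 23"
      using ids by (intro fr; auto)+
    have kN: "k < N" using k N by simp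
    have e: "(u, k) \<in> mat N (m mt) \<longleftrightarrow> m mt (u * N + k) \<noteq> 0" "k \<in> arr_set N (m a) \<longleftrightarrow> m a k \<noteq> 0"
      using kN m(3) by (auto simp: mat_def arr_set_def)
    have t: "upd 13 0 (Suc k) s' t = s' t" for s' using ids by (intro upd_other) auto
    show "arr_set N (upd 13 0 (Suc k) (sem inp ?body s) t) = arr_set N (m t) \<union> ?G (Suc k)"
    proof (cases "(u, k) \<in> mat N (m mt) \<and> k \<notin> arr_set N (m a)")
      case True
      then have "sem inp ?body s = upd t k 1 s"
        using f k(2) m(2) N(2) e by (simp add: entry_def)
      moreover have "?G (Suc k) = insert k (?G k)" using True by (auto simp: less_Suc_eq)
      ultimately show ?thesis unfolding t using J kN by (simp add: upd_same arr_set_put)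
    next
      case False
      then have "sem inp ?body s = s"
        using f k(2) m(2) N(2) e by (auto simp: entry_def)
      moreover have "?G (Suc k) = ?G k" using False by (auto simp: less_Suc_eq)
      ultimately show ?thesis unfolding t using J by simp
    qed
  qed
  moreover have "?G (m 10 0) = {w. (u, w) \<in> mat N (m mt) \<and> w \<notin> arr_set N (m a)}"
    using N by (auto simp: mat_def)
  ultimately show ?thesis unfolding c_def by simp
qed

lemma sem_nb:
  assumes m: "layout N m"
    and ids: "{mt, a, t} \<inter> {8, 10, 12, 13, 23} = {}" "t \<noteq> mt" "t \<noteq> a"
  shows "arr_set N (sem inp (nb_com mt a t) m t) = nb (mat N (m mt)) (arr_set N (m a))"
proof -
  let ?row = "For 13 10 (If (entry mt (Var 12) (Var 13))
         (If (Arr a (Var 13)) Skip (Put t (Var 13) (Num 1))) Skip)"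
  let ?body = "If (Arr a (Var 12)) ?row Skip"
  let ?A = "arr_set N (m a)" and ?E = "mat N (m mt)"
  define m1 where "m1 = sem inp (clear t) m"
  have f1: "m1 z = m z" if "z \<notin> {12, t}" for z
    unfolding m1_def using that by (intro sem_frame) auto
  have N: "m 10 0 = N" "m1 10 0 = N" using m f1[of 10] ids by (auto simp: layout_def)
  have e: "arr_set N (m1 t) = {}"
    unfolding m1_def by (rule sem_clear[where m = m]) (use N ids in auto)
  let ?G = "\<lambda>k. {w. \<exists>u<k. u \<in> ?A \<and> (u, w) \<in> ?E \<and> w \<notin> ?A}"
  have "arr_set N (sem inp (For 12 10 ?body) m1 t) = ?G (m1 10 0)"
  proof (rule For_invariant[where J = "\<lambda>k s. arr_set N (s t) = ?G k"])
    show "12 \<notin> writes ?body" using ids by auto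
    show "arr_set N (upd 12 0 0 m1 t) = ?G 0" using ids e by (simp add: upd_other)
  next
    fix k s
    assume k: "k < m1 10 0" "s 12 0 = k" and J: "arr_set N (s t) = ?G k"
      and fr: "\<And>z. z \<notin> writes (For 12 10 ?body) \<Longrightarrow> s z = m1 z"
    have f: "s z = m z" if "z \<notin> {12, 13, t}" for z using fr[of z] f1[of z] that by simp
    have kN: "k < N" using k N by simp
    have e: "k \<in> ?A \<longleftrightarrow> m a k \<noteq> 0" using kN by (simp add: arr_set_def)
    have t: "upd 12 0 (Suc k) s' t = s' t" for s' using ids by (intro upd_other) auto
    have sa: "s a = m a" "s mt = m mt" using ids by (intro f; auto)+
    show "arr_set N (upd 12 0 (Suc k) (sem inp ?body s) t) = ?G (Suc k)"
    proof (cases "k \<in> ?A")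
      case True
      then have "sem inp ?body s = sem inp ?row s"
        using k(2) sa e by (simp del: sem.simps(6))
      moreover have "arr_set N (sem inp ?row s t) =
          arr_set N (s t) \<union> {w. (k, w) \<in> mat N (s mt) \<and> w \<notin> arr_set N (s a)}"
      proof (rule sem_nb_row)
        show "layout N s" using ids by (intro layout_cong[OF m] f; auto)+
      qed (use k(2) kN ids in auto)
      moreover have "?G (Suc k) = ?G k \<union> {w. (k, w) \<in> ?E \<and> w \<notin> ?A}"
        using True by (auto simp: less_Suc_eq)
      ultimately show ?thesis unfolding t using J sa by simp
    next
      case False
      then have "sem inp ?body s = s" using k(2) sa e by simp
      moreover have "?G (Suc k) = ?G k" using False by (auto simp: less_Suc_eq)
      ultimately show ?thesis unfolding t using J by simp
    qed
  qed
  moreover have "?G (m1 10 0) = nb ?E ?A"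
    using N by (auto simp: nb_def Image_iff dest: arr_set_less)
  ultimately show ?thesis by (simp add: nb_com_def m1_def del: sem.simps(6))
qed

definition copy_com :: "nat \<Rightarrow> nat \<Rightarrow> com" where
  "copy_com a b = For 12 10 (Put b (Var 12) (Arr a (Var 12)))"

lemma sem_copy:
  assumes "m 10 0 = N" "{a, b} \<inter> {10, 12} = {}" "a \<noteq> b"
  shows "arr_set N (sem inp (copy_com a b) m b) = arr_set N (m a)"
proof -
  have "\<forall>i<m 10 0. sem inp (copy_com a b) m b i = m a i"
    unfolding copy_com_def
  proof (rule For_invariant[where J = "\<lambda>k s. \<forall>i<k. s b i = m a i"])
    fix k s
    assume J: "\<forall>i<k. s b i = m a i" "s 12 0 = k"
      and "\<And>z. z \<notin> writes (For 12 10 (Put b (Var 12) (Arr a (Var 12)))) \<Longrightarrow> s z = m z"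
    then have "s a = m a" using assms by auto
    then show "\<forall>i<Suc k. upd 12 0 (Suc k) (sem inp (Put b (Var 12) (Arr a (Var 12))) s) b i = m a i"
      using J assms(2) by (auto simp: upd_simps less_Suc_eq)
  qed (use assms(2) in auto)
  then show ?thesis using assms(1) by (auto simp: arr_set_def)
qed

definition check_com :: com where
  "check_com =
     Set 19 (Num 1) ;;
     For 12 10
       (If (Arr 40 (Var 12)) (If (Arr 28 (Var 12)) (Set 19 (Num 0)) Skip) Skip ;;
        If (Arr 44 (Var 12)) (If (Arr 38 (Var 12)) (Set 19 (Num 0)) Skip) Skip)"

lemma sem_check:
  assumes "m 10 0 = N"
  shows "sem inp check_com m 19 0 \<noteq> 0 \<longleftrightarrow>
    arr_set N (m 40) \<inter> arr_set N (m 28) = {} \<and> arr_set N (m 44) \<inter> arr_set N (m 38) = {}"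
proof -
  let ?body = "If (Arr 40 (Var 12)) (If (Arr 28 (Var 12)) (Set 19 (Num 0)) Skip) Skip ;;
        If (Arr 44 (Var 12)) (If (Arr 38 (Var 12)) (Set 19 (Num 0)) Skip) Skip"
  define m1 where "m1 = upd 19 0 1 m"
  have m1: "m1 z = m z" if "z \<noteq> 19" for z using that by (simp add: m1_def upd_other)
  let ?Q = "\<lambda>i. \<not> (m 40 i \<noteq> 0 \<and> m 28 i \<noteq> 0) \<and> \<not> (m 44 i \<noteq> 0 \<and> m 38 i \<noteq> 0)"
  have "sem inp (For 12 10 ?body) m1 19 0 \<noteq> 0 \<longleftrightarrow> (\<forall>i<m1 10 0. ?Q i)"
  proof (rule For_invariant[where J = "\<lambda>k s. s 19 0 \<noteq> 0 \<longleftrightarrow> (\<forall>i<k. ?Q i)"])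
    fix k s
    assume J: "s 19 0 \<noteq> 0 \<longleftrightarrow> (\<forall>i<k. ?Q i)" "s 12 0 = k"
      and fr: "\<And>z. z \<notin> writes (For 12 10 ?body) \<Longrightarrow> s z = m1 z"
    have "s 40 = m 40" "s 28 = m 28" "s 44 = m 44" "s 38 = m 38"
      using fr m1 by simp_all
    then show "upd 12 0 (Suc k) (sem inp ?body s) 19 0 \<noteq> 0 \<longleftrightarrow> (\<forall>i<Suc k. ?Q i)"
      using J by (auto simp: upd_simps less_Suc_eq)
  qed (auto simp: m1_def upd_simps)
  then have "sem inp check_com m 19 0 \<noteq> 0 \<longleftrightarrow> (\<forall>i<N. ?Q i)"
    using assms m1[of 10] by (simp add: check_com_def m1_def del: sem.simps(6))
  then show ?thesis by (auto simp: arr_set_def)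
qed

text \<open>Arrays 40 to 44 receive \<open>grow\<close>, its neighbourhood, \<open>far\<close>, the
  neighbourhood of that, and \<open>star\<close>, all for the set in array 39.\<close>

definition closure_com :: com where
  "closure_com =
     reach_com 25 39 29 40 ;; nb_com 25 40 41 ;; reach_com 25 28 41 42 ;; nb_com 25 42 43 ;;
     reach_com 25 27 43 44 ;; check_com"

lemma writes_reach [simp]: "writes (reach_com mt sd bl rs) = {12, 13, 14, 15, 16, 26, rs}"
  by (auto simp: reach_com_def)

lemma writes_nb [simp]: "writes (nb_com mt a t) = {12, 13, t}"
  by (auto simp: nb_com_def)

lemma writes_copy [simp]: "writes (copy_com a b) = {12, b}"
  by (simp add: copy_com_def)

lemma writes_check [simp]: "writes check_com = {12, 19}"
  by (auto simp: check_com_def)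

lemma writes_closure [simp]:
  "writes closure_com = {12, 13, 14, 15, 16, 19, 26, 40, 41, 42, 43, 44}"
  by (auto simp: closure_com_def)

context nat_separation
begin

definition loaded :: "nat \<Rightarrow> store \<Rightarrow> bool" where
  "loaded N s \<longleftrightarrow> layout N s \<and> mat N (s 25) = E \<and> arr_set N (s 27) = X \<and>
     arr_set N (s 28) = Y \<and> arr_set N (s 29) = D"

lemma loaded_cong:
  "loaded N m \<Longrightarrow> (\<And>z. z \<in> {8, 10, 23, 25, 27, 28, 29} \<Longrightarrow> s z = m z) \<Longrightarrow> loaded N s"
  by (simp add: loaded_def layout_def)

lemma loaded_sem:
  "loaded N m \<Longrightarrow> {8, 10, 23, 25, 27, 28, 29} \<inter> writes c = {} \<Longrightarrow> loaded N (sem inp c m)"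
  by (erule loaded_cong) (auto intro!: sem_frame)

text \<open>\<open>star\<close> is computed whether or not it is a side; the flag in variable 19
  tells whether it may be used.\<close>

lemma sem_closure:
  fixes inp
  assumes m: "loaded N m"
  defines "s \<equiv> sem inp closure_com m"
  shows "arr_set N (s 44) = star (arr_set N (m 39))"
    and "s 19 0 \<noteq> 0 \<longleftrightarrow> grow (arr_set N (m 39)) \<inter> Y = {} \<and>
      star (arr_set N (m 39)) \<inter> arr_set N (m 38) = {}"
proof -
  let ?B = "arr_set N (m 39)"
  define m1 where "m1 = sem inp (reach_com 25 39 29 40) m"
  define m2 where "m2 = sem inp (nb_com 25 40 41) m1"
  define m3 where "m3 = sem inp (reach_com 25 28 41 42) m2"
  define m4 where "m4 = sem inp (nb_com 25 42 43) m3"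
  define m5 where "m5 = sem inp (reach_com 25 27 43 44) m4"
  have s: "s = sem inp check_com m5"
    by (simp add: s_def closure_com_def m1_def m2_def m3_def m4_def m5_def)
  have l: "loaded N m1" "loaded N m2" "loaded N m3" "loaded N m4" "loaded N m5"
    unfolding m5_def m4_def m3_def m2_def m1_def using m by (intro loaded_sem; simp)+
  note L = l[unfolded loaded_def] m[unfolded loaded_def]
  have 1: "arr_set N (m1 40) = grow ?B"
    unfolding m1_def grow_def using L by (subst sem_reach) auto
  have 2: "arr_set N (m2 41) = nb E (grow ?B)"
    unfolding m2_def using L 1 by (subst sem_nb) auto
  have 3: "arr_set N (m3 42) = far ?B"
    unfolding m3_def far_def using L 2 by (subst sem_reach) auto
  have 4: "arr_set N (m4 43) = nb E (far ?B)"
    unfolding m4_def using L 3 by (subst sem_nb) auto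
  have 5: "arr_set N (m5 44) = star ?B"
    unfolding m5_def star_def using L 4 by (subst sem_reach) auto
  have "m5 40 = m1 40" "m5 38 = m 38"
    by (simp_all add: m1_def m2_def m3_def m4_def m5_def sem_frame)
  moreover have "s 44 = m5 44" unfolding s by (simp add: sem_frame)
  ultimately show "arr_set N (s 44) = star ?B"
    and "s 19 0 \<noteq> 0 \<longleftrightarrow> grow ?B \<inter> Y = {} \<and> star ?B \<inter> arr_set N (m 38) = {}"
    using 5 1 sem_check[of m5 N inp] L unfolding s by (simp_all add: layout_def)
qed

end

text \<open>Variable 18 also blocks the scan after the first hit, so the least candidate is
  kept.\<close>

definition pick_com :: com where
  "pick_com =
     Set 18 (Num 0) ;;
     For 12 10 (If (Var 18) Skip (If (Arr 46 (Var 12)) (If (Arr 38 (Var 12)) Skip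
       (Set 17 (Var 12) ;; Set 18 (Num 1))) Skip))"

lemma sem_pick:
  assumes "m 10 0 = N"
  defines "C \<equiv> arr_set N (m 46) - arr_set N (m 38)"
  shows "sem inp pick_com m 18 0 \<noteq> 0 \<longleftrightarrow> C \<noteq> {}"
    and "C \<noteq> {} \<Longrightarrow> sem inp pick_com m 17 0 = (LEAST v. v \<in> C)"
proof -
  let ?body = "If (Var 18) Skip (If (Arr 46 (Var 12)) (If (Arr 38 (Var 12)) Skip
       (Set 17 (Var 12) ;; Set 18 (Num 1))) Skip)"
  define m1 where "m1 = upd 18 0 0 m"
  have N: "m1 10 0 = N" using assms(1) by (simp add: m1_def upd_other)
  define J where "J k s \<longleftrightarrow> (s 18 0 = 0 \<and> (\<forall>i<k. i \<notin> C)) \<or>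
    (s 18 0 \<noteq> 0 \<and> s 17 0 \<in> C \<and> (\<forall>i<s 17 0. i \<notin> C))" for k :: nat and s :: store
  have J: "J (m1 10 0) (sem inp (For 12 10 ?body) m1)"
  proof (rule For_invariant)
    show "J 0 (upd 12 0 0 m1)" by (simp add: J_def m1_def upd_simps)
  next
    fix k s
    assume k: "k < m1 10 0" "s 12 0 = k" and Jk: "J k s"
      and fr: "\<And>z. z \<notin> writes (For 12 10 ?body) \<Longrightarrow> s z = m1 z"
    have f: "s 46 = m 46" "s 38 = m 38" using fr by (simp_all add: m1_def upd_other)
    have e: "k \<in> C \<longleftrightarrow> m 46 k \<noteq> 0 \<and> m 38 k = 0" using k(1) N by (auto simp: C_def arr_set_def)
    show "J (Suc k) (upd 12 0 (Suc k) (sem inp ?body s))"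
      using Jk k(2) f e by (auto simp: J_def upd_simps less_Suc_eq)
  qed simp
  let ?s = "sem inp pick_com m"
  have "J N ?s" using J N by (simp add: pick_com_def m1_def del: sem.simps(6))
  moreover have "C \<subseteq> {..<N}" by (auto simp: C_def arr_set_def)
  ultimately show "?s 18 0 \<noteq> 0 \<longleftrightarrow> C \<noteq> {}" by (auto simp: J_def)
  show "?s 17 0 = (LEAST v. v \<in> C)" if "C \<noteq> {}"
  proof -
    have "?s 17 0 \<in> C" "\<forall>i<?s 17 0. i \<notin> C"
      using \<open>J N ?s\<close> that \<open>C \<subseteq> {..<N}\<close> by (auto simp: J_def)
    then show ?thesis by (metis (mono_tags, lifting) LeastI Least_le le_neq_implies_less)
  qed
qed

text \<open>Variable 20 minus variable 48 is what remains of the position argument of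
  \<open>descend\<close> at this depth: 0 means left if feasible, 1 means right, and more means
  repeating the stored turn.\<close>

definition turn_com :: com where
  "turn_com =
     Set 21 (Num 0) ;;
     If (Var 19)
       (If (Minus (Var 20) (Var 48))
         (If (Minus (Minus (Var 20) (Var 48)) (Num 1)) (Set 21 (Arr 45 (Var 48))) Skip)
         (Set 21 (Num 1)))
       Skip"

definition move_com :: com where
  "move_com = If (Var 21) (copy_com 44 37) (Put 38 (Var 17) (Num 1))"

text \<open>Array 45 serves two words at once: when a step begins, the entries from the current
  depth on still belong to the previous leaf, those before it to the new one.\<close>

definition step_com :: com where
  "step_com =
     nb_com 25 37 46 ;;
     pick_com ;;
     If (Var 18)
       (copy_com 37 39 ;; Put 39 (Var 17) (Num 1) ;; closure_com ;; turn_com ;; move_com)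
       (Set 21 (Num 0)) ;;
     Put 45 (Var 48) (Var 21)"

lemma writes_pick [simp]: "writes pick_com = {12, 17, 18}"
  by (auto simp: pick_com_def)

lemma writes_turn [simp]: "writes turn_com = {21}"
  by (auto simp: turn_com_def)

lemma writes_move [simp]: "writes move_com = {12, 37, 38}"
  by (auto simp: move_com_def)

lemma writes_step [simp]:
  "writes step_com = {12, 13, 14, 15, 16, 17, 18, 19, 21, 26, 37, 38, 39, 40, 41, 42, 43, 44, 45, 46}"
  by (auto simp: step_com_def)

lemma sem_turn:
  "sem inp turn_com m 21 0 \<noteq> 0 \<longleftrightarrow>
    m 19 0 \<noteq> 0 \<and> (m 20 0 - m 48 0 = 0 \<or> 1 < m 20 0 - m 48 0 \<and> m 45 (m 48 0) \<noteq> 0)"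
  by (auto simp: turn_com_def upd_simps)

context nat_separation
begin

definition state :: "nat \<Rightarrow> store \<Rightarrow> nat set \<times> nat set" where
  "state N m = (arr_set N (m 37), arr_set N (m 38))"

lemma sem_step:
  fixes inp
  assumes m: "loaded N m"
  defines "s \<equiv> sem inp step_com m" and "p \<equiv> m 20 0 - m 48 0"
  defines "b \<equiv> feas (state N m) \<and> (p = 0 \<or> 1 < p \<and> m 45 (m 48 0) \<noteq> 0)"
  shows "state N s = (if b then incl (state N m) else excl (state N m))"
    and "(s 45 (m 48 0) \<noteq> 0) = b" "i \<noteq> m 48 0 \<Longrightarrow> s 45 i = m 45 i"
proof -
  let ?t = "state N m"
  define m1 where "m1 = sem inp (nb_com 25 37 46) m"
  define m2 where "m2 = sem inp pick_com m1"
  define m3 where "m3 = sem inp (copy_com 37 39) m2"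
  define m4 where "m4 = sem inp (Put 39 (Var 17) (Num 1)) m3"
  define m5 where "m5 = sem inp closure_com m4"
  define m6 where "m6 = sem inp turn_com m5"
  define m7 where "m7 = sem inp move_com m6"
  define r where "r = (if m2 18 0 \<noteq> 0 then m7 else upd 21 0 0 m2)"
  have s: "s = upd 45 (r 48 0) (r 21 0) r"
    by (simp add: s_def step_com_def m1_def m2_def m3_def m4_def m5_def m6_def m7_def r_def)
  have l: "loaded N m1" "loaded N m2" "loaded N m3" "loaded N m4"
    unfolding m4_def m3_def m2_def m1_def using m by (intro loaded_sem; simp)+
  have N: "m 10 0 = N" "m1 10 0 = N" "m2 10 0 = N" "m3 10 0 = N" "m4 10 0 = N"
    using m l by (simp_all add: loaded_def layout_def)
  have E1: "mat N (m 25) = E" using m by (simp add: loaded_def)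
  have f1: "m1 z = m z" if "z \<notin> {12, 13, 46}" for z
    unfolding m1_def using that by (intro sem_frame) auto
  have f2: "m2 z = m z" if "z \<notin> {12, 13, 46, 17, 18}" for z
    using f1[of z] that sem_frame[of z pick_com inp m1] by (simp add: m2_def)
  have lay: "layout N m" using m by (simp add: loaded_def)
  have n1: "arr_set N (m1 46) = nb E (fst ?t)"
    unfolding m1_def using sem_nb[OF lay, of 25 37 46 inp] E1 by (simp add: state_def)
  have C: "arr_set N (m1 46) - arr_set N (m1 38) = nb E (fst ?t) - snd ?t"
    using n1 f1[of 38] by (simp add: state_def)
  have br: "m2 18 0 \<noteq> 0 \<longleftrightarrow> branching ?t"
    unfolding m2_def sem_pick(1)[where m = m1 and N = N, OF N(2)] C branching_def ..
  have r48: "r 48 = m 48" and r45: "r 45 = m 45"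
    using f2[of 48] f2[of 45]
    by (simp_all add: r_def m7_def m6_def m5_def m4_def m3_def sem_frame upd_other)
  have main: "state N r = (if b then incl ?t else excl ?t) \<and> ((r 21 0 \<noteq> 0) = b)"
  proof (cases "branching ?t")
    case False
    then have "r = upd 21 0 0 m2" "\<not> b" using br by (simp_all add: r_def b_def feas_def)
    then show ?thesis
      using False f2[of 37] f2[of 38] by (simp add: state_def excl_def upd_simps)
  next
    case True
    have v: "m2 17 0 = pick ?t"
      unfolding m2_def using sem_pick(2)[where m = m1 and N = N and inp = inp, OF N(2)] True
      unfolding C branching_def pick_def by simp
    have vN: "pick ?t < N" using pick[OF True] n1 arr_set_less by blast
    have r: "r = m7" using True br by (simp add: r_def)
    have f3: "m3 z = m2 z" if "z \<notin> {12, 39}" for z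
      unfolding m3_def using that by (intro sem_frame) auto
    have f4: "m4 z = m3 z" if "z \<noteq> 39" for z
      unfolding m4_def using that by (intro sem_frame) auto
    have f5: "m5 z = m4 z" if "z \<notin> {12, 13, 14, 15, 16, 19, 26, 40, 41, 42, 43, 44}" for z
      unfolding m5_def using that by (intro sem_frame) auto
    have f6: "m6 z = m5 z" if "z \<noteq> 21" for z
      unfolding m6_def using that by (intro sem_frame) auto
    have "arr_set N (m3 39) = fst ?t"
      unfolding m3_def using sem_copy[where m = m2 and N = N and a = 37 and b = 39 and inp = inp] N(3) f2[of 37] by (simp add: state_def)
    then have B: "arr_set N (m4 39) = insert (pick ?t) (fst ?t)"
      using v vN f3[of 17] by (simp add: m4_def upd_simps arr_set_put)
    have U: "arr_set N (m4 38) = snd ?t"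
      using f2[of 38] f3[of 38] f4[of 38] by (simp add: state_def)
    have c: "arr_set N (m5 44) = star (insert (pick ?t) (fst ?t))"
      "m5 19 0 \<noteq> 0 \<longleftrightarrow> feas ?t"
      using sem_closure[OF l(4), of inp] B U True by (simp_all add: m5_def feas_def)
    have same: "m5 20 = m 20" "m5 48 = m 48" "m5 45 = m 45" "m5 37 = m 37" "m5 38 = m 38"
      "m6 37 = m 37" "m6 38 = m 38" "m6 44 = m5 44" "m6 17 = m2 17" "m6 10 = m 10"
      using f2 f3 f4 f5 f6 by simp_all
    have bt: "(m6 21 0 \<noteq> 0) = b"
      unfolding m6_def sem_turn c(2) same b_def p_def ..
    have "m7 21 = m6 21" unfolding m7_def by (simp add: sem_frame)
    moreover have "state N m7 = (if b then incl ?t else excl ?t)"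
    proof (cases b)
      case True
      then have m7: "m7 = sem inp (copy_com 44 37) m6" using bt by (simp add: m7_def move_com_def)
      have "arr_set N (m7 37) = star (insert (pick ?t) (fst ?t))"
        unfolding m7 using sem_copy[where m = m6 and N = N and a = 44 and b = 37 and inp = inp] same N(1) c(1) by simp
      moreover have "m7 38 = m 38" unfolding m7 using same by (simp add: sem_frame)
      ultimately show ?thesis using True by (simp add: state_def incl_def)
    next
      case False
      then have m7: "m7 = upd 38 (pick ?t) 1 m6"
        using bt same v by (simp add: m7_def move_com_def)
      show ?thesis
        using False \<open>branching ?t\<close> vN same
        by (simp add: m7 state_def excl_def upd_simps arr_set_put)
    qed
    ultimately show ?thesis unfolding r using bt by simp
  qed
  have st: "state N s = state N r" by (simp add: s state_def upd_other)
  show "state N s = (if b then incl ?t else excl ?t)" using main st by simp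
  show "(s 45 (m 48 0) \<noteq> 0) = b" using main r48 by (simp add: s upd_same)
  show "i \<noteq> m 48 0 \<Longrightarrow> s 45 i = m 45 i" using r48 r45 by (simp add: s upd_same)
qed

end

primrec silent :: "com \<Rightarrow> bool" where
  "silent Skip \<longleftrightarrow> True"
| "silent (Put x i e) \<longleftrightarrow> True"
| "silent (Out e) \<longleftrightarrow> False"
| "silent (c1 ;; c2) \<longleftrightarrow> silent c1 \<and> silent c2"
| "silent (If e c1 c2) \<longleftrightarrow> silent c1 \<and> silent c2"
| "silent (For x y c) \<longleftrightarrow> silent c"

lemma outp_silent: "silent c \<Longrightarrow> outp inp c m = []"
  by (induction c arbitrary: m) auto

section \<open>One round: descent, output and next turning point\<close>

definition emit_com :: com where
  "emit_com = For 12 9 (If (Plus (Arr 30 (Var 12)) (Arr 46 (Var 12))) (Out (Var 12)) Skip)"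

lemma outp_emit: "set (outp inp emit_com m) = arr_set (m 9 0) (m 30) \<union> arr_set (m 9 0) (m 46)"
proof -
  let ?c = "If (Plus (Arr 30 (Var 12)) (Arr 46 (Var 12))) (Out (Var 12)) Skip"
  define s where "s k = (loop_step 12 (sem inp ?c) ^^ k) (upd 12 0 0 m)" for k
  have s: "s k 12 0 = k" "s k 30 = m 30" "s k 46 = m 46" for k
    using loop_counter[of 12 ?c, where inp = inp and k = k and m = m] by (simp_all add: s_def)
  have o: "outp inp ?c (s k) = (if m 30 k \<noteq> 0 \<or> m 46 k \<noteq> 0 then [k] else [])" for k
    by (simp add: s)
  have "outp inp emit_com m = concat (map (\<lambda>k. outp inp ?c (s k)) [0..<m 9 0])"
    unfolding emit_com_def outp.simps(6) s_def ..
  then show ?thesis unfolding o by (auto simp: arr_set_def split: if_splits)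
qed

definition last_com :: com where
  "last_com = Set 20 (Num 0) ;;
     For 12 9 (If (Arr 45 (Var 12)) (Set 20 (Capped (Plus (Var 12) (Num 1)))) Skip)"

definition word :: "nat \<Rightarrow> store \<Rightarrow> bool list" where
  "word n m = map (\<lambda>i. m 45 i \<noteq> 0) [0..<n]"

context binary_tree
begin

text \<open>Adapts \<open>last_left\<close> to a scan from the front in which later left turns
  overwrite earlier ones.\<close>

lemma last_left_snoc: "last_left (w @ [b]) = (if b then Suc (length w) else last_left w)"
  by (induction w) auto

end

context nat_separation
begin

lemma sem_last:
  assumes "m 9 0 = n" "n \<le> m 8 0"
  shows "sem inp last_com m 20 0 = last_left (word n m)"
proof -
  let ?body = "If (Arr 45 (Var 12)) (Set 20 (Capped (Plus (Var 12) (Num 1)))) Skip"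
  define m1 where "m1 = upd 20 0 0 m"
  have n: "m1 9 0 = n" using assms by (simp add: m1_def upd_other)
  have "sem inp (For 12 9 ?body) m1 20 0 = last_left (word (m1 9 0) m)"
  proof (rule For_invariant[where J = "\<lambda>k s. s 20 0 = last_left (word k m)"])
    fix k s
    assume k: "k < m1 9 0" "s 12 0 = k" and J: "s 20 0 = last_left (word k m)"
      and fr: "\<And>z. z \<notin> writes (For 12 9 ?body) \<Longrightarrow> s z = m1 z"
    have "s 45 = m 45" "s 8 = m 8" using fr by (simp_all add: m1_def upd_other)
    then show "upd 12 0 (Suc k) (sem inp ?body s) 20 0 = last_left (word (Suc k) m)"
      using k J n assms(2) by (simp add: word_def last_left_snoc upd_simps)
  qed (simp_all add: m1_def upd_simps word_def)
  then show ?thesis using n by (simp add: last_com_def m1_def del: sem.simps(6))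
qed

lemma sem_steps:
  fixes inp
  assumes m: "loaded N m" and n: "m 9 0 = n"
  defines "s \<equiv> sem inp (For 48 9 step_com) m"
  shows "loaded N s" "(state N s, word n s) = descend (m 20 0) n (word n m) (state N m)"
proof -
  define p w0 where "p = m 20 0" and "w0 = word n m"
  have w0: "length w0 = n" "\<And>i. i < n \<Longrightarrow> w0 ! i = (m 45 i \<noteq> 0)" by (simp_all add: w0_def word_def)
  \<comment> \<open>The whole descent equals the \<open>k\<close> turns already written, followed by
    the descent from the current state along the rest of the old word, which is intact from
    \<open>k\<close> on. The truncated \<open>p - k\<close> mirrors the repeated
    \<open>p - 1\<close> of \<open>descend\<close>.\<close>
  define J where "J k s \<longleftrightarrow> loaded N s \<and> (\<forall>i\<ge>k. s 45 i = m 45 i) \<and>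
    descend p n w0 (state N m) =
      (fst (descend (p - k) (n - k) (drop k w0) (state N s)),
       word k s @ snd (descend (p - k) (n - k) (drop k w0) (state N s)))" for k s
  have other: "J k (upd 48 0 v s) = J k s" for k v s
  proof -
    have "loaded N (upd 48 0 v s) = loaded N s"
      by (simp add: loaded_def layout_def upd_other)
    then show ?thesis by (simp add: J_def state_def word_def upd_other)
  qed
  have "J (m 9 0) s"
    unfolding s_def
  proof (rule For_invariant)
    show "J 0 (upd 48 0 0 m)" unfolding other using m by (simp add: J_def word_def)
  next
    fix k s
    assume k: "k < m 9 0" "s 48 0 = k" and Jk: "J k s"
      and fr: "\<And>z. z \<notin> writes (For 48 9 step_com) \<Longrightarrow> s z = m z"
    let ?s = "sem inp step_com s" and ?t = "state N s"
    have ls: "loaded N s" and same: "\<And>i. k \<le> i \<Longrightarrow> s 45 i = m 45 i" using Jk by (auto simp: J_def)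
    have p: "s 20 0 = p" using fr by (simp add: p_def)
    have kn: "k < n" using k n by simp
    have hd: "hd (drop k w0) = (m 45 k \<noteq> 0)" using w0 kn by (simp add: hd_drop_conv_nth)
    define b where "b \<longleftrightarrow> feas ?t \<and> (p - k = 0 \<or> 1 < p - k \<and> hd (drop k w0))"
    have st: "state N ?s = (if b then incl ?t else excl ?t)" "(?s 45 k \<noteq> 0) = b"
      "\<And>i. i \<noteq> k \<Longrightarrow> ?s 45 i = s 45 i"
      using sem_step[OF ls, where inp = inp] k(2) same[of k] unfolding p hd b_def by auto
    have "word k ?s = word k s" using st(3) by (simp add: word_def)
    then have wd: "word (Suc k) ?s = word k s @ [b]" using st(2) by (simp add: word_def)
    have "n - k = Suc (n - Suc k)" using kn by simp
    then have "descend (p - k) (n - k) (drop k w0) ?t =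
        (fst (descend (p - Suc k) (n - Suc k) (drop (Suc k) w0) (state N ?s)),
         b # snd (descend (p - Suc k) (n - Suc k) (drop (Suc k) w0) (state N ?s)))"
      unfolding st(1) b_def
      by (simp add: Let_def case_prod_beta drop_Suc tl_drop)
    then have "J (Suc k) ?s"
      using Jk wd st(3) same loaded_sem[OF ls, where c = step_com and inp = inp] by (simp add: J_def)
    then show "J (Suc k) (upd 48 0 (Suc k) ?s)" unfolding other .
  qed simp
  then show "loaded N s" "(state N s, word n s) = descend (m 20 0) n (word n m) (state N m)"
    using n by (simp_all add: J_def p_def w0_def)
qed

end

text \<open>Each round starts again at the root, whose set is kept in array 47. Variable 11 becomes
  zero when the word just found has no left turn to flip.\<close>

definition round_com :: com where
  "round_com =
     copy_com 47 37 ;; clear 38 ;; For 48 9 step_com ;; nb_com 25 37 46 ;;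
     emit_com ;; last_com ;; Set 11 (Var 20)"

context nat_separation
begin

definition ready :: "nat \<Rightarrow> nat \<Rightarrow> nat set \<Rightarrow> nat set \<Rightarrow> store \<Rightarrow> bool" where
  "ready n N A I m \<longleftrightarrow> loaded N m \<and> m 9 0 = n \<and> n \<le> N \<and> arr_set n (m 30) = I \<and> arr_set N (m 47) = A"

text \<open>The output loop visits only the \<open>n\<close> original nodes, hence
  \<open>{..<n}\<close>. For a side nothing is lost, as its neighbourhood lies in
  \<open>D\<close>.\<close>

lemma sem_round:
  fixes inp
  assumes m: "ready n N A I m"
  defines "s \<equiv> sem inp round_com m" and "d \<equiv> descend (m 20 0) n (word n m) (A, {})"
  shows "ready n N A I s" "word n s = snd d" "s 20 0 = last_left (snd d)"
    "s 11 0 = last_left (snd d)"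
    "set (outp inp round_com m) = I \<union> (nb E (fst (fst d)) \<inter> {..<n})"
proof -
  define m1 where "m1 = sem inp (copy_com 47 37) m"
  define m2 where "m2 = sem inp (clear 38) m1"
  define m3 where "m3 = sem inp (For 48 9 step_com) m2"
  define m4 where "m4 = sem inp (nb_com 25 37 46) m3"
  define m5 where "m5 = sem inp emit_com m4"
  define m6 where "m6 = sem inp last_com m5"
  have s: "s = upd 11 0 (m6 20 0) m6"
    by (simp add: s_def round_com_def m1_def m2_def m3_def m4_def m5_def m6_def)
  have wr: "writes emit_com = {12}" "writes last_com = {12, 20}"
    by (auto simp: emit_com_def last_com_def)
  have lm: "loaded N m" "m 9 0 = n" "n \<le> N" using m by (auto simp: ready_def)
  have l: "loaded N m1" "loaded N m2" "loaded N m3" "loaded N m4" "loaded N m5" "loaded N m6"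
    unfolding m6_def m5_def m4_def m3_def m2_def m1_def
    using lm(1) by (intro loaded_sem; simp add: wr)+
  have ls: "loaded N s" unfolding s using l(6) by (rule loaded_cong) (auto simp: upd_other)
  have N: "m 10 0 = N" "m1 10 0 = N" using lm l by (simp_all add: loaded_def layout_def)
  have f1: "m1 z = m z" if "z \<notin> {12, 37}" for z
    unfolding m1_def using that by (intro sem_frame) auto
  have f2: "m2 z = m z" if "z \<notin> {12, 37, 38}" for z
    unfolding m2_def using that f1 by (subst sem_frame) auto
  have f3: "m3 z = m2 z" if "z \<notin> insert 48 (writes step_com)" for z
    unfolding m3_def using that by (intro sem_frame) auto
  have f6: "m6 z = m3 z" if "z \<notin> {12, 13, 46, 20}" for z
    unfolding m6_def m5_def m4_def using that by (simp add: sem_frame wr)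
  have "arr_set N (m1 37) = A"
    unfolding m1_def
    using sem_copy[where m = m and N = N and a = 47 and b = 37 and inp = inp] N(1) m
    by (simp add: ready_def)
  moreover have "m2 37 = m1 37" unfolding m2_def by (simp add: sem_frame)
  moreover have "arr_set N (m2 38) = {}"
    unfolding m2_def using sem_clear[where m = m1 and N = N and x = 38 and inp = inp] N(2) by simp
  ultimately have st2: "state N m2 = (A, {})" by (simp add: state_def)
  have "m2 9 0 = n" "m2 20 = m 20" "word n m2 = word n m"
    using f2 lm(2) by (simp_all add: word_def)
  then have d: "(state N m3, word n m3) = d"
    unfolding m3_def d_def using sem_steps(2)[OF l(2), where n = n and inp = inp] st2 by simp
  have w6: "word n m6 = word n m3" "word n s = word n m3" "word n m5 = word n m3"
    using f6[of 45] by (simp_all add: s word_def upd_other m5_def m4_def sem_frame wr)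
  show "word n s = snd d" using w6 d by (metis snd_conv)
  have "m5 9 0 = n" "n \<le> m5 8 0"
    using f3[of 9] f2[of 9] lm l(5) by (simp_all add: m5_def m4_def sem_frame wr loaded_def layout_def)
  then have "m6 20 0 = last_left (word n m5)" unfolding m6_def by (rule sem_last)
  then show "s 20 0 = last_left (snd d)" "s 11 0 = last_left (snd d)"
    using w6 d by (auto simp: s upd_simps)
  have "s 9 0 = n" "s 30 = m 30" "s 47 = m 47"
    using f6 f3 f2 lm(2) by (simp_all add: s upd_other)
  then show "ready n N A I s" using m ls by (simp add: ready_def)
  have "arr_set N (m4 46) = nb E (fst (fst d))"
    unfolding m4_def using sem_nb[of N m3 25 37 46 inp] l(3) d[symmetric]
    by (simp add: loaded_def state_def)
  moreover have "arr_set n (m4 46) = arr_set N (m4 46) \<inter> {..<n}"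
    using lm(3) by (auto simp: arr_set_def)
  moreover have "m4 9 0 = n" "m4 30 = m 30"
    using f3 f2 lm(2) by (simp_all add: m4_def sem_frame)
  moreover have "outp inp round_com m = outp inp emit_com m4"
  proof -
    have "silent (copy_com 47 37)" "silent (clear 38)" "silent (For 48 9 step_com)"
      "silent (nb_com 25 37 46)" "silent last_com"
      by (simp_all add: copy_com_def clear_def step_com_def nb_com_def last_com_def pick_com_def
        closure_com_def reach_com_def push_def check_com_def turn_com_def move_com_def)
    then show ?thesis
      by (simp add: round_com_def outp_silent m1_def m2_def m3_def m4_def
        del: outp.simps(6) sem.simps(6))
  qed
  ultimately show "set (outp inp round_com m) = I \<union> (nb E (fst (fst d)) \<inter> {..<n})"
    using m outp_emit[of inp m4] by (simp add: ready_def)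
qed

end

section \<open>Reading the encoded instance\<close>

lemma concat_rows:
  assumes "\<And>i. i < m \<Longrightarrow> length (f i) = n"
  shows "length (concat (map f [0..<m])) = m * n"
    and "i < m \<Longrightarrow> j < n \<Longrightarrow> concat (map f [0..<m]) ! (i * n + j) = f i ! j"
proof -
  have "length (concat (map f [0..<m])) = m * n \<and>
      (\<forall>i<m. \<forall>j<n. concat (map f [0..<m]) ! (i * n + j) = f i ! j)"
    using assms
  proof (induction m)
    case (Suc m)
    then have IH: "length (concat (map f [0..<m])) = m * n"
      "\<forall>i<m. \<forall>j<n. concat (map f [0..<m]) ! (i * n + j) = f i ! j"
      by auto
    have "i * n + j < m * n" if "i < m" "j < n" for i j
      using that mult_le_mono1[of "Suc i" m n] by simp
    then show ?case using IH Suc.prems by (auto simp: nth_append less_Suc_eq)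
  qed simp
  then show "length (concat (map f [0..<m])) = m * n"
    and "i < m \<Longrightarrow> j < n \<Longrightarrow> concat (map f [0..<m]) ! (i * n + j) = f i ! j"
    by blast+
qed

lemma length_adjacency_matrix: "length (adjacency_matrix n E) = n * n"
  unfolding adjacency_matrix_def by (rule concat_rows(1)) simp

lemma nth_adjacency_matrix:
  "i < n \<Longrightarrow> j < n \<Longrightarrow> adjacency_matrix n E ! (i * n + j) = of_bool ((i, j) \<in> E)"
  unfolding adjacency_matrix_def by (subst concat_rows(2)) simp_all

lemma set_adjacency_matrix: "set (adjacency_matrix n E) \<subseteq> {0, 1}"
  by (auto simp: adjacency_matrix_def)

lemma length_set_bits: "length (set_bits n A) = n"
  by (simp add: set_bits_def)

lemma nth_set_bits: "i < n \<Longrightarrow> set_bits n A ! i = of_bool (i \<in> A)"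
  by (simp add: set_bits_def)

lemma matrix_index: "i < n \<Longrightarrow> j < n \<Longrightarrow> i * n + j < n * (n::nat)"
  using mult_le_mono1[of "Suc i" n n] by simp

definition fetch :: "nat list \<Rightarrow> nat \<Rightarrow> nat" where
  "fetch inp k = (if k < length inp then inp ! k else 0)"

text \<open>The positions are bracketed as the expressions of the program evaluate to them, with
  \<open>2 * n\<close> for variable 10.\<close>

lemma encode_nth:
  fixes n G X Y R I
  defines "inp \<equiv> encode_instance n G X Y R I"
  shows "fetch inp 0 = n"
    and "i < n \<Longrightarrow> fetch inp (1 + i) = of_bool (i \<in> X)"
    and "i < n \<Longrightarrow> fetch inp (1 + (n + i)) = of_bool (i \<in> Y)"
    and "i < n \<Longrightarrow> fetch inp (1 + (2 * n + i)) = of_bool (i \<in> R)"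
    and "i < n \<Longrightarrow> fetch inp (1 + (2 * n + (n + i))) = of_bool (i \<in> I)"
    and "i < n \<Longrightarrow> j < n \<Longrightarrow> fetch inp (1 + 4 * n + i * n + j) = of_bool ((i, j) \<in> dir G)"
    and "i < n \<Longrightarrow> j < n \<Longrightarrow> fetch inp (1 + 4 * n + n * n + i * n + j) = of_bool ((i, j) \<in> und G)"
    and "i < n \<Longrightarrow> j < n \<Longrightarrow>
      fetch inp (1 + 4 * n + n * n + n * n + i * n + j) = of_bool ((i, j) \<in> bid G)"
proof -
  have len: "length inp = 1 + 4 * n + 3 * (n * n)"
    by (simp add: inp_def encode_instance_def length_set_bits length_adjacency_matrix)
  have app: "(xs @ ys) ! (length xs + k) = ys ! k" for xs ys :: "nat list" and k by simp
  have sb: "length (set_bits n A) = n" for A by (simp add: length_set_bits)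
  have head: "(set_bits n A @ ys) ! i = of_bool (i \<in> A)" if "i < n" for A ys i
    using that by (simp add: nth_append sb nth_set_bits)
  have skip: "(set_bits n A @ ys) ! (n + k) = ys ! k" for A ys k
    using app[of "set_bits n A"] by (simp add: sb)
  have mhead: "(adjacency_matrix n A @ ys) ! (i * n + j) = of_bool ((i, j) \<in> A)"
    if "i < n" "j < n" for A ys i j
    using that by (simp add: nth_append length_adjacency_matrix matrix_index nth_adjacency_matrix)
  have mskip: "(adjacency_matrix n A @ ys) ! (n * n + k) = ys ! k" for A ys k
    using app[of "adjacency_matrix n A"] by (simp add: length_adjacency_matrix)
  show "fetch inp 0 = n" by (simp add: fetch_def len) (simp add: inp_def encode_instance_def)
  show "i < n \<Longrightarrow> fetch inp (1 + i) = of_bool (i \<in> X)"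
    by (simp add: fetch_def len) (simp add: inp_def encode_instance_def head)
  show "i < n \<Longrightarrow> fetch inp (1 + (n + i)) = of_bool (i \<in> Y)"
    by (simp add: fetch_def len) (simp add: inp_def encode_instance_def head skip)
  show "fetch inp (1 + (2 * n + i)) = of_bool (i \<in> R)" if "i < n"
  proof -
    have "1 + (2 * n + i) = Suc (n + (n + i))" by simp
    moreover have "Suc (n + (n + i)) < length inp" using that by (simp add: len)
    ultimately show ?thesis
      using that by (simp only: fetch_def if_True)
        (simp add: inp_def encode_instance_def head skip)
  qed
  show "fetch inp (1 + (2 * n + (n + i))) = of_bool (i \<in> I)" if "i < n"
  proof -
    have "1 + (2 * n + (n + i)) = Suc (n + (n + (n + i)))" by simp
    moreover have "Suc (n + (n + (n + i))) < length inp" using that by (simp add: len)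
    ultimately show ?thesis
      using that by (simp only: fetch_def if_True)
        (simp add: inp_def encode_instance_def head skip)
  qed
  show "fetch inp (1 + 4 * n + i * n + j) = of_bool ((i, j) \<in> dir G)" if "i < n" "j < n"
  proof -
    have "1 + 4 * n + i * n + j = Suc (n + (n + (n + (n + (i * n + j)))))" by simp
    moreover have "Suc (n + (n + (n + (n + (i * n + j))))) < length inp"
      using matrix_index[OF that] by (simp add: len)
    ultimately show ?thesis
      using that by (simp only: fetch_def if_True)
        (simp add: inp_def encode_instance_def skip mhead)
  qed
  show "fetch inp (1 + 4 * n + n * n + i * n + j) = of_bool ((i, j) \<in> und G)" if "i < n" "j < n"
  proof -
    have "1 + 4 * n + n * n + i * n + j = Suc (n + (n + (n + (n + (n * n + (i * n + j))))))" by simp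
    moreover have "Suc (n + (n + (n + (n + (n * n + (i * n + j)))))) < length inp"
      using matrix_index[OF that] by (simp add: len)
    ultimately show ?thesis
      using that by (simp only: fetch_def if_True)
        (simp add: inp_def encode_instance_def skip mhead mskip)
  qed
  show "fetch inp (1 + 4 * n + n * n + n * n + i * n + j) = of_bool ((i, j) \<in> bid G)"
    if "i < n" "j < n"
  proof -
    have "1 + 4 * n + n * n + n * n + i * n + j =
        Suc (n + (n + (n + (n + (n * n + (n * n + (i * n + j)))))))" by simp
    moreover have "Suc (n + (n + (n + (n + (n * n + (n * n + (i * n + j))))))) < length inp"
      using matrix_index[OF that] by (simp add: len)
    moreover have "adjacency_matrix n (bid G) ! (i * n + j) = of_bool ((i, j) \<in> bid G)"
      using that by (rule nth_adjacency_matrix)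
    ultimately show ?thesis
      using that by (simp only: fetch_def if_True)
        (simp add: inp_def encode_instance_def skip mskip)
  qed
qed

lemma encode_bound: "v \<in> set (encode_instance n G X Y R I) \<Longrightarrow> v \<le> max n 1"
  using set_adjacency_matrix by (fastforce simp: encode_instance_def set_bits_def)

text \<open>Variable 8 runs through the multiples of \<open>N\<close> by repeated addition up to
  \<open>N * N\<close>. Tripling it puts it above all positions in the input once \<open>n\<close>
  is at least 2. Since the cap is only being built here, \<open>static_safe\<close> does not apply
  and safety is shown directly.\<close>

definition table_com :: com where
  "table_com =
     Set 9 (Inp (Num 0)) ;; Set 10 (Plus (Var 9) (Var 9)) ;;
     For 12 10 (Put 23 (Var 12) (Var 8) ;; Set 8 (Plus (Var 8) (Var 10))) ;;
     Set 8 (Plus (Var 8) (Plus (Var 8) (Var 8)))"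

lemma sem_table:
  fixes inp n N W
  defines "m \<equiv> sem inp table_com (\<lambda>_ _. 0)"
  assumes n: "fetch inp 0 = n" "1 \<le> n" and N: "N = 2 * n" and W: "64 * (3 * (N * N)) + 64 < W"
  shows "m 9 0 = n" "m 10 0 = N" "m 8 0 = 3 * (N * N)" "u < N \<Longrightarrow> m 23 u = u * N"
    "z \<notin> {8, 9, 10, 12, 23} \<Longrightarrow> m z = (\<lambda>_. 0)"
    "bounded_store (3 * (N * N)) N m" "safe W N inp table_com (\<lambda>_ _. 0)"
proof -
  let ?body = "Put 23 (Var 12) (Var 8) ;; Set 8 (Plus (Var 8) (Var 10))"
  define m1 :: store where "m1 = upd 10 0 N (upd 9 0 n (\<lambda>_ _. 0))"
  define st where "st k = (loop_step 12 (sem inp ?body) ^^ k) (upd 12 0 0 m1)" for k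
  have N1: "m1 10 0 = N" by (simp add: m1_def upd_simps)
  have NN: "N \<le> N * N" using n N by simp
  define J where "J k s \<longleftrightarrow> s 8 0 = k * N \<and> (\<forall>u<k. s 23 u = u * N) \<and> (\<forall>x i. s x i \<le> N * N) \<and>
    (\<forall>z. z \<notin> {8, 12, 23} \<longrightarrow> s z = m1 z)" for k s
  have J: "J k (st k)" if "k \<le> N" for k
  proof -
    have "k \<le> m1 10 0" using that N1 by simp
    then show ?thesis
      unfolding st_def
    proof (rule For_iterate[where J = J and y = 10, rotated -1])
      show "J 0 (upd 12 0 0 m1)"
        using NN N by (auto simp: J_def m1_def upd_def)
    next
      fix k s
      assume k: "k < m1 10 0" "s 12 0 = k" and Jk: "J k s"
      have Js: "s 8 0 = k * N" "\<And>u. u < k \<Longrightarrow> s 23 u = u * N" "\<And>x i. s x i \<le> N * N"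
        "\<And>z. z \<notin> {8, 12, 23} \<Longrightarrow> s z = m1 z"
        using Jk unfolding J_def by blast+
      have kN: "k < N" "k * N + N \<le> N * N"
        using mult_le_mono1[of "Suc k" N N] k(1) N1 by simp_all
      have "s 10 0 = N" using Js(4)[of 10] N1 by simp
      then have e: "upd 12 0 (Suc k) (sem inp ?body s) =
          upd 12 0 (Suc k) (upd 8 0 (k * N + N) (upd 23 k (k * N) s))"
        using Js(1) k(2) by (simp add: upd_simps)
      have "upd 12 0 (Suc k) (upd 8 0 (k * N + N) (upd 23 k (k * N) s)) x i \<le> N * N" for x i
        using Js(3)[of x i] kN NN by (simp add: upd_apply)
      then show "J (Suc k) (upd 12 0 (Suc k) (sem inp ?body s))"
        unfolding e J_def using Js(2,4) by (auto simp: upd_simps less_Suc_eq)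
    qed simp
  qed
  have ev: "eval inp (Inp (Num 0)) s = n" for s
    using n(1) unfolding fetch_def eval.simps .
  have nW: "n < W" "n + n < W" "64 < W" using NN N W by linarith+
  have pre: "sem inp (Set 10 (Plus (Var 9) (Var 9))) (sem inp (Set 9 (Inp (Num 0))) (\<lambda>_ _. 0)) = m1"
    using N by (simp add: m1_def upd_simps mult_2 ev del: eval.simps(3))
  have loop: "sem inp (For 12 10 ?body) m1 = st N" by (simp only: sem.simps(6) N1 st_def)
  have m: "m = upd 8 0 (3 * st N 8 0) (st N)"
  proof -
    have "m = sem inp (Set 8 (Plus (Var 8) (Plus (Var 8) (Var 8)))) (st N)"
      unfolding m_def table_com_def by (simp add: loop pre del: sem.simps(2,6))
    then show ?thesis by (simp add: numeral_3_eq_3)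
  qed
  have JN: "J N (st N)" using J by simp
  show "m 9 0 = n" "m 10 0 = N" "m 8 0 = 3 * (N * N)"
    using JN by (simp_all add: J_def m m1_def upd_simps)
  show "u < N \<Longrightarrow> m 23 u = u * N" using JN by (simp add: J_def m upd_other)
  show "z \<notin> {8, 9, 10, 12, 23} \<Longrightarrow> m z = (\<lambda>_. 0)" using JN by (simp add: J_def m m1_def upd_other)
  have "m x i \<le> 3 * (N * N)" for x i
  proof -
    have "st N x i \<le> N * N" "st N 8 0 = N * N" using JN by (simp_all add: J_def)
    then show ?thesis unfolding m upd_apply by auto
  qed
  then show "bounded_store (3 * (N * N)) N m"
    using \<open>m 8 0 = 3 * (N * N)\<close> \<open>m 9 0 = n\<close> \<open>m 10 0 = N\<close> N by (simp add: bounded_store_def)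
  have small: "k < W" if "k \<le> 3 * (N * N)" for k using that W by simp
  have body: "safe W N inp ?body (st k)" if k: "k < N" for k
  proof -
    have s: "st k 8 0 = k * N" "st k 10 0 = N" "st k 12 0 = k"
      using J[of k] k N1 loop_counter(1)[of 12 ?body k inp m1] by (simp_all add: J_def st_def)
    have "k * N + N \<le> N * N" using mult_le_mono1[of "Suc k" N N] k by simp
    moreover have "64 * k + 23 < W" using k NN W by linarith
    ultimately show ?thesis using W NN by (simp add: s upd_simps)
  qed
  have "safe W N inp (For 12 10 ?body) m1"
    using body N1 by (simp add: st_def)
  moreover have "safe W N inp (Set 8 (Plus (Var 8) (Plus (Var 8) (Var 8)))) (st N)"
    using JN W by (simp add: J_def)
  moreover have "safe W N inp (Set 9 (Inp (Num 0))) (\<lambda>_ _. 0)"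
    using nW by (simp add: ev del: eval.simps(3))
  moreover have "safe W N inp (Set 10 (Plus (Var 9) (Var 9))) (sem inp (Set 9 (Inp (Num 0))) (\<lambda>_ _. 0))"
    using nW by (simp add: ev upd_simps del: eval.simps(3))
  ultimately show "safe W N inp table_com (\<lambda>_ _. 0)"
    unfolding table_com_def by (simp add: loop pre del: sem.simps(2,6) safe.simps(2,6))
qed

definition rows_com :: "nat \<Rightarrow> com" where
  "rows_com x = For 12 9 (Put x (Var 12) (Var 22) ;; Set 22 (Capped (Plus (Var 22) (Var 9))))"

lemma sem_rows:
  assumes "m 9 0 = n" "m 22 0 = b" "b + n * n \<le> m 8 0" "x \<notin> {8, 9, 12, 22}"
  shows "(\<forall>i<n. sem inp (rows_com x) m x i = b + i * n) \<and> sem inp (rows_com x) m 22 0 = b + n * n"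
proof -
  let ?body = "Put x (Var 12) (Var 22) ;; Set 22 (Capped (Plus (Var 22) (Var 9)))"
  have "(\<forall>i<m 9 0. sem inp (For 12 9 ?body) m x i = b + i * n) \<and>
      sem inp (For 12 9 ?body) m 22 0 = b + m 9 0 * n"
  proof (rule For_invariant[where J = "\<lambda>k s. (\<forall>i<k. s x i = b + i * n) \<and> s 22 0 = b + k * n"])
    fix k s
    assume k: "k < m 9 0" "s 12 0 = k"
      and J: "(\<forall>i<k. s x i = b + i * n) \<and> s 22 0 = b + k * n"
      and fr: "\<And>z. z \<notin> writes (For 12 9 ?body) \<Longrightarrow> s z = m z"
    have f: "s 9 = m 9" "s 8 = m 8" using assms(4) by (intro fr; auto)+
    have "b + k * n + n \<le> m 8 0"
      using mult_le_mono1[of "Suc k" n n] k(1) assms(1,3) by simp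
    then show "(\<forall>i<Suc k. upd 12 0 (Suc k) (sem inp ?body s) x i = b + i * n) \<and>
        upd 12 0 (Suc k) (sem inp ?body s) 22 0 = b + Suc k * n"
      using J k f assms(1,4) by (auto simp: upd_simps less_Suc_eq)
  qed (use assms in \<open>auto simp: upd_simps\<close>)
  then show ?thesis using assms(1) by (simp add: rows_com_def del: sem.simps(6))
qed

definition mark_com :: "nat \<Rightarrow> exp \<Rightarrow> com" where
  "mark_com x e = For 12 9 (If e (Put x (Var 12) (Num 1)) Skip)"

lemma sem_mark:
  assumes n: "m 9 0 = n" and x: "x \<notin> {9, 12}" "m x = (\<lambda>_. 0)"
    and e: "\<And>s k. k < n \<Longrightarrow> s 12 0 = k \<Longrightarrow> (\<And>z. z \<notin> {12, x} \<Longrightarrow> s z = m z) \<Longrightarrow>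
      eval inp e s \<noteq> 0 \<longleftrightarrow> k \<in> Q"
    and N: "n \<le> N"
  shows "arr_set N (sem inp (mark_com x e) m x) = {k. k < n \<and> k \<in> Q}"
proof -
  let ?body = "If e (Put x (Var 12) (Num 1)) Skip"
  have "\<forall>i. sem inp (For 12 9 ?body) m x i \<noteq> 0 \<longleftrightarrow> i < m 9 0 \<and> i \<in> Q"
  proof (rule For_invariant[where J = "\<lambda>k s. \<forall>i. s x i \<noteq> 0 \<longleftrightarrow> i < k \<and> i \<in> Q"])
    fix k s
    assume k: "k < m 9 0" "s 12 0 = k" and J: "\<forall>i. s x i \<noteq> 0 \<longleftrightarrow> i < k \<and> i \<in> Q"
      and fr: "\<And>z. z \<notin> writes (For 12 9 ?body) \<Longrightarrow> s z = m z"
    have fz: "s z = m z" if "z \<notin> {12, x}" for z using fr[of z] that by simp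
    have "eval inp e s \<noteq> 0 \<longleftrightarrow> k \<in> Q" by (rule e[OF _ k(2) fz]) (use k(1) n in simp_all)
    then have b: "sem inp ?body s = (if k \<in> Q then upd x k 1 s else s)" using k(2) by simp
    have "upd 12 0 (Suc k) (sem inp ?body s) x i \<noteq> 0 \<longleftrightarrow> i < Suc k \<and> i \<in> Q" for i
      unfolding b using J[rule_format, of i] x(1) by (cases "i = k") (auto simp: upd_apply)
    then show "\<forall>i. upd 12 0 (Suc k) (sem inp ?body s) x i \<noteq> 0 \<longleftrightarrow> i < Suc k \<and> i \<in> Q" by blast
  next
    show "12 \<notin> writes ?body" using x(1) by auto
  next
    have "upd 12 0 0 m x = m x" using x(1) by (intro upd_other) auto
    then show "\<forall>i. upd 12 0 0 m x i \<noteq> 0 \<longleftrightarrow> i < 0 \<and> i \<in> Q" using x(2) by simp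
  qed
  then have iff: "sem inp (mark_com x e) m x i \<noteq> 0 \<longleftrightarrow> i < n \<and> i \<in> Q" for i
    unfolding mark_com_def n by blast
  show ?thesis unfolding arr_set_def iff using N by auto
qed

definition pairs_com :: "com \<Rightarrow> com" where
  "pairs_com c = For 12 9 (For 13 9 c)"

text \<open>The body sets entries but never clears them, so the result is the union of the
  contributions \<open>Q i j\<close>.\<close>

lemma sem_pairs:
  assumes n: "m 9 0 = n" and x: "x \<notin> {9, 12, 13}" "writes c \<subseteq> {x}"
    and c: "\<And>s i j a. i < n \<Longrightarrow> j < n \<Longrightarrow> s 12 0 = i \<Longrightarrow> s 13 0 = j \<Longrightarrow>
      (\<And>z. z \<notin> {12, 13, x} \<Longrightarrow> s z = m z) \<Longrightarrow> sem inp c s x a \<noteq> 0 \<longleftrightarrow> s x a \<noteq> 0 \<or> a \<in> Q i j"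
  shows "sem inp (pairs_com c) m x a \<noteq> 0 \<longleftrightarrow> m x a \<noteq> 0 \<or> (\<exists>i<n. \<exists>j<n. a \<in> Q i j)"
proof -
  have w: "z \<notin> writes c" if "z \<noteq> x" for z using that x by blast
  have inner: "\<forall>a. sem inp (For 13 9 c) s x a \<noteq> 0 \<longleftrightarrow> s x a \<noteq> 0 \<or> (\<exists>j<n. a \<in> Q i j)"
    if i: "i < n" "s 12 0 = i" "\<And>z. z \<notin> {12, 13, x} \<Longrightarrow> s z = m z" for i s
  proof -
    have n': "s 9 0 = n" using i(3)[of 9] n x by simp
    have "\<forall>a. sem inp (For 13 9 c) s x a \<noteq> 0 \<longleftrightarrow> s x a \<noteq> 0 \<or> (\<exists>j<s 9 0. a \<in> Q i j)"
    proof (rule For_invariant[where J = "\<lambda>k t. \<forall>a. t x a \<noteq> 0 \<longleftrightarrow> s x a \<noteq> 0 \<or> (\<exists>j<k. a \<in> Q i j)"])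
      fix k t
      assume k: "k < s 9 0" "t 13 0 = k"
        and J: "\<forall>a. t x a \<noteq> 0 \<longleftrightarrow> s x a \<noteq> 0 \<or> (\<exists>j<k. a \<in> Q i j)"
        and fr: "\<And>z. z \<notin> writes (For 13 9 c) \<Longrightarrow> t z = s z"
      have fr': "t z = s z" if "z \<notin> {13, x}" for z using fr[of z] w[of z] that by simp
      have t12: "t 12 0 = i" using fr'[of 12] i(2) x by simp
      have tz: "t z = m z" if "z \<notin> {12, 13, x}" for z using fr'[of z] i(3)[of z] that by simp
      have kn: "k < n" using k n' by simp
      have "sem inp c t x a \<noteq> 0 \<longleftrightarrow> t x a \<noteq> 0 \<or> a \<in> Q i k" for a
        by (rule c[OF i(1) kn t12 k(2) tz])
      then show "\<forall>a. upd 13 0 (Suc k) (sem inp c t) x a \<noteq> 0 \<longleftrightarrow>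
          s x a \<noteq> 0 \<or> (\<exists>j<Suc k. a \<in> Q i j)"
        using J x by (auto simp: upd_other less_Suc_eq)
    qed (use w x in \<open>auto simp: upd_other\<close>)
    then show ?thesis using n' by simp
  qed
  have "\<forall>a. sem inp (For 12 9 (For 13 9 c)) m x a \<noteq> 0 \<longleftrightarrow>
      m x a \<noteq> 0 \<or> (\<exists>i<m 9 0. \<exists>j<n. a \<in> Q i j)"
  proof (rule For_invariant[where J = "\<lambda>k s. \<forall>a. s x a \<noteq> 0 \<longleftrightarrow> m x a \<noteq> 0 \<or> (\<exists>i<k. \<exists>j<n. a \<in> Q i j)"])
    fix k s
    assume k: "k < m 9 0" "s 12 0 = k"
      and J: "\<forall>a. s x a \<noteq> 0 \<longleftrightarrow> m x a \<noteq> 0 \<or> (\<exists>i<k. \<exists>j<n. a \<in> Q i j)"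
      and fr: "\<And>z. z \<notin> writes (For 12 9 (For 13 9 c)) \<Longrightarrow> s z = m z"
    have "s z = m z" if "z \<notin> {12, 13, x}" for z using fr[of z] w[of z] that by simp
    then have "\<forall>a. sem inp (For 13 9 c) s x a \<noteq> 0 \<longleftrightarrow> s x a \<noteq> 0 \<or> (\<exists>j<n. a \<in> Q k j)"
      using inner[of k s] k n by simp
    then show "\<forall>a. upd 12 0 (Suc k) (sem inp (For 13 9 c) s) x a \<noteq> 0 \<longleftrightarrow>
        m x a \<noteq> 0 \<or> (\<exists>i<Suc k. \<exists>j<n. a \<in> Q i j)"
      using J x by (auto simp: upd_other less_Suc_eq simp del: sem.simps(6))
  qed (use w x in \<open>auto simp: upd_other\<close>)
  then show ?thesis using n by (simp add: pairs_com_def del: sem.simps(6))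
qed

lemma eval_Inp: "eval inp (Inp e) s = fetch inp (eval inp e s)"
  by (simp add: fetch_def)

lemma row_index_inj:
  assumes "w < N" "w' < (N::nat)" shows "u * N + w = u' * N + w' \<longleftrightarrow> u = u' \<and> w = w'"
proof
  assume e: "u * N + w = u' * N + w'"
  have "(u * N + w) div N = u" "(u' * N + w') div N = u'" using assms by simp_all
  then have "u = u'" using e by metis
  then show "u = u' \<and> w = w'" using e by simp
qed simp

definition dir_exp :: "nat \<Rightarrow> nat \<Rightarrow> exp" where
  "dir_exp i j = Inp (Plus (Arr 32 (Var i)) (Var j))"

definition und_exp :: "nat \<Rightarrow> nat \<Rightarrow> exp" where
  "und_exp i j = Inp (Plus (Arr 33 (Var i)) (Var j))"

definition bid_exp :: "nat \<Rightarrow> nat \<Rightarrow> exp" where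
  "bid_exp i j = Inp (Plus (Arr 34 (Var i)) (Var j))"

definition anterior_com :: com where
  "anterior_com = pairs_com (If (Plus (dir_exp 12 13) (und_exp 12 13))
     (Put 24 (Plus (Arr 23 (Var 13)) (Var 12)) (Num 1)) Skip)"

definition adjacent_exp :: exp where
  "adjacent_exp =
     Plus (Plus (dir_exp 12 13) (dir_exp 13 12)) (Plus (und_exp 12 13) (bid_exp 12 13))"

definition arrow_exp :: exp where
  "arrow_exp = Plus (dir_exp 12 13) (bid_exp 12 13)"

text \<open>An element of \<open>I\<close> is barred as an ordinary node only; the tests on array 30
  leave its copy in place.\<close>

definition edge_com :: com where
  "edge_com =
     If (Arr 31 (Var 12)) (If (Arr 31 (Var 13))
       (If (Arr 30 (Var 12)) Skip
         (If (Arr 30 (Var 13)) Skip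
           (If adjacent_exp (Put 25 (Plus (Arr 23 (Var 12)) (Var 13)) (Num 1)) Skip) ;;
          If arrow_exp
            (Put 25 (Plus (Arr 23 (Var 12)) (Plus (Var 9) (Var 13))) (Num 1) ;;
             Put 25 (Plus (Arr 23 (Plus (Var 9) (Var 13))) (Var 12)) (Num 1)) Skip) ;;
        If (bid_exp 12 13)
          (Put 25 (Plus (Arr 23 (Plus (Var 9) (Var 12))) (Plus (Var 9) (Var 13))) (Num 1)) Skip)
       Skip) Skip"

text \<open>The first assignment yields \<open>1 + 4 * n\<close>, where the matrices begin: after
  the number \<open>n\<close> and four bit vectors.\<close>

definition read_com :: com where
  "read_com =
     Set 22 (Capped (Plus (Num 1) (Plus (Var 10) (Var 10)))) ;;
     rows_com 32 ;; rows_com 33 ;; rows_com 34 ;;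
     mark_com 27 (Inp (Plus (Num 1) (Var 12))) ;;
     mark_com 28 (Inp (Plus (Num 1) (Plus (Var 9) (Var 12)))) ;;
     mark_com 30 (Inp (Plus (Num 1) (Plus (Var 10) (Plus (Var 9) (Var 12))))) ;;
     mark_com 35 (Plus (Arr 27 (Var 12)) (Plus (Arr 28 (Var 12)) (Arr 30 (Var 12))))"

text \<open>Array 36 is never written and so is the empty set of blocked nodes. For a bit
  \<open>r\<close>, the truncated \<open>r - i - (1 - m)\<close> is nonzero exactly if
  \<open>r\<close> and \<open>m\<close> are nonzero and \<open>i\<close> is zero; this is membership
  in \<open>D\<close>.\<close>

definition graph_com :: com where
  "graph_com =
     anterior_com ;; reach_com 24 35 36 31 ;;
     mark_com 29 (Minus (Minus (Inp (Plus (Num 1) (Plus (Var 10) (Var 12)))) (Arr 30 (Var 12)))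
       (Minus (Num 1) (Arr 31 (Var 12)))) ;;
     pairs_com edge_com"

definition start_com :: com where
  "start_com =
     copy_com 27 39 ;; closure_com ;; copy_com 44 47 ;; Set 11 (Var 19)"

lemma writes_pairs [simp]: "writes (pairs_com c) = {12, 13} \<union> writes c"
  by (auto simp: pairs_com_def)

lemma writes_rows [simp]: "writes (rows_com x) = {12, 22, x}"
  by (auto simp: rows_com_def)

lemma writes_mark [simp]: "writes (mark_com x e) = {12, x}"
  by (auto simp: mark_com_def)

lemma writes_anterior [simp]: "writes anterior_com = {12, 13, 24}"
  by (auto simp: anterior_com_def)

lemma writes_edge [simp]: "writes edge_com = {25}"
  by (auto simp: edge_com_def)

lemma writes_read [simp]: "writes read_com = {12, 22, 32, 33, 34, 27, 28, 30, 35}"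
  by (auto simp: read_com_def)

lemma writes_graph [simp]: "writes graph_com = {12, 13, 14, 15, 16, 24, 25, 26, 29, 31}"
  by (auto simp: graph_com_def)

context separator_instance
begin

abbreviation inp :: "nat list" where
  "inp \<equiv> encode_instance n G X Y R I"

abbreviation N :: nat where
  "N \<equiv> 2 * n"

definition tables :: "store \<Rightarrow> bool" where
  "tables s \<longleftrightarrow> s 9 0 = n \<and> s 10 0 = N \<and> N \<le> s 8 0 \<and> (\<forall>u<N. s 23 u = u * N) \<and>
     (\<forall>i<n. s 32 i = 1 + 4 * n + i * n \<and> s 33 i = 1 + 4 * n + n * n + i * n \<and>
       s 34 i = 1 + 4 * n + n * n + n * n + i * n)"

lemma tables_cong:
  "tables m \<Longrightarrow> (\<And>z. z \<in> {8, 9, 10, 23, 32, 33, 34} \<Longrightarrow> s z = m z) \<Longrightarrow> tables s"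
  by (simp add: tables_def)

lemma tables_sem:
  "tables m \<Longrightarrow> {8, 9, 10, 23, 32, 33, 34} \<inter> writes c = {} \<Longrightarrow> tables (sem inp c m)"
  by (erule tables_cong) (auto intro!: sem_frame)

lemma tables_layout: "tables s \<Longrightarrow> layout N s"
  by (simp add: tables_def layout_def)

lemma eval_edges:
  assumes "tables s" "s x 0 = i" "s y 0 = j" "i < n" "j < n"
  shows "eval inp (dir_exp x y) s = of_bool ((i, j) \<in> dir G)"
    and "eval inp (und_exp x y) s = of_bool ((i, j) \<in> und G)"
    and "eval inp (bid_exp x y) s = of_bool ((i, j) \<in> bid G)"
  using assms encode_nth(6-8)[of i n j G X Y R I]
  by (simp_all add: dir_exp_def und_exp_def bid_exp_def eval_Inp tables_def del: eval.simps(3))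

lemma nodes_less: "v \<in> nodes G \<longleftrightarrow> v < n"
  using nodes by simp

lemma subset_less: "X \<subseteq> {..<n}" "Y \<subseteq> {..<n}" "R \<subseteq> {..<n}" "I \<subseteq> {..<n}"
  using X Y R IR nodes by auto

lemma sem_read:
  assumes m: "m 9 0 = n" "m 10 0 = N" "m 8 0 = 3 * (N * N)" "\<And>u. u < N \<Longrightarrow> m 23 u = u * N"
    and z: "\<And>z. z \<notin> {8, 9, 10, 12, 23} \<Longrightarrow> m z = (\<lambda>_. 0)" and n2: "2 \<le> n"
  defines "s \<equiv> sem inp read_com m"
  shows "tables s" "arr_set N (s 27) = X" "arr_set N (s 28) = Y" "arr_set N (s 30) = I"
    "arr_set N (s 35) = X \<union> Y \<union> I" "\<And>z. z \<in> {24, 25, 29, 31, 36} \<Longrightarrow> s z = (\<lambda>_. 0)"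
proof -
  let ?b = "1 + 4 * n"
  define m1 where "m1 = sem inp (Set 22 (Capped (Plus (Num 1) (Plus (Var 10) (Var 10))))) m"
  define m2 where "m2 = sem inp (rows_com 32) m1"
  define m3 where "m3 = sem inp (rows_com 33) m2"
  define m4 where "m4 = sem inp (rows_com 34) m3"
  define m5 where "m5 = sem inp (mark_com 27 (Inp (Plus (Num 1) (Var 12)))) m4"
  define m6 where "m6 = sem inp (mark_com 28 (Inp (Plus (Num 1) (Plus (Var 9) (Var 12))))) m5"
  define m7 where "m7 = sem inp (mark_com 30 (Inp (Plus (Num 1) (Plus (Var 10) (Plus (Var 9) (Var 12)))))) m6"
  define m8 where "m8 = sem inp (mark_com 35 (Plus (Arr 27 (Var 12)) (Plus (Arr 28 (Var 12)) (Arr 30 (Var 12))))) m7"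
  have s: "s = m8"
    by (simp add: s_def read_com_def m1_def m2_def m3_def m4_def m5_def m6_def m7_def m8_def)
  \<comment> \<open>Row positions go up to \<open>1 + 4 * n + 3 * (n * n)\<close>; that
    \<open>n\<close> is at least 2 keeps the cap from cutting them off.\<close>
  have "3 * (N * N) = 12 * (n * n)" by simp
  moreover have "2 * n \<le> n * n" using n2 by (rule mult_le_mono1)
  ultimately have cap: "?b + 3 * (n * n) \<le> 3 * (N * N)" using n2 by linarith
  have f1: "m1 z = m z" if "z \<noteq> 22" for z
    using that by (simp add: m1_def sem_frame del: sem.simps)
  have b1: "m1 22 0 = ?b" using m cap by (simp add: m1_def upd_simps)
  have f2: "m2 z = m1 z" if "z \<notin> {12, 22, 32}" for z
    using that by (simp add: m2_def sem_frame)
  have f3: "m3 z = m2 z" if "z \<notin> {12, 22, 33}" for z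
    using that by (simp add: m3_def sem_frame)
  have f4: "m4 z = m3 z" if "z \<notin> {12, 22, 34}" for z
    using that by (simp add: m4_def sem_frame)
  have f5: "m5 z = m4 z" if "z \<notin> {12, 27}" for z
    using that by (simp add: m5_def sem_frame)
  have f6: "m6 z = m5 z" if "z \<notin> {12, 28}" for z
    using that by (simp add: m6_def sem_frame)
  have f7: "m7 z = m6 z" if "z \<notin> {12, 30}" for z
    using that by (simp add: m7_def sem_frame)
  have f8: "m8 z = m7 z" if "z \<notin> {12, 35}" for z
    using that by (simp add: m8_def sem_frame)
  have r2: "(\<forall>i<n. m2 32 i = ?b + i * n) \<and> m2 22 0 = ?b + n * n"
    unfolding m2_def by (rule sem_rows) (use b1 f1 m cap in simp_all)
  have r3: "(\<forall>i<n. m3 33 i = ?b + n * n + i * n) \<and> m3 22 0 = ?b + n * n + n * n"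
    unfolding m3_def by (rule sem_rows) (use r2 f1 f2 m cap in simp_all)
  have r4: "(\<forall>i<n. m4 34 i = ?b + n * n + n * n + i * n) \<and> m4 22 0 = ?b + n * n + n * n + n * n"
    unfolding m4_def by (rule sem_rows) (use r3 f1 f2 f3 m cap in simp_all)
  have t4: "tables m4"
    using r2 r3 r4 f4 f3 f2 f1 m n2 by (simp add: tables_def)
  have zz: "m4 z = (\<lambda>_. 0)" if "z \<in> {27, 28, 30, 35, 24, 25, 29, 31, 36}" for z
    using that z[of z] f4[of z] f3[of z] f2[of z] f1[of z] by auto
  have t5: "tables m5" and t6: "tables m6" and t7: "tables m7" and t8: "tables m8"
    unfolding m8_def m7_def m6_def m5_def using t4 by (intro tables_sem; simp)+
  have nN: "n \<le> N" by simp
  have 5: "arr_set N (m5 27) = {k. k < n \<and> k \<in> X}"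
    unfolding m5_def
  proof (rule sem_mark)
    show "eval inp (Inp (Plus (Num 1) (Var 12))) s \<noteq> 0 \<longleftrightarrow> k \<in> X" if "k < n" "s 12 0 = k" for s k
      using that encode_nth(2)[of k n G X Y R I] by (simp add: eval_Inp del: eval.simps(3))
  qed (use t4 zz nN in \<open>auto simp: tables_def\<close>)
  have 6: "arr_set N (m6 28) = {k. k < n \<and> k \<in> Y}"
    unfolding m6_def
  proof (rule sem_mark)
    show "eval inp (Inp (Plus (Num 1) (Plus (Var 9) (Var 12)))) s \<noteq> 0 \<longleftrightarrow> k \<in> Y"
      if "k < n" "s 12 0 = k" "\<And>z. z \<notin> {12, 28} \<Longrightarrow> s z = m5 z" for s k
      using that(1,2) that(3)[of 9] t5 encode_nth(3)[of k n G X Y R I]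
      by (simp add: eval_Inp tables_def del: eval.simps(3))
  qed (use t5 zz[of 28] f5[of 28] nN in \<open>auto simp: tables_def\<close>)
  have 7: "arr_set N (m7 30) = {k. k < n \<and> k \<in> I}"
    unfolding m7_def
  proof (rule sem_mark)
    show "eval inp (Inp (Plus (Num 1) (Plus (Var 10) (Plus (Var 9) (Var 12))))) s \<noteq> 0 \<longleftrightarrow> k \<in> I"
      if "k < n" "s 12 0 = k" "\<And>z. z \<notin> {12, 30} \<Longrightarrow> s z = m6 z" for s k
      using that(1,2) that(3)[of 9] that(3)[of 10] t6 encode_nth(5)[of k n G X Y R I]
      by (simp add: eval_Inp tables_def del: eval.simps(3))
  qed (use t6 zz[of 30] f5[of 30] f6[of 30] nN in \<open>auto simp: tables_def\<close>)
  have X7: "arr_set N (m7 27) = X" and Y7: "arr_set N (m7 28) = Y" and I7: "arr_set N (m7 30) = I"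
    using 5 6 7 f6[of 27] f7[of 27] f7[of 28] subset_less by auto
  have bit: "k \<in> arr_set N f \<longleftrightarrow> f k \<noteq> 0" if "k < n" for k f using that by (simp add: arr_set_def)
  have 8: "arr_set N (m8 35) = {k. k < n \<and> k \<in> X \<union> Y \<union> I}"
    unfolding m8_def
  proof (rule sem_mark)
    show "eval inp (Plus (Arr 27 (Var 12)) (Plus (Arr 28 (Var 12)) (Arr 30 (Var 12)))) s \<noteq> 0 \<longleftrightarrow>
        k \<in> X \<union> Y \<union> I"
      if "k < n" "s 12 0 = k" "\<And>z. z \<notin> {12, 35} \<Longrightarrow> s z = m7 z" for s k
      using that(2) that(3)[of 27] that(3)[of 28] that(3)[of 30]
        bit[OF that(1), of "m7 27"] bit[OF that(1), of "m7 28"] bit[OF that(1), of "m7 30"]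
      unfolding X7 Y7 I7 by auto
  qed (use t7 zz[of 35] f5[of 35] f6[of 35] f7[of 35] nN in \<open>auto simp: tables_def\<close>)
  show "tables s" using t8 s by simp
  show "arr_set N (s 27) = X" "arr_set N (s 28) = Y" "arr_set N (s 30) = I"
    using X7 Y7 I7 f8 by (simp_all add: s)
  show "arr_set N (s 35) = X \<union> Y \<union> I" using 8 subset_less by (auto simp: s)
  show "s z = (\<lambda>_. 0)" if "z \<in> {24, 25, 29, 31, 36}" for z
    using that zz[of z] f5[of z] f6[of z] f7[of z] f8[of z] by (auto simp: s)
qed

text \<open>Only nodes are found, as the seeds are nodes and every anterior edge joins
  nodes.\<close>

lemma reach_anterior: "reach ((ant_edges G)\<inverse>) {} (X \<union> Y \<union> I) = M"
proof -
  have "(ant_edges G)\<inverse> \<inter> UNIV \<times> - {} = (ant_edges G)\<inverse>" by auto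
  then have *: "reach ((ant_edges G)\<inverse>) {} (X \<union> Y \<union> I) =
      {v. \<exists>s\<in>X \<union> Y \<union> I. (v, s) \<in> (ant_edges G)\<^sup>*}"
    by (auto simp: reach_def rtrancl_converse)
  have "v \<in> nodes G" if "s \<in> X \<union> Y \<union> I" "(v, s) \<in> (ant_edges G)\<^sup>*" for v s
    using that(2,1)
  proof (cases rule: converse_rtranclE)
    case base
    then show ?thesis using that(1) subset_less nodes_less by auto
  next
    case (step y)
    then show ?thesis using edges_in_nodes by (auto simp: ant_edges_def)
  qed
  then show ?thesis unfolding * M_def antset_def by blast
qed

lemma sem_anterior:
  assumes t: "tables m" and z: "m 24 = (\<lambda>_. 0)"
  shows "mat N (sem inp anterior_com m 24) = (ant_edges G)\<inverse>"
proof -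
  define Q where "Q i j = (if (i, j) \<in> ant_edges G then {j * N + i} else {})" for i j
  have *: "sem inp anterior_com m 24 a \<noteq> 0 \<longleftrightarrow> m 24 a \<noteq> 0 \<or> (\<exists>i<n. \<exists>j<n. a \<in> Q i j)" for a
    unfolding anterior_com_def
  proof (rule sem_pairs)
    fix s i j a
    assume ij: "i < n" "j < n" "s 12 0 = i" "s 13 0 = j"
      and fr: "\<And>z. z \<notin> {12, 13, 24} \<Longrightarrow> s z = m z"
    have ts: "tables s" using t by (rule tables_cong) (auto intro: fr)
    have "s 23 j = j * N" using ts ij by (simp add: tables_def)
    then show "sem inp (If (Plus (dir_exp 12 13) (und_exp 12 13))
        (Put 24 (Plus (Arr 23 (Var 13)) (Var 12)) (Num 1)) Skip) s 24 a \<noteq> 0 \<longleftrightarrow>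
        s 24 a \<noteq> 0 \<or> a \<in> Q i j"
      using eval_edges[OF ts ij(3,4,1,2)] ij by (auto simp: Q_def ant_edges_def upd_apply)
  qed (use t in \<open>auto simp: tables_def\<close>)
  have "(u, w) \<in> mat N (sem inp anterior_com m 24) \<longleftrightarrow> (w, u) \<in> ant_edges G" for u w
  proof -
    have less: "(w, u) \<in> ant_edges G \<Longrightarrow> w < n \<and> u < n"
      using edges_in_nodes nodes_less by (auto simp: ant_edges_def)
    have "(u, w) \<in> mat N (sem inp anterior_com m 24) \<longleftrightarrow>
        u < N \<and> w < N \<and> (\<exists>i<n. \<exists>j<n. u * N + w \<in> Q i j)"
      using * z by (simp add: mat_def)
    also have "\<dots> \<longleftrightarrow> u < N \<and> w < N \<and> (\<exists>i<n. \<exists>j<n. u = j \<and> w = i \<and> (i, j) \<in> ant_edges G)"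
      using row_index_inj[of w N] by (auto simp: Q_def split: if_splits)
    also have "\<dots> \<longleftrightarrow> (w, u) \<in> ant_edges G" using less by auto
    finally show ?thesis .
  qed
  then show ?thesis by auto
qed

lemma sem_edges:
  assumes t: "tables m" and z: "m 25 = (\<lambda>_. 0)"
    and MI: "arr_set N (m 31) = M" "arr_set N (m 30) = I"
  shows "mat N (sem inp (pairs_com edge_com) m 25) = E"
proof -
  \<comment> \<open>What the ordered pair \<open>(i, j)\<close> contributes to \<open>E\<close>;
    \<open>Q\<close> turns the same pairs into matrix positions.\<close>
  define P where "P i j =
    (if i \<in> M \<and> j \<in> M then
       (if i \<notin> I \<and> j \<notin> I \<and> adjacent G i j then {(i, j)} else {}) \<union>
       (if i \<notin> I \<and> arr i j then {(i, n + j), (n + j, i)} else {}) \<union>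
       (if (i, j) \<in> bid G then {(n + i, n + j)} else {})
     else {})" for i j
  define Q where "Q i j = (\<lambda>(u, w). u * N + w) ` P i j" for i j
  have *: "sem inp (pairs_com edge_com) m 25 a \<noteq> 0 \<longleftrightarrow> m 25 a \<noteq> 0 \<or> (\<exists>i<n. \<exists>j<n. a \<in> Q i j)" for a
  proof (rule sem_pairs)
    fix s i j a
    assume ij: "i < n" "j < n" "s 12 0 = i" "s 13 0 = j"
      and fr: "\<And>z. z \<notin> {12, 13, 25} \<Longrightarrow> s z = m z"
    have ts: "tables s" using t by (rule tables_cong) (auto intro: fr)
    have tb: "s 23 i = i * N" "s 23 (n + i) = (n + i) * N" "s 23 (n + j) = (n + j) * N" "s 9 0 = n"
      using ts ij by (auto simp: tables_def)
    have b: "s 31 k \<noteq> 0 \<longleftrightarrow> k \<in> M" "s 30 k \<noteq> 0 \<longleftrightarrow> k \<in> I" if "k < n" for k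
    proof -
      have "k \<in> arr_set N f \<longleftrightarrow> f k \<noteq> 0" for f using that by (simp add: arr_set_def)
      from this[of "m 31"] this[of "m 30"]
      show "s 31 k \<noteq> 0 \<longleftrightarrow> k \<in> M" "s 30 k \<noteq> 0 \<longleftrightarrow> k \<in> I"
        unfolding MI using fr[of 31] fr[of 30] by simp_all
    qed
    have ev: "0 < eval inp adjacent_exp s \<longleftrightarrow> adjacent G i j" "0 < eval inp arrow_exp s \<longleftrightarrow> arr i j"
      "0 < eval inp (bid_exp 12 13) s \<longleftrightarrow> (i, j) \<in> bid G"
      using eval_edges[OF ts ij(3,4,1,2)] eval_edges[OF ts ij(4,3,2,1)]
      by (simp_all add: adjacent_exp_def arrow_exp_def adjacent_def arrowhead_at_def)
    have ev0: "eval inp adjacent_exp s = 0 \<longleftrightarrow> \<not> adjacent G i j"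
      "eval inp arrow_exp s = 0 \<longleftrightarrow> \<not> arr i j" "eval inp (bid_exp 12 13) s = 0 \<longleftrightarrow> (i, j) \<notin> bid G"
      unfolding ev[symmetric] by simp_all
    have up: "eval inp arrow_exp (upd 25 b v s') = eval inp arrow_exp s'"
      "eval inp (bid_exp 12 13) (upd 25 b v s') = eval inp (bid_exp 12 13) s'" for b v s'
      by (simp_all add: arrow_exp_def dir_exp_def bid_exp_def upd_other)
    have b': "0 < s 31 i \<longleftrightarrow> i \<in> M" "0 < s 31 j \<longleftrightarrow> j \<in> M" "0 < s 30 i \<longleftrightarrow> i \<in> I" "0 < s 30 j \<longleftrightarrow> j \<in> I"
      using b ij by simp_all
    have run: "sem inp edge_com s =
      (if i \<in> M \<and> j \<in> M then
         (if (i, j) \<in> bid G then upd 25 ((n + i) * N + (n + j)) 1 else id)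
           (if i \<in> I then s else
             (if arr i j then upd 25 ((n + j) * N + i) 1 \<circ> upd 25 (i * N + (n + j)) 1 else id)
               (if j \<notin> I \<and> adjacent G i j then upd 25 (i * N + j) 1 s else s))
       else s)"
      unfolding edge_com_def using ij(3,4) tb by (simp add: upd_other up ev ev0 b')
    show "sem inp edge_com s 25 a \<noteq> 0 \<longleftrightarrow> s 25 a \<noteq> 0 \<or> a \<in> Q i j"
    proof -
      have Q: "a \<in> Q i j \<longleftrightarrow> i \<in> M \<and> j \<in> M \<and>
        ((i \<notin> I \<and> j \<notin> I \<and> adjacent G i j \<and> a = i * N + j) \<or>
         (i \<notin> I \<and> arr i j \<and> (a = i * N + (n + j) \<or> a = (n + j) * N + i)) \<or>
         ((i, j) \<in> bid G \<and> a = (n + i) * N + (n + j)))"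
        unfolding Q_def P_def
        by (cases "i \<in> M \<and> j \<in> M"; cases "i \<in> I"; cases "j \<notin> I \<and> adjacent G i j";
          cases "arr i j"; cases "(i, j) \<in> bid G") (simp_all, blast+)
      \<comment> \<open>Naming the four positions keeps arithmetic out of the case split; whether
        some of them coincide does not matter.\<close>
      obtain a1 a2 a3 a4 where a: "i * N + j = a1" "i * N + (n + j) = a2" "(n + j) * N + i = a3"
        "(n + i) * N + (n + j) = a4" by blast
      show ?thesis
        unfolding Q run a
        by (cases "(i, j) \<in> bid G"; cases "arr i j"; cases "j \<notin> I \<and> adjacent G i j")
          (auto simp: upd_apply)
    qed
  qed (use t in \<open>auto simp: tables_def\<close>)
  have Pm: "(u, w) \<in> P i j \<longleftrightarrow> i \<in> M \<and> j \<in> M \<and>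
    ((i \<notin> I \<and> j \<notin> I \<and> adjacent G i j \<and> u = i \<and> w = j) \<or>
     (i \<notin> I \<and> arr i j \<and> (u = i \<and> w = n + j \<or> u = n + j \<and> w = i)) \<or>
     ((i, j) \<in> bid G \<and> u = n + i \<and> w = n + j))" for u w i j
    unfolding P_def
    by (cases "i \<in> M \<and> j \<in> M"; cases "i \<in> I"; cases "j \<notin> I \<and> adjacent G i j";
      cases "arr i j"; cases "(i, j) \<in> bid G") (simp_all, blast+)
  have Pn: "i < n \<and> j < n" if "(u, w) \<in> P i j" for i j u w
    using that M_less unfolding Pm by blast
  have PN: "u < N \<and> w < N" if "(u, w) \<in> P i j" for i j u w
    using that Pn[OF that] unfolding Pm by auto
  have "(u, w) \<in> mat N (sem inp (pairs_com edge_com) m 25) \<longleftrightarrow> (\<exists>i<n. \<exists>j<n. (u, w) \<in> P i j)" for u w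
  proof -
    have "(u, w) \<in> mat N (sem inp (pairs_com edge_com) m 25) \<longleftrightarrow>
        u < N \<and> w < N \<and> (\<exists>i<n. \<exists>j<n. u * N + w \<in> Q i j)"
      using * z by (simp add: mat_def)
    moreover have "u * N + w \<in> Q i j \<longleftrightarrow> (u, w) \<in> P i j" if w: "w < N" for i j
    proof
      assume "u * N + w \<in> Q i j"
      then obtain u' w' where p: "(u', w') \<in> P i j" "u * N + w = u' * N + w'" by (auto simp: Q_def)
      then show "(u, w) \<in> P i j" using row_index_inj[OF w, of w'] PN[OF p(1)] by metis
    next
      assume "(u, w) \<in> P i j"
      then show "u * N + w \<in> Q i j" unfolding Q_def by (rule image_eqI[rotated]) simp
    qed
    ultimately show ?thesis using PN by blast
  qed
  moreover have "(\<exists>i<n. \<exists>j<n. (u, w) \<in> P i j) \<longleftrightarrow> (u, w) \<in> E" for u w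
  proof -
    have "(\<exists>i<n. \<exists>j<n. (u, w) \<in> P i j) \<longleftrightarrow> (\<exists>i j. (u, w) \<in> P i j)" using Pn by blast
    also have "\<dots> \<longleftrightarrow> (u \<in> M - I \<and> w \<in> M - I \<and> adjacent G u w) \<or>
        (\<exists>q. w = n + q \<and> u \<in> M - I \<and> q \<in> M \<and> arr u q) \<or>
        (\<exists>q. u = n + q \<and> w \<in> M - I \<and> q \<in> M \<and> arr w q) \<or>
        (\<exists>q r. u = n + q \<and> w = n + r \<and> q \<in> M \<and> r \<in> M \<and> (q, r) \<in> bid G)"
      unfolding Pm by blast
    also have "\<dots> \<longleftrightarrow> (u, w) \<in> E" unfolding E_def by simp
    finally show ?thesis .
  qed
  ultimately show ?thesis by auto
qed

end

section \<open>Initialization and the whole enumeration\<close>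

definition init_com :: com where
  "init_com = read_com ;; graph_com ;; start_com"

context separator_instance
begin

lemma sem_graph:
  assumes t: "tables m" and sets: "arr_set N (m 27) = X" "arr_set N (m 28) = Y" "arr_set N (m 30) = I"
      "arr_set N (m 35) = X \<union> Y \<union> I"
    and z: "\<And>z. z \<in> {24, 25, 29, 31, 36} \<Longrightarrow> m z = (\<lambda>_. 0)"
  shows "loaded N (sem inp graph_com m)"
proof -
  let ?e = "Minus (Minus (Inp (Plus (Num 1) (Plus (Var 10) (Var 12)))) (Arr 30 (Var 12)))
       (Minus (Num 1) (Arr 31 (Var 12)))"
  define m1 where "m1 = sem inp anterior_com m"
  define m2 where "m2 = sem inp (reach_com 24 35 36 31) m1"
  define m3 where "m3 = sem inp (mark_com 29 ?e) m2"
  define m4 where "m4 = sem inp (pairs_com edge_com) m3"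
  have s: "sem inp graph_com m = m4"
    by (simp add: graph_com_def m1_def m2_def m3_def m4_def)
  have t1: "tables m1" and t2: "tables m2" and t3: "tables m3" and t4: "tables m4"
    unfolding m4_def m3_def m2_def m1_def using t by (intro tables_sem; simp)+
  have f1: "m1 z = m z" if "z \<notin> {12, 13, 24}" for z
    using that by (simp add: m1_def sem_frame)
  have f2: "m2 z = m1 z" if "z \<notin> {12, 13, 14, 15, 16, 26, 31}" for z
    using that by (simp add: m2_def sem_frame)
  have f3: "m3 z = m2 z" if "z \<notin> {12, 29}" for z
    using that by (simp add: m3_def sem_frame)
  have f4: "m4 z = m3 z" if "z \<notin> {12, 13, 25}" for z
    using that by (simp add: m4_def sem_frame)
  have "mat N (m1 24) = (ant_edges G)\<inverse>"
    unfolding m1_def using t z by (intro sem_anterior) auto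
  moreover have "arr_set N (m1 36) = {}" using f1[of 36] z[of 36] by (simp add: arr_set_def)
  moreover have "arr_set N (m1 35) = X \<union> Y \<union> I" using f1[of 35] sets(4) by simp
  ultimately have M2: "arr_set N (m2 31) = M"
    unfolding m2_def using sem_reach[OF tables_layout[OF t1], of 24 35 36 31 inp] reach_anterior
    by simp
  have I2: "arr_set N (m2 30) = I" using f2[of 30] f1[of 30] sets(3) by simp
  have "arr_set N (m3 29) = {k. k < n \<and> k \<in> D}"
    unfolding m3_def
  proof (rule sem_mark)
    fix s k
    assume k: "k < n" "s 12 0 = k" and fr: "\<And>z. z \<notin> {12, 29} \<Longrightarrow> s z = m2 z"
    have "k \<in> arr_set N f \<longleftrightarrow> f k \<noteq> 0" for f using k(1) by (simp add: arr_set_def)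
    from this[of "m2 31"] this[of "m2 30"]
    have b: "s 31 k \<noteq> 0 \<longleftrightarrow> k \<in> M" "s 30 k \<noteq> 0 \<longleftrightarrow> k \<in> I"
      unfolding M2 I2 using fr[of 31] fr[of 30] by simp_all
    have "s 10 0 = N" using fr[of 10] t2 by (simp add: tables_def)
    then have "eval inp (Inp (Plus (Num 1) (Plus (Var 10) (Var 12)))) s = of_bool (k \<in> R)"
      using k encode_nth(4)[of k n G X Y R I] by (simp add: eval_Inp del: eval.simps(3))
    then have "eval inp ?e s = of_bool (k \<in> R) - s 30 k - (1 - s 31 k)"
      using k(2) by (simp del: eval.simps(3))
    then show "eval inp ?e s \<noteq> 0 \<longleftrightarrow> k \<in> D" using b by (auto simp: D_def)
  next
    show "m2 29 = (\<lambda>_. 0)" using f2[of 29] f1[of 29] z[of 29] by simp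
  qed (use t2 in \<open>auto simp: tables_def\<close>)
  moreover have "D \<subseteq> {..<n}" using subset_less by (auto simp: D_def)
  ultimately have D3: "arr_set N (m3 29) = D" by auto
  have "mat N (m4 25) = E"
    unfolding m4_def
  proof (rule sem_edges[OF t3])
    show "m3 25 = (\<lambda>_. 0)" using f3[of 25] f2[of 25] f1[of 25] z[of 25] by simp
    show "arr_set N (m3 31) = M" "arr_set N (m3 30) = I" using f3 M2 I2 by simp_all
  qed
  moreover have "arr_set N (m4 27) = X" "arr_set N (m4 28) = Y" "arr_set N (m4 29) = D"
    using f4 f3 f2 f1 sets D3 by simp_all
  ultimately show ?thesis using tables_layout[OF t4] by (simp add: s loaded_def)
qed

text \<open>Array 38 is still empty here, so the feasibility flag says just whether
  \<open>grow X\<close> misses \<open>Y\<close>, that is, whether any separator exists.\<close>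

lemma sem_init:
  assumes m: "m 9 0 = n" "m 10 0 = N" "m 8 0 = 3 * (N * N)" "\<And>u. u < N \<Longrightarrow> m 23 u = u * N"
    and z: "\<And>z. z \<notin> {8, 9, 10, 12, 23} \<Longrightarrow> m z = (\<lambda>_. 0)" and n2: "2 \<le> n"
  defines "s \<equiv> sem inp init_com m"
  shows "ready n N (star X) I s" "s 20 0 = 0" "s 11 0 \<noteq> 0 \<longleftrightarrow> grow X \<inter> Y = {}"
proof -
  define m1 where "m1 = sem inp read_com m"
  define m2 where "m2 = sem inp graph_com m1"
  define m3 where "m3 = sem inp (copy_com 27 39) m2"
  define m4 where "m4 = sem inp closure_com m3"
  define m5 where "m5 = sem inp (copy_com 44 47) m4"
  have s: "s = upd 11 0 (m5 19 0) m5"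
    by (simp add: s_def init_com_def start_com_def m1_def m2_def m3_def m4_def m5_def)
  note r = sem_read[OF m z n2, folded m1_def]
  have l2: "loaded N m2" unfolding m2_def using r by (intro sem_graph) auto
  have l3: "loaded N m3" and l4: "loaded N m4" and l5: "loaded N m5"
    unfolding m5_def m4_def m3_def using l2 by (intro loaded_sem; simp)+
  have N: "m2 10 0 = N" "m4 10 0 = N" using l2 l4 by (simp_all add: loaded_def layout_def)
  have f: "m5 z = m z" if "z \<in> {9, 20, 38}" for z
    using that by (auto simp: m5_def m4_def m3_def m2_def m1_def sem_frame)
  have f3: "m3 38 = m 38" by (simp add: m3_def m2_def m1_def sem_frame)
  have f30: "m5 30 = m1 30" by (simp add: m5_def m4_def m3_def m2_def sem_frame)
  have B: "arr_set N (m3 39) = X"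
    unfolding m3_def
    using sem_copy[where m = m2 and N = N and a = 27 and b = 39 and inp = inp] N(1) l2
    by (simp add: loaded_def)
  have U: "arr_set N (m3 38) = {}" using f3 z[of 38] by (simp add: arr_set_def)
  have c: "arr_set N (m4 44) = star X" "m4 19 0 \<noteq> 0 \<longleftrightarrow> grow X \<inter> Y = {}"
    using sem_closure[OF l3, where inp = inp] B U by (simp_all add: m4_def)
  have "arr_set N (m5 47) = star X"
    unfolding m5_def
    using sem_copy[where m = m4 and N = N and a = 44 and b = 47 and inp = inp] N(2) c(1) by simp
  moreover have "m5 19 = m4 19" by (simp add: m5_def sem_frame)
  moreover have "arr_set n (m5 30) = I"
  proof -
    have "arr_set n (m5 30) = arr_set N (m1 30) \<inter> {..<n}" using f30 by (auto simp: arr_set_def)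
    then show ?thesis using r(4) subset_less(4) by auto
  qed
  moreover have "loaded N s" unfolding s using l5 by (rule loaded_cong) (auto simp: upd_other)
  ultimately show "ready n N (star X) I s" "s 20 0 = 0" "s 11 0 \<noteq> 0 \<longleftrightarrow> grow X \<inter> Y = {}"
    using c(2) f[of 9] f[of 20] m(1) z[of 20] by (simp_all add: ready_def s upd_other upd_same)
qed

text \<open>Round \<open>k\<close> prints the separator of leaf \<open>k\<close>. If
  \<open>grow X\<close> meets \<open>Y\<close>, there is no side at all by
  \<open>star_least\<close>, and the loop is never entered.\<close>

lemma rounds:
  assumes m0: "ready n N (star X) I m0" "m0 20 0 = 0" "m0 11 0 \<noteq> 0 \<longleftrightarrow> grow X \<inter> Y = {}"
  shows "\<exists>K. (\<forall>k<K. (sem inp round_com ^^ k) m0 11 0 \<noteq> 0) \<and>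
    (sem inp round_com ^^ K) m0 11 0 = 0 \<and>
    distinct (map (\<lambda>k. set (outp inp round_com ((sem inp round_com ^^ k) m0))) [0..<K]) \<and>
    (\<lambda>k. set (outp inp round_com ((sem inp round_com ^^ k) m0))) ` {..<K} =
      (\<union>) I ` {S. min_sep S}"
proof (cases "grow X \<inter> Y = {}")
  case False
  have "\<not> side C" for C using star_least[of C X] side_X[of C] False by blast
  then have "{S. min_sep S} = {}" by (simp add: min_sep_image)
  then show ?thesis using m0(3) False by (intro exI[of _ 0]) simp
next
  case True
  define A where "A = star X"
  have sA: "side A" "X \<subseteq> A"
    using star_side[of X] True reach_refl[of X E "- X"] by (auto simp: A_def)
  \<comment> \<open>Every side contains \<open>star X\<close>, so all sides are solutions of this
    root.\<close>
  define s0 where "s0 = (A, {} :: nat set)"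
  define L where "L = leaves n s0"
  have "sols s0 = {C. side C}"
    using star_least[of _ X] side_X by (auto simp: sols_def s0_def A_def)
  moreover have "card (D - (fst s0 \<union> snd s0)) \<le> n"
  proof -
    have "card (D - (fst s0 \<union> snd s0)) \<le> card {..<n}"
      using subset_less by (intro card_mono) (auto simp: D_def)
    then show ?thesis by simp
  qed
  ultimately have L: "set (map fst L) = {C. side C}" "distinct (map fst L)"
    using leaves_sols[of s0 n] sA by (simp_all add: L_def s0_def)
  let ?m = "\<lambda>k. (sem inp round_com ^^ k) m0"
  let ?w = "\<lambda>k. word n (?m k)"
  let ?d = "\<lambda>k. descend (?m k 20 0) n (?w k) s0"
  \<comment> \<open>The stored word names a leaf only after the first round; before it, position
    \<open>0\<close> asks for the first leaf.\<close>
  define P where "P k \<longleftrightarrow> ready n N A I (?m k) \<and>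
      (if k = 0 then ?m k 20 0 = 0
       else fits s0 (?w k) \<and> ?m k 20 0 = last_left (?w k) \<and>
         ?m k 11 0 = last_left (?w k) \<and> drop k L = later n s0 (?w k))" for k
  have len: "length (?w k) = n" for k by (simp add: word_def)
  have next_leaf: "drop k L = fst (?d k) # later n s0 (snd (?d k))" if "P k" "k < length L" for k
  proof (cases "k = 0")
    case True
    then show ?thesis using m0(2) leaves_descend[of n s0 "?w k"] by (simp add: L_def)
  next
    case False
    then have Pk: "fits s0 (?w k)" "?m k 20 0 = last_left (?w k)" "drop k L = later n s0 (?w k)"
      using that(1) by (simp_all add: P_def)
    have "drop k L \<noteq> []" using that(2) by simp
    then show ?thesis
      unfolding Pk(3) using later_descend[OF len Pk(1)] Pk(2) by (auto split: if_splits)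
  qed
  have step: "P k" if "k \<le> length L" for k
    using that
  proof (induction k)
    case 0
    then show ?case using m0 by (simp add: P_def A_def)
  next
    case (Suc k)
    then have Pk: "P k" by simp
    then have r: "ready n N A I (?m k)" unfolding P_def by blast
    have "drop (Suc k) L = later n s0 (snd (?d k))"
      using next_leaf[OF Pk] Suc.prems by (metis Suc_le_eq drop_Suc list.sel(3) tl_drop)
    moreover have "?m (Suc k) = sem inp round_com (?m k)" by simp
    ultimately show ?case
      using sem_round[OF r, where inp = inp] fits_descend[of s0 "?m k 20 0" n "?w k"]
      by (simp add: P_def s0_def del: funpow.simps)
  qed
  have descend: "fst (?d k) = L ! k" if "k < length L" for k
    using next_leaf[OF step[OF less_imp_le[OF that]] that] that
    by (metis hd_drop_conv_nth list.sel(1))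
  have out: "set (outp inp round_com (?m k)) = I \<union> nb E (fst (L ! k))" if k: "k < length L" for k
  proof -
    have "side (fst (L ! k))" using L(1) k nth_mem by force
    then have "nb E (fst (L ! k)) \<subseteq> {..<n}"
      using side_nb_D subset_less by (fastforce simp: D_def)
    then show ?thesis
      using sem_round(5)[of n N A I "?m k", where inp = inp] step[of k] k descend[OF k]
      by (auto simp: P_def s0_def)
  qed
  have go: "?m k 11 0 \<noteq> 0" if "k < length L" for k
  proof (cases "k = 0")
    case True
    then show ?thesis using m0(3) \<open>grow X \<inter> Y = {}\<close> by simp
  next
    case False
    have "drop k L \<noteq> []" using that by simp
    then show ?thesis
      using step[of k] later_descend[OF len, of s0 k] that False
      by (auto simp: P_def split: if_splits)
  qed
  have "L \<noteq> []" using sA L(1) by auto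
  then have stop: "?m (length L) 11 0 = 0"
    using step[of "length L"] later_descend[OF len, of s0 "length L"]
    by (auto simp: P_def split: if_splits)
  have eq: "map (\<lambda>k. set (outp inp round_com (?m k))) [0..<length L] =
      map (\<lambda>C. I \<union> nb E C) (map fst L)"
    using out by (intro nth_equalityI) simp_all
  \<comment> \<open>Adding \<open>I\<close> loses nothing, as neighbourhoods of sides lie in
    \<open>D\<close>, which is disjoint from \<open>I\<close>.\<close>
  have "inj_on (\<lambda>C. I \<union> nb E C) {C. side C}"
  proof (rule inj_onI)
    fix C C' assume C: "C \<in> {C. side C}" "C' \<in> {C. side C}" and eq: "I \<union> nb E C = I \<union> nb E C'"
    have disj: "I \<inter> nb E C = {}" if "side C" for C
      using side_nb_D[OF that] by (auto simp: D_def)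
    have "nb E C = nb E C'" using eq disj[of C] disj[of C'] C by blast
    then show "C = C'" using inj_onD[OF nb_inj _ C] by blast
  qed
  then have "distinct (map (\<lambda>k. set (outp inp round_com (?m k))) [0..<length L])"
    unfolding eq using L by (simp add: distinct_map del: map_map)
  moreover have "(\<lambda>k. set (outp inp round_com (?m k))) ` {..<length L} = (\<union>) I ` {S. min_sep S}"
  proof -
    have "(\<lambda>k. set (outp inp round_com (?m k))) ` {..<length L} =
        set (map (\<lambda>k. set (outp inp round_com (?m k))) [0..<length L])"
      by (simp add: atLeast0LessThan)
    also have "\<dots> = (\<lambda>C. I \<union> nb E C) ` {C. side C}"
      unfolding eq set_map[of "\<lambda>C. I \<union> nb E C"] L(1) ..
    also have "\<dots> = (\<union>) I ` {S. min_sep S}"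
      unfolding min_sep_image image_image ..
    finally show ?thesis .
  qed
  ultimately show ?thesis using go stop by blast
qed

lemma program_correct:
  assumes n2: "2 \<le> n"
    and d: "cost N (table_com ;; init_com) + cost N round_com + 3 \<le> d"
  shows "enumerates_with_delay (program (table_com ;; init_com) round_com) inp
      {Z. minimal_m_separator G X Y I Z \<and> I \<subseteq> Z \<and> Z \<subseteq> R} d \<and>
    words_below (program (table_com ;; init_com) round_com) inp (n ^ 16)"
proof -
  define B W where "B = 3 * (N * N)" and "W = n ^ 16"
  define m where "m = sem inp table_com (\<lambda>_ _. 0)"
  define m0 where "m0 = sem inp init_com m"
  have B12: "B = 12 * (n * n)" by (simp add: B_def)
  have nn: "n \<le> n * n" by simp
  \<comment> \<open>Constants are absorbed into powers of \<open>n\<close>, which is at least 2.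
    With \<open>g = 4\<close> a word needs to hold about \<open>3072 * n^2\<close>, which is below
    \<open>2^14 * n^2\<close> and hence below \<open>n^16\<close>.\<close>
  have "(2::nat) ^ 14 \<le> n ^ 14" using n2 by (rule power_mono) simp
  then have "2 ^ 14 * (n * n) \<le> n ^ 14 * (n * n)" by (rule mult_le_mono1)
  also have "n ^ 14 * (n * n) = W" by (simp add: W_def power_numeral_reduce mult.assoc)
  finally have Wn: "16384 * (n * n) \<le> W" by simp
  have bounds: "64 * B + 64 < W" "64 * (4 * B) + 64 < W" "B < W" "64 \<le> W" "N < W" "1 \<le> B" "n \<le> B"
    using Wn nn n2 unfolding B12 by linarith+
  have inp: "v \<le> B" if "v \<in> set inp" for v
    using encode_bound[OF that] bounds(6,7) by simp
  have n1: "1 \<le> n" using n2 by simp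
  note t = sem_table[OF encode_nth(1)[of n G X Y R I] n1 refl bounds(1)[unfolded B_def], folded m_def B_def]
  \<comment> \<open>The 4 is the largest magnitude that occurs, as in \<open>adjacent_exp\<close>
    and in the input position of the bits of \<open>I\<close>.\<close>
  have static: "static 4 init_com" "static 4 round_com"
    by (simp_all add: init_com_def read_com_def graph_com_def start_com_def round_com_def
        rows_com_def mark_com_def anterior_com_def pairs_com_def edge_com_def adjacent_exp_def
        arrow_exp_def dir_exp_def und_exp_def bid_exp_def reach_com_def clear_def push_def
        entry_def copy_com_def closure_com_def nb_com_def check_com_def step_com_def pick_com_def
        turn_com_def move_com_def emit_com_def last_com_def)
  have wf: "wf_com (table_com ;; init_com)" "wf_com round_com"
    by (simp_all add: table_com_def init_com_def read_com_def graph_com_def start_com_def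
        round_com_def rows_com_def mark_com_def anterior_com_def pairs_com_def edge_com_def
        adjacent_exp_def arrow_exp_def dir_exp_def und_exp_def bid_exp_def reach_com_def clear_def
        push_def entry_def copy_com_def closure_com_def nb_com_def check_com_def step_com_def
        pick_com_def turn_com_def move_com_def emit_com_def last_com_def)
  have quiet: "silent (table_com ;; init_com)"
    by (simp add: table_com_def init_com_def read_com_def graph_com_def start_com_def
        rows_com_def mark_com_def anterior_com_def pairs_com_def edge_com_def reach_com_def
        clear_def push_def copy_com_def closure_com_def nb_com_def check_com_def)
  have safe: "safe W N inp c s \<and> bounded_store B N (sem inp c s)"
    if "static 4 c" "bounded_store B N s" for c s
    by (rule static_safe[where g = 4]) (use inp bounds that in auto)
  have s0: "safe W N inp init_com m \<and> bounded_store B N m0"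
    unfolding m0_def using safe static(1) t(6) by blast
  have "bounded_store B N ((sem inp round_com ^^ k) m0)" for k
  proof (induction k)
    case (Suc k)
    then show ?case using safe[OF static(2)] by simp
  qed (use s0 in simp)
  then have rs: "safe W N inp round_com ((sem inp round_com ^^ k) m0)" for k
    using safe[OF static(2)] by blast
  have i: "ready n N (star X) I m0" "m0 20 0 = 0" "m0 11 0 \<noteq> 0 \<longleftrightarrow> grow X \<inter> Y = {}"
    using sem_init[OF t(1-3)[unfolded B_def] t(4,5) n2] unfolding m0_def by blast+
  obtain K where
    K: "\<And>k. k < K \<Longrightarrow> (sem inp round_com ^^ k) m0 11 0 \<noteq> 0" "(sem inp round_com ^^ K) m0 11 0 = 0"
    "distinct (map (\<lambda>k. set (outp inp round_com ((sem inp round_com ^^ k) m0))) [0..<K])"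
    "(\<lambda>k. set (outp inp round_com ((sem inp round_com ^^ k) m0))) ` {..<K} =
      (\<union>) I ` {S. min_sep S}"
    using rounds[OF i] by blast
  have m0: "sem inp (table_com ;; init_com) (\<lambda>_ _. 0) = m0" by (simp add: m0_def m_def)
  have "safe W N inp (table_com ;; init_com) (\<lambda>_ _. 0)"
    using t(7) s0 by (simp add: m_def)
  then show ?thesis
    unfolding minimal_m_separators W_def[symmetric]
    using program_enumerates[OF wf bounds(4,5) _ outp_silent[OF quiet] _ _ _ _ d, of inp K] K rs
    unfolding m0 by blast
qed

end

theorem proposition10:
  "\<exists>P c k. \<forall>(n::nat) (G::nat mixed_graph) X Y R I.
     ancestral_graph G \<and> nodes G = {0..<n} \<and>
     X \<subseteq> nodes G \<and> Y \<subseteq> nodes G \<and> R \<subseteq> nodes G \<and>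
     X \<inter> Y = {} \<and> X \<inter> R = {} \<and> Y \<inter> R = {} \<and>
     X \<noteq> {} \<and> Y \<noteq> {} \<and> I \<subseteq> R \<longrightarrow>
       enumerates_with_delay P (encode_instance n G X Y R I)
         {Z. minimal_m_separator G X Y I Z \<and> I \<subseteq> Z \<and> Z \<subseteq> R} (c * n ^ 3) \<and>
       words_below P (encode_instance n G X Y R I) (n ^ k)"
proof -
  let ?c0 = "table_com ;; init_com"
  \<comment> \<open>Loops have at most \<open>2 * n\<close> iterations, and cubing this gives the
    factor 8. The 3 covers the instructions around the two commands.\<close>
  define c where "c = 8 * (cost_factor ?c0 + cost_factor round_com) + 3"
  have depth: "loop_depth ?c0 \<le> 3" "loop_depth round_com \<le> 3"
    by (simp_all add: table_com_def init_com_def read_com_def graph_com_def start_com_def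
        round_com_def rows_com_def mark_com_def anterior_com_def pairs_com_def edge_com_def
        reach_com_def clear_def push_def copy_com_def closure_com_def nb_com_def check_com_def
        step_com_def pick_com_def turn_com_def move_com_def emit_com_def last_com_def)
  have "enumerates_with_delay (program ?c0 round_com) (encode_instance n G X Y R I)
         {Z. minimal_m_separator G X Y I Z \<and> I \<subseteq> Z \<and> Z \<subseteq> R} (c * n ^ 3) \<and>
       words_below (program ?c0 round_com) (encode_instance n G X Y R I) (n ^ 16)"
    if A: "ancestral_graph G \<and> nodes G = {0..<n} \<and>
     X \<subseteq> nodes G \<and> Y \<subseteq> nodes G \<and> R \<subseteq> nodes G \<and>
     X \<inter> Y = {} \<and> X \<inter> R = {} \<and> Y \<inter> R = {} \<and>
     X \<noteq> {} \<and> Y \<noteq> {} \<and> I \<subseteq> R" for n G X Y R I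
  proof -
    interpret separator_instance G n X Y R I
      by unfold_locales (use A in auto)
    \<comment> \<open>Two disjoint non-empty sets force at least two nodes, without which powers of
      \<open>n\<close> could not absorb constants.\<close>
    obtain x y where "x \<in> X" "y \<in> Y" using A by blast
    then have "x < n" "y < n" "x \<noteq> y" using A by auto
    then have n2: "2 \<le> n" by simp
    have "cost (2 * n) ?c0 \<le> cost_factor ?c0 * (2 * n) ^ 3"
      "cost (2 * n) round_com \<le> cost_factor round_com * (2 * n) ^ 3"
      using n2 depth by (simp_all only: cost_le)
    moreover have "(2 * n) ^ 3 = 8 * n ^ 3" by (simp add: power_mult_distrib)
    moreover have "3 \<le> 3 * n ^ 3" using n2 by simp
    ultimately have "cost (2 * n) ?c0 + cost (2 * n) round_com + 3 \<le> c * n ^ 3"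
      by (simp add: c_def algebra_simps)
    then show ?thesis using program_correct[OF n2] by blast
  qed
  then show ?thesis by blast
qed

end
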